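(* Let $A\in\mathbb{R}^{n\times n}$ be real and normal with simple complex spectrum. Choose a unitary eigenbasis $(v_1,\ldots,v_n)$ of the complexification $A_{\mathbb{C}}$, ordered so that $A_{\mathbb{C}}v_k=\lambda_kv_k$ and compatible with complex conjugation. Set $$\chi_A(z)=\det(z\,\mathrm{Id}-A),\qquad h_k=\vert\chi_A'(\lambda_k)\vert,\qquad H=\sum_{k=1}^n\frac1{h_k}.$$ For a unit vector $b\in\mathbb{R}^n$ define its spectral weights $\pi_j(b)=\vert\langle b,v_j\rangle\vert^2$, $j\in\{1,\ldots,n\}$ (they sum to one and coincide on conjugate eigenpairs). Then: (i) The unique spectral-weight vector maximizing $d_n(A,b)$ over unit vectors $b\in\mathbb{R}^n$ is given by $\pi_j^\star=\dfrac{1}{Hh_j}$ for all $j\in\{1,\ldots,n\}$. (ii) For every sufficiently small $T>0$, all unit vectors $b_T$ attaining the maximum $\gamma_1(A,T)=\max_{\Vert b\Vert=1}\lambda_{\min}(G_T(A,b))$ have the same spectral weights $\pi_j(T)=\vert\langle b_T,v_j\rangle\vert^2$. This weight vector depends analytically on $T$ and satisfies, as $T\to0^+$, $$\pi_j(T)=\pi_j^\star\Big(1+\frac{\alpha_n(A)-\operatorname{Re}\lambda_j}{2}T\Big)+\mathrm{O}(T^2).$$ (iii) Moreover, $$\delta_n(A)=\frac1H,\qquad \alpha_n(A)=\frac1H\sum_{j=1}^n\frac{\operatorname{Re}\lambda_j}{h_j}.$$ (iv) With $\kappa_n=\frac{((n-1)!)^2}{(2n-1)!(2n-2)!}$, as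 $T\to0^+$, $$\gamma_1(A,T)=\kappa_n\delta_n(A)^2T^{2n-1}\big(1+\alpha_n(A)T+\mathrm{O}(T^2)\big),$$ $$\frac{\gamma_1(A,T)}{\gamma_{\mathrm{rel}}(A,T)}=n\kappa_n\delta_n(A)^2T^{2n-2}\Big(1+\Big(\alpha_n(A)-\frac{\operatorname{tr}A}{n}\Big)T+\mathrm{O}(T^2)\Big).$$
   Context: For $A\in\mathbb{R}^{n\times n}$, $T>0$ and $b\in\mathbb{R}^n$, let $G_T(A,b)=\int_0^Te^{tA}bb^\top e^{tA^\top}\,dt$, $\gamma_1(A,T)=\max_{\Vert b\Vert=1}\lambda_{\min}(G_T(A,b))$, and $\gamma_{\mathrm{rel}}(A,T)=\max_{X\succeq0,\ \operatorname{tr}X=1}\lambda_{\min}\big(\int_0^Te^{tA}Xe^{tA^\top}dt\big)$, where $X$ ranges over real symmetric $n\times n$ matrices. A vector $b$ is cyclic for $A$ if $\operatorname{span}(b,Ab,\ldots,A^{n-1}b)=\mathbb{R}^n$. For a unit cyclic vector $b$, $d_n(A,b)=\operatorname{dist}(A^{n-1}b,\operatorname{span}(b,\ldots,A^{n-2}b))$ (the span being $\{0\}$ when $n=1$); $d_n(A,b)=0$ for a unit vector $b$ that is not cyclic. $\delta_n(A)=\max_{\Vert b\Vert=1}d_n(A,b)$ and $\mathcal{M}(A)=\{b\in\mathbb{R}^n\mid\Vert b\Vert=1,\ d_n(A,b)=\delta_n(A)\}$. For a cyclic vector $b$, $q_n(A,b)$ is the last column of $Q$ in the QR factorization $(b,Ab,\ldots,A^{n-1}b)=QR$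 with positive diagonal in $R$. $\alpha_n(A)=\max_{b\in\mathcal{M}(A)}q_n(A,b)^\top Aq_n(A,b)$ (a matrix with the stated hypotheses admits cyclic vectors, so $\delta_n(A)>0$ and all vectors in $\mathcal{M}(A)$ are cyclic). *)

theory Defs
  imports "HOL-Analysis.Analysis" "HOL-Library.Landau_Symbols"
begin

text \<open>
  The dimension is \<open>n = CARD('n)\<close>. The library operations \<open>*\<close>, \<open>^\<close> and \<open>exp\<close> on
  \<open>real^'n^'n\<close> act entrywise, so powers and the exponential for the matrix product are
  defined here.
\<close>

definition mpow :: "'a::semiring_1^'n^'n \<Rightarrow> nat \<Rightarrow> 'a^'n^'n" where
  "mpow A k = (((**) A) ^^ k) (mat 1)"

definition mexp :: "real^'n^'n \<Rightarrow> real^'n^'n" where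
  "mexp A = (\<Sum>k. (1 / fact k) *\<^sub>R mpow A k)"

definition normal_matrix :: "real^'n^'n \<Rightarrow> bool" where
  "normal_matrix A \<longleftrightarrow> A ** transpose A = transpose A ** A"

definition psd :: "real^'n^'n \<Rightarrow> bool" where
  "psd X \<longleftrightarrow> transpose X = X \<and> (\<forall>x. 0 \<le> x \<bullet> (X *v x))"

text \<open>Smallest eigenvalue; used for symmetric matrices only.\<close>

definition lambda_min :: "real^'n^'n \<Rightarrow> real" where
  "lambda_min M = Min {l. \<exists>x. x \<noteq> 0 \<and> M *v x = l *s x}"

definition gram_int :: "real^'n^'n \<Rightarrow> real \<Rightarrow> real^'n^'n \<Rightarrow> real^'n^'n" where
  "gram_int A T X =
     integral {0..T} (\<lambda>t. mexp (t *\<^sub>R A) ** X ** mexp (t *\<^sub>R transpose A))"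

definition gramian :: "real^'n^'n \<Rightarrow> real \<Rightarrow> real^'n \<Rightarrow> real^'n^'n" where
  "gramian A T b =
     gram_int A T ((columnvector b :: real^1^'n) ** (rowvector b :: real^'n^1))"

text \<open>
  All maxima over infinite sets are written as suprema. Those over unit vectors and over
  trace-one positive semidefinite matrices are taken over compact sets.
\<close>

definition gamma_1 :: "real^'n^'n \<Rightarrow> real \<Rightarrow> real" where
  "gamma_1 A T = (SUP b\<in>{b. norm b = 1}. lambda_min (gramian A T b))"

definition gamma_1_maximizers :: "real^'n^'n \<Rightarrow> real \<Rightarrow> (real^'n) set" where
  "gamma_1_maximizers A T = {b. norm b = 1 \<and> lambda_min (gramian A T b) = gamma_1 A T}"

definition gamma_rel :: "real^'n^'n \<Rightarrow> real \<Rightarrow> real" where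
  "gamma_rel A T = (SUP X\<in>{X. psd X \<and> trace X = 1}. lambda_min (gram_int A T X))"

definition krylov :: "real^'n^'n \<Rightarrow> real^'n \<Rightarrow> nat \<Rightarrow> real^'n" where
  "krylov A b k = mpow A k *v b"

definition cyclic_vector :: "real^'n^'n \<Rightarrow> real^'n \<Rightarrow> bool" where
  "cyclic_vector A b \<longleftrightarrow> span (krylov A b ` {..<CARD('n)}) = UNIV"

definition d_n :: "real^'n^'n \<Rightarrow> real^'n \<Rightarrow> real" where
  "d_n A b =
     (if cyclic_vector A b
      then infdist (krylov A b (CARD('n) - 1)) (span (krylov A b ` {..<CARD('n) - 1}))
      else 0)"

definition delta_n :: "real^'n^'n \<Rightarrow> real" where
  "delta_n A = (SUP b\<in>{b. norm b = 1}. d_n A b)"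

definition d_n_maximizers :: "real^'n^'n \<Rightarrow> (real^'n) set" where
  "d_n_maximizers A = {b. norm b = 1 \<and> d_n A b = delta_n A}"

text \<open>
  QR factorization with positive diagonal of the matrix with columns \<open>a 0, \<dots>, a (n - 1)\<close>:
  \<open>q i\<close> is the \<open>i\<close>-th column of \<open>Q\<close> and \<open>r i j\<close> the \<open>(i, j)\<close> entry of \<open>R\<close>. The columns are
  indexed by \<open>nat\<close> because the index type \<open>'n\<close> carries no order.
\<close>

definition is_QR ::
  "(nat \<Rightarrow> real^'n) \<Rightarrow> (nat \<Rightarrow> real^'n) \<Rightarrow> (nat \<Rightarrow> nat \<Rightarrow> real) \<Rightarrow> bool" where
  "is_QR a q r \<longleftrightarrow>
     (\<forall>i<CARD('n). \<forall>j<CARD('n). q i \<bullet> q j = (if i = j then 1 else 0)) \<and>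
     (\<forall>j<CARD('n). a j = (\<Sum>i<CARD('n). r i j *\<^sub>R q i)) \<and>
     (\<forall>i<CARD('n). \<forall>j<i. r i j = 0) \<and>
     (\<forall>i<CARD('n). 0 < r i i)"

definition q_n :: "real^'n^'n \<Rightarrow> real^'n \<Rightarrow> real^'n" where
  "q_n A b = (THE u. \<exists>q r. is_QR (krylov A b) q r \<and> u = q (CARD('n) - 1))"

definition alpha_n :: "real^'n^'n \<Rightarrow> real" where
  "alpha_n A = (SUP b\<in>d_n_maximizers A. q_n A b \<bullet> (A *v q_n A b))"

definition cvec :: "real^'n \<Rightarrow> complex^'n" where
  "cvec b = (\<chi> i. complex_of_real (b $ i))"

definition cmat :: "real^'n^'n \<Rightarrow> complex^'n^'n" where
  "cmat A = map_matrix complex_of_real A"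

definition cnj_vec :: "complex^'n \<Rightarrow> complex^'n" where
  "cnj_vec x = (\<chi> i. cnj (x $ i))"

text \<open>The library inner product on \<open>complex^'n\<close> is only the real part of this one.\<close>

definition herm :: "complex^'n \<Rightarrow> complex^'n \<Rightarrow> complex" where
  "herm x y = (\<Sum>i\<in>UNIV. x $ i * cnj (y $ i))"

definition simple_spectrum :: "complex^'n^'n \<Rightarrow> bool" where
  "simple_spectrum M \<longleftrightarrow> card {z. \<exists>x. x \<noteq> 0 \<and> M *v x = z *s x} = CARD('n)"

text \<open>
  A unitary eigenbasis \<open>v\<close> with eigenvalues \<open>lam\<close>, closed under entrywise conjugation. When
  the spectrum is simple, this makes the eigenvectors of real eigenvalues real.
\<close>

definition unitary_eigenbasis ::
  "real^'n^'n \<Rightarrow> ('n \<Rightarrow> complex^'n) \<Rightarrow> ('n \<Rightarrow> complex) \<Rightarrow> bool" where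
  "unitary_eigenbasis A v lam \<longleftrightarrow>
     (\<forall>j k. herm (v j) (v k) = (if j = k then 1 else 0)) \<and>
     (\<forall>k. cmat A *v v k = lam k *s v k) \<and>
     (\<forall>k. \<exists>l. v l = cnj_vec (v k))"

definition spectral_weights :: "('n \<Rightarrow> complex^'n) \<Rightarrow> real^'n \<Rightarrow> 'n \<Rightarrow> real" where
  "spectral_weights v b j = (norm (herm (cvec b) (v j)))\<^sup>2"

definition char_fun :: "real^'n^'n \<Rightarrow> complex \<Rightarrow> complex" where
  "char_fun A z = det (mat z - cmat A)"

definition real_analytic_on :: "(real \<Rightarrow> real) \<Rightarrow> real set \<Rightarrow> bool" where
  "real_analytic_on f S \<longleftrightarrow>
     (\<forall>x\<in>S. \<exists>e>0. \<exists>a. \<forall>y. \<bar>y - x\<bar> < e \<longrightarrow> (\<lambda>k. a k * (y - x) ^ k) sums f y)"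

definition kappa :: "nat \<Rightarrow> real" where
  "kappa n = (fact (n - 1))\<^sup>2 / (fact (2 * n - 1) * fact (2 * n - 2))"

end

theory Submission
  imports Defs "HOL-Complex_Analysis.Cauchy_Integral_Formula"
begin

text \<open>
  In the eigenbasis, the quadratic form of \<open>gramian A T b\<close> at \<open>x\<close> is the squared norm in
  \<open>L\<^sup>2(0, T)\<close> of the exponential sum with coefficients \<open>c\<^sub>j = b\<^sub>j * cnj x\<^sub>j\<close>, a
  Hermitian form in \<open>c\<close> with Gram matrix \<open>M\<close>. If \<open>M \<ge> diag (1 / y)\<close> with equality at a vector
  of moduli \<open>y\<close>, then the Cauchy-Schwarz inequality shows that \<open>gamma_1 A T\<close> is the reciprocal of the
  sum of \<open>y\<close>, attained exactly at the spectral weights proportional to \<open>y\<close>.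

  Dually, \<open>diag y - W\<close> with \<open>W\<close> the inverse of \<open>M\<close> must be a graph Laplacian up to unitary phases,
  so phases are needed that make the row sums of \<open>W\<close> real. After centring the time interval,
  \<open>T ^ (2 * n - 1) * W\<close> is even in \<open>T\<close> up to explicit exponential factors and extends
  holomorphically to \<open>T = 0\<close> with the rank-one value \<open>cnj w\<^sub>j * w\<^sub>k / kappa n\<close>, where \<open>w\<^sub>j\<close> is
  the reciprocal of the derivative of the characteristic polynomial at the \<open>j\<close>-th eigenvalue; the
  constant comes from the Legendre polynomials. The phases then are the fixed point of a contraction
  that is holomorphic in \<open>T\<close>, and evenness yields the first-order term of \<open>y\<close>.

  Similarly, \<open>1 / (d_n A b)\<^sup>2\<close> is the sum of \<open>\<bar>w\<^sub>j\<bar>\<^sup>2 / \<pi>\<^sub>j\<close> over the spectral weights \<open>\<pi>\<^sub>j\<close> of \<open>b\<close>, and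
  \<open>gamma_rel A T\<close> is the harmonic combination of the energies of the individual exponentials.
\<close>

section \<open>Moments on the unit interval and Legendre polynomials\<close>

text \<open>As \<open>T\<close> tends to 0 the exponentials merge and \<open>M\<close> degenerates;
  only its rescaled inverse has a useful limit, which is why optimality is tested on
  \<open>W\<close>. Up to a power of \<open>T\<close>, the bound \<open>M >= diag (1 / y)\<close>
  says \<open>W <= diag y\<close>, and an equality vector with entries \<open>y j * U j\<close>,
  \<open>U\<close> unimodular, puts \<open>U\<close> into the kernel of \<open>diag y - W\<close>.
  After conjugation by \<open>U\<close> the constants lie in the kernel, that is, the row sums are
  \<open>y\<close>. Once the phases of the \<open>w j\<close> are removed, the rank-one limit has
  positive entries, so \<open>diag y - W\<close> starts as the Laplacian of a complete graph with
  positive edge weights. Its nonnegativity survives small Hermitian perturbations whose row sums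
  stay real; the phases serve to arrange this. The vectors \<open>b\<close> and \<open>x\<close> are
  real, so every construction has to respect complex conjugation, which permutes the eigenvalues.
  Requiring inverse phases at conjugate eigenvalues also removes the free global phase and makes the
  phases locally unique.\<close>

text \<open>\<open>nu k\<close>, \<open>mom p\<close> and \<open>sinhc z\<close> are the integrals of \<open>s ^ k\<close>, \<open>poly p s\<close> and \<open>exp (z * s)\<close> over
  \<open>- 1/2 \<le> s \<le> 1/2\<close>.\<close>

definition nu :: "nat \<Rightarrow> complex" where
  "nu k = ((1/2) ^ Suc k - (-1/2) ^ Suc k) / of_nat (Suc k)"

definition sinhc :: "complex \<Rightarrow> complex" where
  "sinhc z = (if z = 0 then 1 else (exp (z/2) - exp (- z/2)) / z)"

lemma sinhc_minus: "sinhc (- z) = sinhc z"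
  by (simp add: sinhc_def divide_simps)

lemma sinhc_cnj: "sinhc (cnj z) = cnj (sinhc z)"
  by (simp add: sinhc_def exp_cnj)

lemma sinhc_sums: "(\<lambda>k. nu k / fact k * z ^ k) sums sinhc z"
proof (cases "z = 0")
  case True
  have "(\<lambda>k. nu k / fact k * 0 ^ k) sums (nu 0 / fact 0)"
    using powser_sums_zero[of "\<lambda>k. nu k / fact k"] by simp
  then show ?thesis using True by (simp add: sinhc_def nu_def)
next
  case False
  have 1: "(\<lambda>k. (z/2) ^ k /\<^sub>R fact k - (- z/2) ^ k /\<^sub>R fact k) sums (exp (z/2) - exp (- z/2))"
    by (intro sums_diff exp_converges)
  have "(\<lambda>k. (z/2) ^ Suc k /\<^sub>R fact (Suc k) - (- z/2) ^ Suc k /\<^sub>R fact (Suc k)) sums (exp (z/2) - exp (- z/2))"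
    using 1 by (subst sums_Suc_iff) simp
  then have "(\<lambda>k. ((z/2) ^ Suc k /\<^sub>R fact (Suc k) - (- z/2) ^ Suc k /\<^sub>R fact (Suc k)) / z) sums ((exp (z/2) - exp (- z/2)) / z)"
    by (rule sums_divide)
  moreover have "((z/2) ^ Suc k /\<^sub>R fact (Suc k) - (- z/2) ^ Suc k /\<^sub>R fact (Suc k)) / z = nu k / fact k * z ^ k" for k
  proof -
    have a: "(z/2) ^ Suc k = z * z ^ k * (1/2) ^ Suc k" "(- z/2) ^ Suc k = z * z ^ k * (-1/2) ^ Suc k"
      using power_mult_distrib[of z "1/2" "Suc k"] power_mult_distrib[of z "-1/2" "Suc k"] by simp_all
    show ?thesis
      unfolding a nu_def scaleR_conv_of_real using False
      by (simp add: field_simps del: power_Suc of_nat_Suc)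
  qed
  ultimately show ?thesis using False by (simp add: sinhc_def)
qed

definition mom :: "complex poly \<Rightarrow> complex" where
  "mom p = (\<Sum>k\<le>degree p. coeff p k * nu k)"

lemma mom_le: "degree p \<le> N \<Longrightarrow> mom p = (\<Sum>k\<le>N. coeff p k * nu k)"
  unfolding mom_def by (rule sum.mono_neutral_left) (auto simp: coeff_eq_0)

lemma mom_add: "mom (p + q) = mom p + mom q"
  using mom_le[of p "max (degree p) (degree q)"] mom_le[of q "max (degree p) (degree q)"]
    mom_le[of "p + q" "max (degree p) (degree q)"] degree_add_le_max[of p q]
  by (simp add: sum.distrib algebra_simps)

lemma mom_smult: "mom (smult c p) = c * mom p"
  using mom_le[of "smult c p" "degree p"] by (simp add: mom_def sum_distrib_left mult.assoc)

lemma mom_0 [simp]: "mom 0 = 0"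
  by (simp add: mom_def)

lemma mom_sum: "mom (\<Sum>i\<in>I. f i) = (\<Sum>i\<in>I. mom (f i))"
  by (induction I rule: infinite_finite_induct) (auto simp: mom_add)

text \<open>The fundamental theorem of calculus; it turns integration by parts into a polynomial
  identity.\<close>

lemma mom_pderiv: "mom (pderiv p) = poly p (1/2) - poly p (- (1/2))"
proof -
  have "mom (pderiv p) = (\<Sum>k\<le>degree p. coeff (pderiv p) k * nu k)"
    by (rule mom_le) (simp add: degree_pderiv)
  also have "\<dots> = (\<Sum>k\<le>degree p. coeff p (Suc k) * ((1/2) ^ Suc k - (-1/2) ^ Suc k))"
    by (rule sum.cong) (auto simp: coeff_pderiv nu_def simp del: of_nat_Suc power_Suc)
  also have "\<dots> = (\<Sum>k\<le>Suc (degree p). coeff p k * ((1/2) ^ k - (-1/2) ^ k))"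
    by (subst sum.atMost_Suc_shift) simp
  also have "\<dots> = poly p (1/2) - poly p (- (1/2))"
    by (simp add: poly_altdef coeff_eq_0 algebra_simps sum_subtractf)
  finally show ?thesis .
qed

lemma mom_monom_mult:
  assumes "degree p < n"
  shows "mom (monom 1 i * p) = (\<Sum>l<n. coeff p l * nu (i + l))"
proof -
  have "p = (\<Sum>l<n. monom (coeff p l) l)"
    using assms by (subst poly_as_sum_of_monoms'[symmetric, of p "n - 1"])
      (auto simp: lessThan_Suc_atMost[symmetric])
  then have "monom 1 i * p = monom 1 i * (\<Sum>l<n. monom (coeff p l) l)" by (rule arg_cong)
  also have "\<dots> = (\<Sum>l<n. smult (coeff p l) (monom 1 (i + l)))"
    by (simp add: sum_distrib_left mult_monom smult_monom)
  finally have "mom (monom 1 i * p) = mom (\<Sum>l<n. smult (coeff p l) (monom 1 (i + l)))" by (rule arg_cong)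
  also have "\<dots> = (\<Sum>l<n. coeff p l * nu (i + l))"
    by (simp add: mom_sum mom_smult) (simp add: mom_def degree_monom_eq if_distrib if_distribR sum.delta cong: if_cong)
  finally show ?thesis .
qed

lemma mom_by_parts:
  assumes "poly p (1/2) = 0" "poly p (- (1/2)) = 0"
  shows "mom (pderiv p * q) = - mom (p * pderiv q)"
  using mom_pderiv[of "p * q"] assms by (simp add: pderiv_mult mom_add mult.commute add_eq_0_iff)

text \<open>The polynomial \<open>(s - 1/2) ^ m * (s + 1/2) ^ m\<close> of Rodrigues' formula. Its
  zeros of order \<open>m\<close> at both endpoints remove the boundary terms in \<open>m\<close>
  integrations by parts.\<close>

definition bump :: "nat \<Rightarrow> complex poly" where
  "bump m = [:-1/4, 0, 1:] ^ m"

text \<open>Each differentiation costs at most one factor \<open>p\<close>, by the product rule on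
  \<open>p ^ Suc k * g\<close>.\<close>

lemma power_dvd_higher_pderiv:
  fixes p f :: "'a::idom poly"
  assumes "p ^ (k + j) dvd f"
  shows "p ^ k dvd (pderiv ^^ j) f"
  using assms
proof (induction j arbitrary: k)
  case 0
  then show ?case by simp
next
  case (Suc j)
  have "p ^ Suc k dvd (pderiv ^^ j) f" by (rule Suc.IH) (use Suc.prems in simp)
  then obtain g where g: "(pderiv ^^ j) f = p ^ Suc k * g" by (auto elim: dvdE)
  have "pderiv (p ^ Suc k * g) = p ^ k * (p * pderiv g) + p ^ k * (smult (of_nat (Suc k)) (g * pderiv p))"
    unfolding pderiv_mult pderiv_power_Suc by (simp add: mult.assoc mult.left_commute del: of_nat_Suc)
  then have "p ^ k dvd pderiv (p ^ Suc k * g)" by (metis dvd_add dvd_triv_left)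
  then show ?case using g by (simp only: funpow.simps o_def)
qed

lemma bump_boundary:
  assumes "k < m"
  shows "poly ((pderiv ^^ k) (bump m)) (1/2) = 0" "poly ((pderiv ^^ k) (bump m)) (- (1/2)) = 0"
proof -
  have "[:-1/4, 0, 1:] ^ (1 + k) dvd bump m" unfolding bump_def using assms by (intro le_imp_power_dvd) simp
  then have "[:-1/4, 0, 1:] ^ 1 dvd (pderiv ^^ k) (bump m)" by (rule power_dvd_higher_pderiv)
  then obtain q where "(pderiv ^^ k) (bump m) = [:-1/4, 0, 1:] * q" by (auto elim: dvdE)
  then show "poly ((pderiv ^^ k) (bump m)) (1/2) = 0" "poly ((pderiv ^^ k) (bump m)) (- (1/2)) = 0"
    by simp_all
qed

lemma mom_higher_pderiv_bump:
  "j \<le> m \<Longrightarrow> mom ((pderiv ^^ m) (bump m) * q) = (-1) ^ j * mom ((pderiv ^^ (m - j)) (bump m) * (pderiv ^^ j) q)"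
proof (induction j)
  case 0
  then show ?case by simp
next
  case (Suc j)
  then have e: "m - j = Suc (m - Suc j)" by simp
  have "mom ((pderiv ^^ (m - j)) (bump m) * (pderiv ^^ j) q) =
      - mom ((pderiv ^^ (m - Suc j)) (bump m) * pderiv ((pderiv ^^ j) q))"
    unfolding e funpow.simps o_def using Suc.prems by (intro mom_by_parts bump_boundary) simp_all
  then show ?case using Suc by simp
qed

text \<open>A Beta integral, from the recursion
  \<open>(2 * m + 3) * I (m + 1) = - (m + 1) / 2 * I m\<close>. It results from integrating the
  derivative of \<open>s * bump (m + 1)\<close>, which contributes nothing at the endpoints, with
  \<open>s ^ 2\<close> split as \<open>(s ^ 2 - 1/4) + 1/4\<close>.\<close>

lemma mom_bump: "mom (bump m) = (-1) ^ m * (fact m)\<^sup>2 / fact (2 * m + 1)"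
proof (induction m)
  case 0
  show ?case by (simp add: mom_def bump_def nu_def)
next
  case (Suc m)
  let ?x = "[:0, 1:] :: complex poly"
  have b: "bump (Suc m) = [:-1/4, 0, 1:] * bump m" by (simp add: bump_def)
  have d: "pderiv (bump (Suc m)) = smult (2 * of_nat (Suc m)) (?x * bump m)"
  proof -
    have "pderiv [:-1/4, 0, 1 :: complex:] = smult 2 ?x" by (simp add: pderiv_pCons)
    then show ?thesis unfolding bump_def pderiv_power_Suc
      by (simp only: mult_smult_left mult_smult_right smult_smult) (simp add: mult.commute del: of_nat_Suc)
  qed
  have x2: "?x * ?x = [:-1/4, 0, 1:] + [:1/4:]" by simp
  have "?x * pderiv (bump (Suc m)) = smult (2 * of_nat (Suc m)) ((?x * ?x) * bump m)"
    unfolding d by (simp only: mult_smult_right mult.assoc)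
  also have "\<dots> = smult (2 * of_nat (Suc m)) (bump (Suc m) + smult (1/4) (bump m))"
    unfolding x2 b by (simp only: distrib_right) simp
  finally have xd: "?x * pderiv (bump (Suc m)) = smult (2 * of_nat (Suc m)) (bump (Suc m) + smult (1/4) (bump m))" .
  have "mom (pderiv (?x * bump (Suc m))) = 0"
    using bump_boundary[of 0 "Suc m"] by (simp add: mom_pderiv)
  moreover have "pderiv (?x * bump (Suc m)) = ?x * pderiv (bump (Suc m)) + bump (Suc m)"
    by (simp add: pderiv_mult pderiv_pCons)
  ultimately have "2 * of_nat (Suc m) * (mom (bump (Suc m)) + mom (bump m) / 4) + mom (bump (Suc m)) = 0"
    unfolding xd by (simp add: mom_add mom_smult)
  then have r: "(2 * of_nat m + 3) * mom (bump (Suc m)) = - (of_nat (Suc m)) / 2 * mom (bump m)"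
    by (simp add: algebra_simps) (simp add: eq_neg_iff_add_eq_0 field_simps)
  have nz: "(2 * of_nat m + 3 :: complex) \<noteq> 0"
    using of_nat_neq_0[of "2 * m + 2", where ?'a = complex] by (simp add: algebra_simps)
  have f: "fact (2 * Suc m + 1) = (2 * of_nat m + 3) * (2 * of_nat (Suc m)) * (fact (2 * m + 1) :: complex)"
    by (simp add: algebra_simps)
  have c: "a * (e * (s * g)\<^sup>2 / (a * (2 * s) * F)) = - s / 2 * (- e * g\<^sup>2 / F)"
    if "a \<noteq> 0" "s \<noteq> 0" for a e s g F :: complex
    using that by (simp add: field_simps power2_eq_square)
  have "(2 * of_nat m + 3) * ((-1) ^ Suc m * (fact (Suc m))\<^sup>2 / fact (2 * Suc m + 1)) =
      - (of_nat (Suc m)) / 2 * ((-1) ^ m * (fact m)\<^sup>2 / (fact (2 * m + 1) :: complex))"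
    unfolding f fact_Suc[of m] using c[OF nz of_nat_neq_0[of m], of "(-1) ^ Suc m" "fact m" "fact (2 * m + 1)"]
    by (simp del: of_nat_Suc)
  then have "(2 * of_nat m + 3) * mom (bump (Suc m)) =
      (2 * of_nat m + 3) * ((-1) ^ Suc m * (fact (Suc m))\<^sup>2 / fact (2 * Suc m + 1))"
    using r unfolding Suc.IH by simp
  then show ?case using nz by (metis mult_left_cancel)
qed

text \<open>Rodrigues' formula without normalisation, for the interval from -1/2 to 1/2.\<close>

definition legendre :: "nat \<Rightarrow> complex poly" where
  "legendre m = (pderiv ^^ m) (bump m)"

lemma degree_bump: "degree (bump m) = 2 * m"
  unfolding bump_def by (simp add: degree_power_eq)

lemma degree_legendre: "degree (legendre m) = m"
  by (simp add: legendre_def degree_higher_pderiv degree_bump)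

lemma lead_coeff_legendre: "coeff (legendre m) m = fact (2 * m) / fact m"
proof -
  have "coeff (bump m) (2 * m) = 1"
    using lead_coeff_power[of "[:-1/4, 0, 1::complex:]" m] by (simp add: bump_def degree_power_eq mult_2 mult_2_right)
  moreover have "pochhammer (of_nat (Suc m)) m = (fact (2 * m) / fact m :: complex)"
  proof -
    have "fact (2 * m) = (fact m * pochhammer (of_nat (Suc m)) m :: complex)"
      using pochhammer_product[of m "2 * m" "1 :: complex"] by (simp add: mult_2 flip: pochhammer_fact)
    then show ?thesis by simp
  qed
  ultimately show ?thesis by (simp add: legendre_def coeff_higher_pderiv mult_2)
qed

text \<open>After \<open>m\<close> integrations by parts all derivatives fall on the monomial: they
  kill it for \<open>i < m\<close> and leave the constant \<open>fact m\<close> for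
  \<open>i = m\<close>.\<close>

lemma mom_legendre:
  assumes "i \<le> m"
  shows "mom (legendre m * monom 1 i) = (if i = m then (fact m) ^ 3 / fact (2 * m + 1) else 0)"
proof -
  have "(pderiv ^^ m) (monom 1 i :: complex poly) = (if i = m then [:fact m:] else 0)"
  proof (rule poly_eqI)
    fix k
    show "coeff ((pderiv ^^ m) (monom 1 i :: complex poly)) k = coeff (if i = m then [:fact m:] else 0) k"
      using assms by (cases k) (auto simp: coeff_higher_pderiv pochhammer_fact)
  qed
  then have "mom (legendre m * monom 1 i) = (-1) ^ m * mom (bump m * (if i = m then [:fact m:] else 0))"
    using mom_higher_pderiv_bump[of m m "monom 1 i"] by (simp add: legendre_def)
  moreover have "(-1) ^ m * (a * ((-1) ^ m * a\<^sup>2 / b)) = (a ^ 3 / b :: complex)" for a b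
    by (cases "even m") (simp_all add: power2_eq_square power3_eq_cube)
  ultimately show ?thesis by (auto simp add: mom_smult mom_bump simp del: fact_Suc)
qed

text \<open>A kernel vector is a polynomial \<open>p\<close> of degree below \<open>n\<close> that
  is orthogonal to all monomials of degree below \<open>n\<close>. Testing it against the Legendre
  polynomial of its own degree isolates the leading coefficient, which must then vanish.\<close>

lemma moment_matrix_injective:
  assumes "\<And>i. i < n \<Longrightarrow> (\<Sum>l<n. nu (i + l) * c l) = 0" "l < n"
  shows "c l = 0"
proof -
  define p where "p = (\<Sum>l<n. monom (c l) l)"
  have cp: "coeff p k = (if k < n then c k else 0)" for k
    by (simp add: p_def coeff_sum)
  have deg: "degree p < n"
    using assms(2) by (intro le_less_trans[OF degree_le[of "n - 1"]]) (auto simp: cp)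
  have z: "mom (monom 1 i * p) = 0" if "i < n" for i
    using mom_monom_mult[OF deg, of i] assms(1)[OF that] by (simp add: cp mult.commute)
  have "p = 0"
  proof (rule ccontr)
    assume "p \<noteq> 0"
    define d where "d = degree p"
    have dn: "d < n" using deg d_def by simp
    have L: "legendre d = (\<Sum>i\<le>d. monom (coeff (legendre d) i) i)"
      by (rule poly_as_sum_of_monoms'[symmetric]) (simp add: degree_legendre)
    have "mom (legendre d * p) = mom (\<Sum>i\<le>d. smult (coeff (legendre d) i) (monom 1 i * p))"
      by (subst L) (simp add: sum_distrib_right smult_monom flip: mult_smult_left)
    also have "\<dots> = 0" unfolding mom_sum mom_smult using z dn by simp
    finally have "mom (legendre d * p) = 0" .
    moreover have "mom (legendre d * p) = mom (\<Sum>i\<le>d. smult (coeff p i) (legendre d * monom 1 i))"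
      by (subst (1) poly_as_sum_of_monoms'[symmetric, of p d])
        (simp_all add: d_def sum_distrib_left smult_monom flip: mult_smult_right)
    then have "mom (legendre d * p) = (\<Sum>i\<le>d. coeff p i * (if i = d then (fact d) ^ 3 / fact (2 * d + 1) else 0))"
      unfolding mom_sum mom_smult by (simp add: mom_legendre)
    then have "mom (legendre d * p) = coeff p d * ((fact d) ^ 3 / fact (2 * d + 1))"
      by (simp add: if_distrib[of "(*) _"] sum.delta del: fact_Suc cong: if_cong)
    ultimately show False using \<open>p \<noteq> 0\<close> by (simp add: d_def del: fact_Suc)
  qed
  then show ?thesis using cp[of l] assms(2) by simp
qed

text \<open>Up to a scalar, the Legendre coefficients form the last column of the inverse moment
  matrix. The corner entry of that column is the origin of \<open>kappa\<close>.\<close>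

lemma moment_matrix_solution:
  assumes "i \<le> m"
  shows "(\<Sum>l\<le>m. nu (i + l) * coeff (legendre m) l) = (if i = m then (fact m) ^ 3 / fact (2 * m + 1) else 0)"
  using mom_monom_mult[of "legendre m" "Suc m" i] mom_legendre[OF assms]
  by (simp add: degree_legendre mult.commute lessThan_Suc_atMost)

section \<open>Lagrange interpolation at the eigenvalues\<close>

locale distinct_nodes =
  fixes lam :: "'n::finite \<Rightarrow> complex"
  assumes inj_lam: "inj lam"
begin

text \<open>The barycentric weights: the product is the derivative of the node polynomial at
  \<open>lam j\<close>, and \<open>wt j\<close> is the leading coefficient of
  \<open>lagrange j\<close>.\<close>

definition wt :: "'n \<Rightarrow> complex" where
  "wt j = 1 / (\<Prod>k\<in>UNIV - {j}. lam j - lam k)"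

definition lagrange :: "'n \<Rightarrow> complex poly" where
  "lagrange j = smult (wt j) (\<Prod>k\<in>UNIV - {j}. [:- lam k, 1:])"

lemma wt_nonzero: "wt j \<noteq> 0"
  using inj_lam by (auto simp: wt_def inj_def)

lemma poly_lagrange: "poly (lagrange j) (lam k) = (if k = j then 1 else 0)"
proof (cases "k = j")
  case True
  then show ?thesis using wt_nonzero[of j] by (simp add: lagrange_def poly_prod wt_def)
next
  case False
  then have "(\<Prod>i\<in>UNIV - {j}. lam k - lam i) = 0" by (intro prod_zero) auto
  then show ?thesis using False by (simp add: lagrange_def poly_prod)
qed

lemma degree_lagrange: "degree (lagrange j) = CARD('n) - 1"
  using wt_nonzero[of j] by (simp add: lagrange_def degree_prod_eq_sum_degree card_Diff_singleton)

lemma degree_lagrange_less: "degree (lagrange j) < CARD('n)"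
  by (simp add: degree_lagrange)

lemma lead_coeff_lagrange: "coeff (lagrange j) (CARD('n) - 1) = wt j"
proof -
  have "lead_coeff (lagrange j) = wt j"
    by (simp add: lagrange_def lead_coeff_smult lead_coeff_prod)
  then show ?thesis by (simp add: degree_lagrange)
qed

lemma interpolation:
  assumes "degree p < CARD('n)"
  shows "p = (\<Sum>j\<in>UNIV. smult (poly p (lam j)) (lagrange j))" (is "_ = ?q")
proof (rule ccontr)
  assume ne: "p \<noteq> ?q"
  have "degree ?q \<le> CARD('n) - 1"
    by (intro degree_sum_le) (auto intro: order.trans[OF degree_smult_le] simp: degree_lagrange)
  then have deg: "degree (p - ?q) < CARD('n)"
    using assms by (intro le_less_trans[OF degree_diff_le[of p "CARD('n) - 1"]]) auto
  have "poly (p - ?q) (lam k) = 0" for k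
  proof -
    have "poly ?q (lam k) = (\<Sum>j\<in>UNIV. if j = k then poly p (lam j) else 0)"
      unfolding poly_sum poly_smult poly_lagrange by (intro sum.cong refl) simp
    then show ?thesis unfolding poly_diff by (simp only: sum.delta finite UNIV_I if_True diff_self)
  qed
  then have "range lam \<subseteq> {z. poly (p - ?q) z = 0}" unfolding image_subset_iff mem_Collect_eq by blast
  moreover have "finite {z. poly (p - ?q) z = 0}" using ne by (intro poly_roots_finite) simp
  ultimately have "card (range lam) \<le> card {z. poly (p - ?q) z = 0}" by (intro card_mono)
  also have "\<dots> \<le> degree (p - ?q)" using ne by (intro card_poly_roots_bound) simp
  finally have "card (range lam) \<le> degree (p - ?q)" .
  then show False using deg card_image[OF inj_lam] by simp
qed

text \<open>Interpolation reproduces monomials of degree below \<open>n\<close>. Hence the Lagrange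
  coefficients invert the Vandermonde matrix from one side; \<open>sum_coeff_lagrange_power\<close>
  is the other side.\<close>

lemma sum_power_coeff_lagrange:
  assumes "l < CARD('n)"
  shows "(\<Sum>k\<in>UNIV. lam k ^ l * coeff (lagrange k) i) = (if i = l then 1 else 0)"
proof -
  have "monom 1 l = (\<Sum>j\<in>UNIV. smult (lam j ^ l) (lagrange j))"
    using interpolation[of "monom 1 l"] assms by (simp add: degree_monom_eq poly_monom)
  then have "coeff (monom 1 l) i = (\<Sum>k\<in>UNIV. lam k ^ l * coeff (lagrange k) i)"
    by (simp add: coeff_sum)
  then show ?thesis by auto
qed

lemma sum_power_wt:
  assumes "l < CARD('n)"
  shows "(\<Sum>k\<in>UNIV. lam k ^ l * wt k) = (if l = CARD('n) - 1 then 1 else 0)"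
  using sum_power_coeff_lagrange[OF assms, of "CARD('n) - 1"] unfolding lead_coeff_lagrange by auto

lemma sum_coeff_lagrange_power:
  "(\<Sum>i<CARD('n). lam j ^ i * coeff (lagrange m) i) = (if j = m then 1 else 0)"
proof -
  have "poly (lagrange m) (lam j) = (\<Sum>i<CARD('n). lam j ^ i * coeff (lagrange m) i)"
    unfolding poly_altdef using degree_lagrange_less[of m]
    by (intro sum.mono_neutral_cong_left) (auto simp: coeff_eq_0 mult.commute)
  then show ?thesis by (simp add: poly_lagrange)
qed

lemma vandermonde_injective:
  assumes "\<And>l. l < CARD('n) \<Longrightarrow> (\<Sum>j\<in>UNIV. lam j ^ l * c j) = 0"
  shows "c m = 0"
proof -
  have "c m = (\<Sum>j\<in>UNIV. (\<Sum>i<CARD('n). lam j ^ i * coeff (lagrange m) i) * c j)"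
  proof -
    have "(\<Sum>j\<in>UNIV. (\<Sum>i<CARD('n). lam j ^ i * coeff (lagrange m) i) * c j) = (\<Sum>j\<in>UNIV. if j = m then c j else 0)"
      unfolding sum_coeff_lagrange_power by (rule sum.cong) auto
    then show ?thesis by simp
  qed
  also have "\<dots> = (\<Sum>i<CARD('n). coeff (lagrange m) i * (\<Sum>j\<in>UNIV. lam j ^ i * c j))"
    unfolding sum_distrib_left sum_distrib_right by (subst sum.swap) (simp add: algebra_simps)
  also have "\<dots> = 0" using assms by simp
  finally show ?thesis .
qed

section \<open>The exponential Gram matrix near zero\<close>

text \<open>For real \<open>T\<close>, the Gram matrix of the functions
  \<open>exp (T * lam j * s)\<close> over the centred unit interval. \<open>T\<close> itself is
  never conjugated, so the entries are entire functions of a complex \<open>T\<close>.\<close>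

definition expgram :: "complex \<Rightarrow> 'n \<Rightarrow> 'n \<Rightarrow> complex" where
  "expgram T j k = sinhc (T * (lam j + cnj (lam k)))"

definition gcoeff :: "nat \<Rightarrow> nat \<Rightarrow> nat \<Rightarrow> complex" where
  "gcoeff i l N = (\<Sum>j\<in>UNIV. \<Sum>k\<in>UNIV. coeff (lagrange j) i * cnj (coeff (lagrange k) l) *
      (nu N / fact N * (lam j + cnj (lam k)) ^ N))"

lemma gcoeff_binomial:
  "gcoeff i l N = nu N / fact N * (\<Sum>p\<le>N. of_nat (N choose p) *
     ((\<Sum>j\<in>UNIV. lam j ^ p * coeff (lagrange j) i) * cnj (\<Sum>k\<in>UNIV. lam k ^ (N - p) * coeff (lagrange k) l)))"
proof -
  have "gcoeff i l N = (\<Sum>j\<in>UNIV. \<Sum>k\<in>UNIV. \<Sum>p\<le>N. nu N / fact N * (of_nat (N choose p) *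
     ((lam j ^ p * coeff (lagrange j) i) * cnj (lam k ^ (N - p) * coeff (lagrange k) l))))"
    unfolding gcoeff_def binomial_ring sum_distrib_left by (simp add: mult_ac)
  also have "\<dots> = (\<Sum>j\<in>UNIV. \<Sum>p\<le>N. \<Sum>k\<in>UNIV. nu N / fact N * (of_nat (N choose p) *
     ((lam j ^ p * coeff (lagrange j) i) * cnj (lam k ^ (N - p) * coeff (lagrange k) l))))"
    by (rule sum.cong[OF refl], rule sum.swap)
  also have "\<dots> = (\<Sum>p\<le>N. \<Sum>j\<in>UNIV. \<Sum>k\<in>UNIV. nu N / fact N * (of_nat (N choose p) *
     ((lam j ^ p * coeff (lagrange j) i) * cnj (lam k ^ (N - p) * coeff (lagrange k) l))))"
    by (rule sum.swap)
  also have "\<dots> = nu N / fact N * (\<Sum>p\<le>N. of_nat (N choose p) *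
     ((\<Sum>j\<in>UNIV. lam j ^ p * coeff (lagrange j) i) * cnj (\<Sum>k\<in>UNIV. lam k ^ (N - p) * coeff (lagrange k) l)))"
    unfolding cnj_sum sum_product by (simp add: sum_distrib_left)
  finally show ?thesis .
qed

text \<open>In each binomial term one exponent is small enough for the Vandermonde orthogonality. If
  \<open>p \<le> i\<close>, the first factor forces \<open>p = i\<close>, and then
  \<open>N - p \<le> l\<close> lets the second force \<open>N = i + l\<close>. If
  \<open>p > i\<close>, then \<open>N - p < l\<close> and the second factor is zero.\<close>

lemma gcoeff_low:
  assumes "i < CARD('n)" "l < CARD('n)" "N \<le> i + l"
  shows "gcoeff i l N = (if N = i + l then nu N / (fact i * fact l) else 0)"
proof -
  have t: "(\<Sum>j\<in>UNIV. lam j ^ p * coeff (lagrange j) i) * cnj (\<Sum>k\<in>UNIV. lam k ^ (N - p) * coeff (lagrange k) l)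
     = (if p = i \<and> N = i + l then 1 else 0)" if "p \<le> N" for p
  proof (cases "p \<le> i")
    case True
    then show ?thesis
      using sum_power_coeff_lagrange[of p i] sum_power_coeff_lagrange[of "N - p" l] assms that
      by (cases "p = i") auto
  next
    case False
    then have "N - p < l" using assms that by auto
    then show ?thesis
      using sum_power_coeff_lagrange[of "N - p" l] assms False by auto
  qed
  have "gcoeff i l N = nu N / fact N * (\<Sum>p\<le>N. of_nat (N choose p) * (if p = i \<and> N = i + l then 1 else 0))"
    unfolding gcoeff_binomial
    by (rule arg_cong[where f = "(*) _"], rule sum.cong[OF refl], subst t) simp_all
  also have "\<dots> = (if N = i + l then nu N / fact N * of_nat (N choose i) else 0)"
    by (auto simp: if_distrib[of "(*) _"] sum.delta cong: if_cong)
  also have "\<dots> = (if N = i + l then nu N / (fact i * fact l) else 0)"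
    using binomial_fact[of i N, where ?'a = complex] by auto
  finally show ?thesis .
qed

text \<open>Replacing the exponentials \<open>exp (T * lam j * s)\<close> by the combinations with the coefficients of the
  Lagrange polynomials turns the Gram matrix into \<open>T ^ (i + l) * sgram i l T\<close>: the low-order
  coefficients \<open>gcoeff\<close> vanish, and \<open>sgram\<close> at 0 is the Gram matrix of the monomials
  \<open>s ^ i / fact i\<close>.\<close>

definition sgram :: "nat \<Rightarrow> nat \<Rightarrow> complex \<Rightarrow> complex" where
  "sgram i l T = (\<Sum>N. gcoeff i l (N + (i + l)) * T ^ N)"

lemma gcoeff_sums:
  "(\<lambda>N. gcoeff i l N * T ^ N) sums
     (\<Sum>j\<in>UNIV. \<Sum>k\<in>UNIV. coeff (lagrange j) i * cnj (coeff (lagrange k) l) * expgram T j k)"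
proof -
  have "(\<lambda>N. \<Sum>j\<in>UNIV. \<Sum>k\<in>UNIV. coeff (lagrange j) i * cnj (coeff (lagrange k) l) *
      (nu N / fact N * (T * (lam j + cnj (lam k))) ^ N)) sums
     (\<Sum>j\<in>UNIV. \<Sum>k\<in>UNIV. coeff (lagrange j) i * cnj (coeff (lagrange k) l) * expgram T j k)"
    unfolding expgram_def by (intro sums_sum sums_mult sinhc_sums)
  then show ?thesis
    by (simp add: gcoeff_def power_mult_distrib sum_distrib_left sum_distrib_right mult_ac)
qed

lemma sgram_sums:
  assumes "i < CARD('n)" "l < CARD('n)"
  shows "(\<lambda>N. gcoeff i l (N + (i + l)) * T ^ N) sums sgram i l T"
    and "(\<Sum>j\<in>UNIV. \<Sum>k\<in>UNIV. coeff (lagrange j) i * cnj (coeff (lagrange k) l) * expgram T j k)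
      = T ^ (i + l) * sgram i l T"
proof -
  let ?S = "\<Sum>j\<in>UNIV. \<Sum>k\<in>UNIV. coeff (lagrange j) i * cnj (coeff (lagrange k) l) * expgram T j k"
  have z: "(\<Sum>N<i+l. gcoeff i l N * T ^ N) = 0" using gcoeff_low[OF assms] by simp
  have s: "(\<lambda>N. gcoeff i l (N + (i + l)) * T ^ (N + (i + l))) sums ?S"
    using gcoeff_sums[of i l T] by (subst sums_iff_shift) (simp add: z)
  have "summable (\<lambda>N. gcoeff i l (N + (i + l)) * T ^ N)"
  proof (cases "T = 0")
    case True
    then show ?thesis using summable_zero_power'[of "\<lambda>N. gcoeff i l (N + (i + l))"] by simp
  next
    case False
    then have "(\<lambda>N. gcoeff i l (N + (i + l)) * T ^ N) = (\<lambda>N. gcoeff i l (N + (i + l)) * T ^ (N + (i + l)) / T ^ (i + l))"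
      by (simp add: power_add)
    then show ?thesis using summable_divide[OF sums_summable[OF s], of "T ^ (i + l)"] by simp
  qed
  then show g: "(\<lambda>N. gcoeff i l (N + (i + l)) * T ^ N) sums sgram i l T"
    unfolding sgram_def by (rule summable_sums)
  have "(\<lambda>N. T ^ (i + l) * (gcoeff i l (N + (i + l)) * T ^ N)) sums (T ^ (i + l) * sgram i l T)"
    by (rule sums_mult[OF g])
  then have "(\<lambda>N. gcoeff i l (N + (i + l)) * T ^ (N + (i + l))) sums (T ^ (i + l) * sgram i l T)"
    by (simp add: power_add mult_ac)
  then show "?S = T ^ (i + l) * sgram i l T" using s sums_unique2 by blast
qed

lemma sgram_holomorphic:
  assumes "i < CARD('n)" "l < CARD('n)"
  shows "sgram i l holomorphic_on UNIV"
proof -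
  have "sgram i l holomorphic_on ball 0 r" for r
    by (rule power_series_holomorphic[where a = "\<lambda>N. gcoeff i l (N + (i + l))"])
      (simp add: sgram_sums(1)[OF assms])
  then have "sgram i l field_differentiable at z" for z
    by (rule holomorphic_on_imp_differentiable_at[of _ "ball 0 (norm z + 1)"]) auto
  then show ?thesis by (simp add: holomorphic_on_def)
qed

lemma sgram_0:
  assumes "i < CARD('n)" "l < CARD('n)"
  shows "sgram i l 0 = nu (i + l) / (fact i * fact l)"
proof -
  have "(\<lambda>N. gcoeff i l (N + (i + l)) * 0 ^ N) sums gcoeff i l (0 + (i + l))"
    by (rule powser_sums_zero)
  then show ?thesis using sgram_sums(1)[OF assms, of 0] gcoeff_low[OF assms, of "i + l"]
    by (auto dest: sums_unique2)
qed

text \<open>Undoing the change of basis factors the Gram matrix into Vandermonde, powers of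
  \<open>T\<close>, \<open>sgram\<close>, powers of \<open>T\<close>, adjoint Vandermonde. The whole
  degeneration at \<open>T = 0\<close> sits in the explicit powers.\<close>

lemma expgram_eq:
  "expgram T j k = (\<Sum>i<CARD('n). \<Sum>l<CARD('n). lam j ^ i * cnj (lam k) ^ l * (T ^ (i + l) * sgram i l T))"
proof -
  have "(\<Sum>i<CARD('n). \<Sum>l<CARD('n). lam j ^ i * cnj (lam k) ^ l * (T ^ (i + l) * sgram i l T)) =
     (\<Sum>i<CARD('n). \<Sum>l<CARD('n). \<Sum>j'\<in>UNIV. \<Sum>k'\<in>UNIV.
        (lam j ^ i * coeff (lagrange j') i) * cnj (lam k ^ l * coeff (lagrange k') l) * expgram T j' k')"
    by (intro sum.cong refl) (simp add: sgram_sums(2)[symmetric] sum_distrib_left mult_ac)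
  also have "\<dots> = (\<Sum>j'\<in>UNIV. \<Sum>k'\<in>UNIV. \<Sum>i<CARD('n). \<Sum>l<CARD('n).
        (lam j ^ i * coeff (lagrange j') i) * cnj (lam k ^ l * coeff (lagrange k') l) * expgram T j' k')"
  proof -
    have sw: "(\<Sum>i\<in>I. \<Sum>l\<in>I. \<Sum>j\<in>J. \<Sum>k\<in>J. f i l j k) = (\<Sum>j\<in>J. \<Sum>k\<in>J. \<Sum>i\<in>I. \<Sum>l\<in>I. f i l j k)"
      for I :: "nat set" and J :: "'n set" and f :: "nat \<Rightarrow> nat \<Rightarrow> 'n \<Rightarrow> 'n \<Rightarrow> complex"
    proof -
      have "(\<Sum>i\<in>I. \<Sum>l\<in>I. \<Sum>j\<in>J. \<Sum>k\<in>J. f i l j k) = (\<Sum>i\<in>I. \<Sum>j\<in>J. \<Sum>l\<in>I. \<Sum>k\<in>J. f i l j k)"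
        by (rule sum.cong[OF refl], rule sum.swap)
      also have "\<dots> = (\<Sum>j\<in>J. \<Sum>i\<in>I. \<Sum>l\<in>I. \<Sum>k\<in>J. f i l j k)" by (rule sum.swap)
      also have "\<dots> = (\<Sum>j\<in>J. \<Sum>i\<in>I. \<Sum>k\<in>J. \<Sum>l\<in>I. f i l j k)"
        by (rule sum.cong[OF refl], rule sum.cong[OF refl], rule sum.swap)
      also have "\<dots> = (\<Sum>j\<in>J. \<Sum>k\<in>J. \<Sum>i\<in>I. \<Sum>l\<in>I. f i l j k)"
        by (rule sum.cong[OF refl], rule sum.swap)
      finally show ?thesis .
    qed
    show ?thesis by (rule sw)
  qed
  also have "\<dots> = (\<Sum>j'\<in>UNIV. \<Sum>k'\<in>UNIV. (\<Sum>i<CARD('n). lam j ^ i * coeff (lagrange j') i) *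
       cnj (\<Sum>l<CARD('n). lam k ^ l * coeff (lagrange k') l) * expgram T j' k')"
    unfolding cnj_sum sum_product unfolding sum_distrib_right by (rule refl)
  also have "\<dots> = (\<Sum>j'\<in>UNIV. \<Sum>k'\<in>UNIV. (if j = j' then if k = k' then expgram T j k else 0 else 0))"
    unfolding sum_coeff_lagrange_power by (intro sum.cong refl) auto
  also have "\<dots> = expgram T j k"
  proof -
    have "(\<Sum>k'\<in>UNIV. (if j = j' then if k = k' then expgram T j k else 0 else 0)) = (if j = j' then expgram T j k else 0)" for j'
      by simp
    then show ?thesis by simp
  qed
  finally show ?thesis by simp
qed

end

section \<open>Inverses of holomorphic matrix families and derivatives of even functions\<close>

lemma holomorphic_on_det:
  fixes M :: "complex \<Rightarrow> complex^'n^'n"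
  assumes "\<And>i j. (\<lambda>T. M T $ i $ j) holomorphic_on S"
  shows "(\<lambda>T. det (M T)) holomorphic_on S"
  unfolding det_def by (intro holomorphic_intros assms)

text \<open>Cramer's rule writes the inverse in terms of determinants, hence holomorphically
  wherever \<open>det (M T)\<close> does not vanish; the trivial kernel at 0 provides a
  neighbourhood of 0.\<close>

lemma holomorphic_matrix_inverse:
  fixes M :: "complex \<Rightarrow> complex^'n^'n"
  assumes hol: "\<And>i j. (\<lambda>T. M T $ i $ j) holomorphic_on UNIV"
    and ker: "\<And>x. M 0 *v x = 0 \<Longrightarrow> x = 0"
  obtains r N where "r > 0" "\<And>i j. (\<lambda>T. N T $ i $ j) holomorphic_on ball 0 r"
    "\<And>T. T \<in> ball 0 r \<Longrightarrow> M T ** N T = mat 1"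
proof -
  have "invertible (M 0)"
    using ker matrix_left_invertible_ker[of "M 0"] matrix_left_right_inverse unfolding invertible_def by metis
  then have "det (M 0) \<noteq> 0" by (simp add: invertible_det_nz)
  moreover have hd: "(\<lambda>T. det (M T)) holomorphic_on UNIV" by (rule holomorphic_on_det[OF hol])
  ultimately obtain r where r: "r > 0" "\<And>T. T \<in> ball 0 r \<Longrightarrow> det (M T) \<noteq> 0"
    using continuous_on_open_avoid[OF holomorphic_on_imp_continuous_on[OF hd], of 0 0]
    by (auto simp: dist_commute mem_ball)
  define N where "N T = (\<chi> i j. det (\<chi> a b. if b = i then (if a = j then 1 else 0) else M T $ a $ b) / det (M T))" for T
  show thesis
  proof (rule that[OF r(1)])
    fix i j
    show "(\<lambda>T. N T $ i $ j) holomorphic_on ball 0 r"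
      unfolding N_def vec_lambda_beta
    proof (intro holomorphic_on_divide holomorphic_on_det)
      fix a b
      show "(\<lambda>T. (\<chi> a b. if b = i then (if a = j then 1 else 0) else M T $ a $ b) $ a $ b) holomorphic_on ball 0 r"
        by (cases "b = i") (auto intro: holomorphic_on_subset[OF hol])
    qed (use r(2) in \<open>auto intro: holomorphic_on_subset[OF hol]\<close>)
  next
    fix T :: complex
    assume T: "T \<in> ball 0 r"
    have "M T *v (\<chi> k. N T $ k $ j) = (\<chi> i. if i = j then 1 else 0)" for j
      by (subst cramer[OF r(2)[OF T]]) (unfold N_def vec_lambda_beta, rule refl)
    then have "(M T ** N T) $ i $ j = (if i = j then 1 else 0)" for i j
      by (simp add: vec_eq_iff matrix_matrix_mult_def matrix_vector_mult_def)
    then show "M T ** N T = mat 1" by (simp add: vec_eq_iff mat_def)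
  qed
qed

lemma even_DERIV_0:
  fixes f :: "complex \<Rightarrow> complex"
  assumes "r > 0" "\<And>x. x \<in> ball 0 r \<Longrightarrow> f (- x) = f x" "f field_differentiable at 0"
  shows "(f has_field_derivative 0) (at 0)"
proof -
  obtain d where d: "(f has_field_derivative d) (at 0)" using assms(3) by (auto simp: field_differentiable_def)
  have "((\<lambda>x. f (- x)) has_field_derivative d * (- 1)) (at 0)"
    by (rule DERIV_chain2[of f]) (use d in \<open>auto intro!: derivative_eq_intros\<close>)
  then have "(f has_field_derivative d * (- 1)) (at 0)"
    by (rule has_field_derivative_transform_within_open[OF _ open_ball[of 0 r]]) (simp_all add: assms(1,2))
  then have "d = d * (- 1)" by (rule DERIV_unique[OF d])
  then show ?thesis using d by simp
qed

definition kappa_inv :: "nat \<Rightarrow> real" where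
  "kappa_inv n = fact (2 * n - 1) * fact (2 * n - 2) / (fact (n - 1))\<^sup>2"

context distinct_nodes
begin

text \<open>Inverting the factorisation \<open>expgram_eq\<close> divides by
  \<open>T ^ (i + l)\<close> with \<open>i\<close> and \<open>l\<close> at most
  \<open>n - 1\<close>, so \<open>T ^ (2 * n - 2)\<close> is just enough to cancel the pole. At
  \<open>T = 0\<close> only the index pair \<open>i = l = n - 1\<close> survives: the limit has rank
  one, its vectors consist of leading Lagrange coefficients, and its scalar is the corner entry of
  the inverse of \<open>sgram\<close> at 0.\<close>

lemma expgram_scaled_inverse:
  obtains r B where "r > 0" "\<And>j k. (\<lambda>T. B T j k) holomorphic_on ball 0 r"
    "\<And>T j m. T \<in> ball 0 r \<Longrightarrow>
      (\<Sum>k\<in>UNIV. expgram T j k * B T k m) = (if j = m then T ^ (2 * CARD('n) - 2) else 0)"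
    "\<And>j m. B 0 j m = of_real (kappa_inv CARD('n)) * cnj (wt j) * wt m"
proof -
  let ?n = "CARD('n)"
  obtain e :: "'n \<Rightarrow> nat" where e: "bij_betw e UNIV {..<?n}"
    using ex_bij_betw_finite_nat[of "UNIV :: 'n set"] by (auto simp: atLeast0LessThan)
  have en: "e a < ?n" for a using e by (auto simp: bij_betw_def)
  have se: "(\<Sum>i<?n. f i) = (\<Sum>a\<in>UNIV. f (e a))" for f :: "nat \<Rightarrow> complex"
    using sum.reindex_bij_betw[OF e, of f] by simp
  define M where "M T = (\<chi> a b. sgram (e a) (e b) T)" for T
  have hM: "(\<lambda>T. M T $ i $ j) holomorphic_on UNIV" for i j
    unfolding M_def vec_lambda_beta by (rule sgram_holomorphic[OF en en])
  have kerM: "x = 0" if "M 0 *v x = 0" for x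
  proof -
    define c where "c l = x $ (inv_into UNIV e l) / fact l" for l
    have ce: "c (e a) = x $ a / fact (e a)" for a
      using e by (simp add: c_def bij_betw_def)
    have "(\<Sum>l<?n. nu (i + l) * c l) = 0" if i: "i < ?n" for i
    proof -
      obtain a where a: "i = e a" using e i by (auto simp: bij_betw_def)
      have "(M 0 *v x) $ a = 0" using that \<open>M 0 *v x = 0\<close> by simp
      then have "(\<Sum>b\<in>UNIV. nu (e a + e b) / (fact (e a) * fact (e b)) * x $ b) = 0"
        by (simp add: M_def matrix_vector_mult_def sgram_0[OF en en])
      then have "fact (e a) * (\<Sum>b\<in>UNIV. nu (e a + e b) / (fact (e a) * fact (e b)) * x $ b) = 0" by simp
      then show ?thesis by (simp add: se ce a sum_distrib_left)
    qed
    from moment_matrix_injective[OF this en] have "c (e a) = 0" for a by blast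
    then show ?thesis by (simp add: ce vec_eq_iff)
  qed
  obtain r N where r: "r > 0" and hN: "\<And>i j. (\<lambda>T. N T $ i $ j) holomorphic_on ball 0 r"
    and N: "\<And>T. T \<in> ball 0 r \<Longrightarrow> M T ** N T = mat 1"
    using holomorphic_matrix_inverse[OF hM kerM] by blast
  define g where "g i j = coeff (lagrange j) i" for i j
  have sg: "(\<Sum>k\<in>UNIV. lam k ^ l * g i k) = (if i = l then 1 else 0)" if "l < ?n" for l i
    unfolding g_def by (rule sum_power_coeff_lagrange[OF that])
  have ei: "e a = e b \<longleftrightarrow> a = b" for a b using e by (auto simp: bij_betw_def inj_def)
  \<comment> \<open>\<open>T ^ (n - 1 - e a)\<close> is what remains of \<open>T ^ (n - 1)\<close>
    after division by \<open>T ^ e a\<close>; the scaling is shared equally between both sides of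
    \<open>N T\<close>.\<close>
  define B where "B T k m = (\<Sum>a\<in>UNIV. \<Sum>b\<in>UNIV.
     cnj (g (e a) k) * g (e b) m * (T ^ (?n - 1 - e a) * T ^ (?n - 1 - e b) * N T $ a $ b))" for T k m
  show thesis
  proof (rule that[OF r])
    show "(\<lambda>T. B T j k) holomorphic_on ball 0 r" for j k
      unfolding B_def by (intro holomorphic_intros hN)
  next
    fix T :: complex and j m
    assume T: "T \<in> ball 0 r"
    define c where "c = T ^ (?n - 1)"
    define V W P Q :: "complex^'n^'n" where "V = (\<chi> j a. lam j ^ e a * T ^ e a)" and "W = (\<chi> a k. cnj (lam k) ^ e a * T ^ e a)"
      and "P = (\<chi> a k. T ^ (?n - 1 - e a) * g (e a) k)" and "Q = (\<chi> k a. T ^ (?n - 1 - e a) * cnj (g (e a) k))"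
    have Tc: "T ^ e a * T ^ (?n - 1 - e a) = c" for a
      using en[of a] by (simp add: c_def flip: power_add)
    have cg: "(\<Sum>k\<in>UNIV. cnj (lam k) ^ e a * cnj (g (e b) k)) = (if a = b then 1 else 0)" for a b
      using arg_cong[OF sg[OF en[of a], of "e b"], of cnj] by (auto simp: ei)
    have "(W ** Q) $ a $ b = mat c $ a $ b" for a b
    proof -
      have "(W ** Q) $ a $ b = T ^ e a * T ^ (?n - 1 - e b) * (\<Sum>k\<in>UNIV. cnj (lam k) ^ e a * cnj (g (e b) k))"
        unfolding matrix_matrix_mult_def W_def Q_def sum_distrib_left by (simp add: mult_ac)
      then show ?thesis unfolding cg using Tc[of b] by (simp add: mat_def)
    qed
    then have WQ: "W ** Q = mat c" by (simp add: vec_eq_iff)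
    have "(V ** P) $ i $ k = mat c $ i $ k" for i k
    proof -
      have "(V ** P) $ i $ k = (\<Sum>a\<in>UNIV. (T ^ e a * T ^ (?n - 1 - e a)) * (lam i ^ e a * g (e a) k))"
        by (simp add: matrix_matrix_mult_def V_def P_def mult_ac)
      also have "\<dots> = c * (if i = k then 1 else 0)"
        using sum_coeff_lagrange_power[of i k] unfolding Tc se g_def by (simp flip: sum_distrib_left)
      finally show ?thesis by (simp add: mat_def)
    qed
    then have VP: "V ** P = mat c" by (simp add: vec_eq_iff)
    have comm: "X ** mat c = mat c ** X" for X :: "complex^'n^'n"
      by (simp add: vec_eq_iff matrix_matrix_mult_def mat_def if_distrib[of "(*) _"] if_distrib[of "\<lambda>x. x * _"] cong: if_cong)
    have R: "V ** (M T ** W) = (\<chi> j k. expgram T j k)"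
      by (simp add: vec_eq_iff matrix_matrix_mult_def V_def W_def M_def expgram_eq se sum_distrib_left power_add mult_ac)
    have B: "Q ** (N T ** P) = (\<chi> j k. B T j k)"
      by (simp add: vec_eq_iff matrix_matrix_mult_def Q_def P_def B_def sum_distrib_left mult_ac)
    have "V ** (M T ** W) ** (Q ** (N T ** P)) = V ** (M T ** ((W ** Q) ** (N T ** P)))"
      by (simp add: matrix_mul_assoc)
    also have "\<dots> = (V ** (M T ** mat c)) ** (N T ** P)" unfolding WQ by (simp add: matrix_mul_assoc)
    also have "\<dots> = (V ** mat c) ** ((M T ** N T) ** P)" unfolding comm[of "M T"] by (simp add: matrix_mul_assoc)
    also have "\<dots> = mat c ** mat c" unfolding comm[of V] N[OF T] by (simp add: VP flip: matrix_mul_assoc)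
    finally have "(\<chi> j k. expgram T j k) ** (\<chi> j k. B T j k) = mat c ** mat c" unfolding R B .
    then have "(\<Sum>k\<in>UNIV. expgram T j k * B T k m) = (mat c ** mat c :: complex^'n^'n) $ j $ m"
      by (simp add: vec_eq_iff matrix_matrix_mult_def)
    also have "\<dots> = (if j = m then c * c else 0)"
      by (simp add: matrix_matrix_mult_def mat_def if_distrib[of "(*) _"] cong: if_cong)
    also have "c * c = T ^ (2 * ?n - 2)" by (simp add: c_def mult_2 numeral_2_eq_2 flip: power_add)
    finally show "(\<Sum>k\<in>UNIV. expgram T j k * B T k m) = (if j = m then T ^ (2 * ?n - 2) else 0)" .
  next
    fix j m
    obtain q where q: "e q = ?n - 1" using e zero_less_card_finite[where 'a='n]
      by (metis bij_betw_imp_surj_on diff_less imageE lessThan_iff zero_less_one)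
    have pw: "(0::complex) ^ (?n - 1 - e a) = (if a = q then 1 else 0)" for a
      using en[of a] q ei[of a q] by auto
    have "B 0 j m = (\<Sum>a\<in>UNIV. \<Sum>b\<in>UNIV. if b = q then (if a = q then cnj (g (e a) j) * g (e b) m * N 0 $ a $ b else 0) else 0)"
      unfolding B_def pw by (intro sum.cong refl) simp
    then have "B 0 j m = cnj (g (?n - 1) j) * g (?n - 1) m * N 0 $ q $ q" by (simp add: q)
    moreover have "N 0 $ q $ q = of_real (kappa_inv ?n)"
    proof -
      \<comment> \<open>The Legendre coefficients, corrected by the factorials in
        \<open>sgram_0\<close>, are the preimage of the unit vector at \<open>q\<close>; hence
        \<open>x\<close> is a column of \<open>N 0\<close>.\<close>
      define x :: "complex^'n" where "x = (\<chi> b. fact (e b) * coeff (legendre (?n - 1)) (e b) * (fact (2 * (?n - 1) + 1) / (fact (?n - 1))\<^sup>2))"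
      have "(M 0 *v x) $ a = (if a = q then 1 else 0)" for a
      proof -
        have "(M 0 *v x) $ a = (\<Sum>b\<in>UNIV. nu (e a + e b) * coeff (legendre (?n - 1)) (e b)) *
            (fact (2 * (?n - 1) + 1) / (fact (?n - 1))\<^sup>2) / fact (e a)"
          unfolding matrix_vector_mult_def M_def x_def vec_lambda_beta sgram_0[OF en en] sum_distrib_right sum_divide_distrib
          by (intro sum.cong refl) (simp add: mult_ac)
        also have "(\<Sum>b\<in>UNIV. nu (e a + e b) * coeff (legendre (?n - 1)) (e b)) = (\<Sum>l<?n. nu (e a + l) * coeff (legendre (?n - 1)) l)"
          by (simp add: se)
        also have "\<dots> = (\<Sum>l\<le>?n - 1. nu (e a + l) * coeff (legendre (?n - 1)) l)"
          by (rule sum.cong) (use zero_less_card_finite[where 'a='n] in \<open>auto simp del: zero_less_card_finite\<close>)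
        also have "\<dots> = (if e a = ?n - 1 then (fact (?n - 1)) ^ 3 / fact (2 * (?n - 1) + 1) else 0)"
          by (rule moment_matrix_solution) (use en[of a] in simp)
        finally show ?thesis using ei[of a q] q
          by (auto simp: power2_eq_square power3_eq_cube simp del: fact_Suc)
      qed
      then have Mx: "M 0 *v x = axis q 1" by (simp add: vec_eq_iff axis_def)
      have "N 0 ** M 0 = mat 1" using N[of 0] r by (simp add: matrix_left_right_inverse)
      then have "x = N 0 *v (M 0 *v x)" by (simp add: matrix_vector_mul_assoc)
      then have "x $ q = (N 0 *v axis q 1) $ q" using Mx by simp
      also have "\<dots> = N 0 $ q $ q"
        by (simp add: matrix_vector_mult_def axis_def if_distrib[of "(*) _"] cong: if_cong)
      finally have "N 0 $ q $ q = fact (?n - 1) * coeff (legendre (?n - 1)) (?n - 1) * (fact (2 * (?n - 1) + 1) / (fact (?n - 1))\<^sup>2)"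
        by (simp add: x_def q)
      moreover have "2 * (?n - 1) + 1 = 2 * ?n - 1" "2 * (?n - 1) = 2 * ?n - 2" using zero_less_card_finite[where 'a='n] by arith+
      ultimately show ?thesis by (simp add: lead_coeff_legendre kappa_inv_def power2_eq_square del: fact_Suc)
    qed
    ultimately show "B 0 j m = of_real (kappa_inv CARD('n)) * cnj (wt j) * wt m"
      unfolding g_def lead_coeff_lagrange by (simp only: mult_ac)
  qed
qed

lemma expgram_minus: "expgram (- T) j k = expgram T j k"
  unfolding expgram_def mult_minus_left sinhc_minus by (rule refl)

lemma expgram_cnj: "expgram (cnj T) k j = cnj (expgram T j k)"
  unfolding expgram_def sinhc_cnj[symmetric] complex_cnj_mult complex_cnj_add complex_cnj_cnj
  by (simp only: add.commute)

end

section \<open>Fixed points depending holomorphically on a parameter\<close>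

lemma norm_mult_diff_le:
  fixes a b c d :: complex
  assumes "norm a \<le> A" "norm d \<le> D" "norm (b - d) \<le> u" "norm (a - c) \<le> v"
  shows "norm (a * b - c * d) \<le> A * u + v * D"
proof -
  have "a * b - c * d = a * (b - d) + (a - c) * d" by (simp add: algebra_simps)
  also have "norm \<dots> \<le> norm (a * (b - d)) + norm ((a - c) * d)" by (rule norm_triangle_ineq)
  also have "\<dots> = norm a * norm (b - d) + norm (a - c) * norm d" by (simp add: norm_mult)
  also have "\<dots> \<le> A * u + v * D"
    using assms norm_ge_zero by (intro add_mono mult_mono) (auto intro: order.trans[OF norm_ge_zero])
  finally show ?thesis .
qed

text \<open>Picard iteration from 0: the iterates are holomorphic and converge uniformly on the
  ball, so the limit is holomorphic. The start bound \<open>\<rho> / 2\<close> and the contraction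
  factor 1/2 keep them below \<open>\<rho>\<close>. The uniqueness in the last conclusion yields the
  conjugation symmetry of the phases.\<close>

lemma holomorphic_contraction:
  fixes F :: "complex \<Rightarrow> ('n::finite \<Rightarrow> complex) \<Rightarrow> 'n \<Rightarrow> complex"
  assumes "\<rho> > 0"
    and hol: "\<And>\<xi> j. (\<And>k. \<xi> k holomorphic_on ball 0 r) \<Longrightarrow> (\<lambda>T. F T (\<lambda>k. \<xi> k T) j) holomorphic_on ball 0 r"
    and small: "\<And>T j. T \<in> ball 0 r \<Longrightarrow> norm (F T (\<lambda>_. 0) j) \<le> \<rho> / 2"
    and lip: "\<And>T a b d j. T \<in> ball 0 r \<Longrightarrow> (\<And>k. norm (a k) \<le> \<rho>) \<Longrightarrow> (\<And>k. norm (b k) \<le> \<rho>) \<Longrightarrow>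
       (\<And>k. norm (a k - b k) \<le> d) \<Longrightarrow> norm (F T a j - F T b j) \<le> d / 2"
  obtains \<xi> where "\<And>j. \<xi> j holomorphic_on ball 0 r"
    "\<And>T j. T \<in> ball 0 r \<Longrightarrow> norm (\<xi> j T) \<le> \<rho>"
    "\<And>T j. T \<in> ball 0 r \<Longrightarrow> F T (\<lambda>k. \<xi> k T) j = \<xi> j T"
    "\<And>T b j. T \<in> ball 0 r \<Longrightarrow> (\<And>k. norm (b k) \<le> \<rho>) \<Longrightarrow> (\<And>k. F T b k = b k) \<Longrightarrow> b j = \<xi> j T"
proof -
  define it where "it = rec_nat (\<lambda>(j::'n) (T::complex). 0 :: complex) (\<lambda>m f j T. F T (\<lambda>k. f k T) j)"
  have it0: "it 0 j T = 0" and itS: "it (Suc m) j T = F T (\<lambda>k. it m k T) j" for m j T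
    by (simp_all add: it_def)
  have hit: "it m j holomorphic_on ball 0 r" for m j
  proof (induction m arbitrary: j)
    case 0
    then show ?case by (simp add: it_def)
  next
    case (Suc m)
    from hol[of "it m", OF Suc] show ?case by (simp add: itS cong: holomorphic_cong)
  qed
  have bit: "norm (it m j T) \<le> \<rho>" if T: "T \<in> ball 0 r" for m j T
  proof (induction m arbitrary: j)
    case 0
    then show ?case using \<open>\<rho> > 0\<close> by (simp add: it0)
  next
    case (Suc m)
    have "norm (F T (\<lambda>k. it m k T) j - F T (\<lambda>_. 0) j) \<le> \<rho> / 2"
      by (rule lip[OF T]) (use Suc \<open>\<rho> > 0\<close> in auto)
    then show ?case using small[OF T, of j] norm_triangle_sub[of "F T (\<lambda>k. it m k T) j" "F T (\<lambda>_. 0) j"]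
      by (simp add: itS)
  qed
  have dit: "norm (it (Suc m) j T - it m j T) \<le> \<rho> * (1/2) ^ m" if T: "T \<in> ball 0 r" for m j T
  proof (induction m arbitrary: j)
    case 0
    then show ?case using bit[OF T, of "Suc 0" j] by (simp add: it0)
  next
    case (Suc m)
    have "norm (F T (\<lambda>k. it (Suc m) k T) j - F T (\<lambda>k. it m k T) j) \<le> (\<rho> * (1/2) ^ m) / 2"
      by (rule lip[OF T]) (use Suc bit[OF T] in auto)
    then show ?case by (simp add: itS)
  qed
  define \<xi> where "\<xi> j T = (\<Sum>m. it (Suc m) j T - it m j T)" for j T
  have ul: "uniform_limit (ball 0 r) (\<lambda>m. it m j) (\<xi> j) sequentially" for j
  proof -
    have "uniform_limit (ball 0 r) (\<lambda>n T. \<Sum>m<n. it (Suc m) j T - it m j T) (\<lambda>T. \<Sum>m. it (Suc m) j T - it m j T) sequentially"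
      by (rule Weierstrass_m_test[where M = "\<lambda>m. \<rho> * (1/2) ^ m"]) (use dit in \<open>auto intro!: summable_mult\<close>)
    moreover have "(\<Sum>m<n. it (Suc m) j T - it m j T) = it n j T" for n T
      by (induction n) (simp_all add: it0)
    ultimately show ?thesis unfolding \<xi>_def[abs_def] by simp
  qed
  have lim: "(\<lambda>m. it m j T) \<longlonglongrightarrow> \<xi> j T" if "T \<in> ball 0 r" for j T
    using tendsto_uniform_limitI[OF ul that] .
  have b\<xi>: "norm (\<xi> j T) \<le> \<rho>" if "T \<in> ball 0 r" for j T
    by (rule LIMSEQ_le_const2[OF tendsto_norm[OF lim[OF that]]]) (use bit[OF that] in auto)
  have fp: "F T (\<lambda>k. \<xi> k T) j = \<xi> j T" if T: "T \<in> ball 0 r" for T j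
  proof (rule LIMSEQ_unique)
    show "(\<lambda>m. it (Suc m) j T) \<longlonglongrightarrow> \<xi> j T" using lim[OF T] by (rule LIMSEQ_Suc)
    show "(\<lambda>m. it (Suc m) j T) \<longlonglongrightarrow> F T (\<lambda>k. \<xi> k T) j"
    proof (rule tendstoI)
      fix e :: real assume "e > 0"
      have "\<forall>\<^sub>F m in sequentially. \<forall>k. dist (it m k T) (\<xi> k T) < e"
        by (rule eventually_all_finite) (use tendstoD[OF lim[OF T] \<open>e > 0\<close>] in blast)
      then show "\<forall>\<^sub>F m in sequentially. dist (it (Suc m) j T) (F T (\<lambda>k. \<xi> k T) j) < e"
      proof (rule eventually_mono)
        fix m assume m: "\<forall>k. dist (it m k T) (\<xi> k T) < e"
        have "norm (F T (\<lambda>k. it m k T) j - F T (\<lambda>k. \<xi> k T) j) \<le> e / 2"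
          by (rule lip[OF T]) (use m bit[OF T] b\<xi>[OF T] in \<open>auto simp: dist_norm intro: less_imp_le\<close>)
        then show "dist (it (Suc m) j T) (F T (\<lambda>k. \<xi> k T) j) < e"
          using \<open>e > 0\<close> by (simp add: itS dist_norm)
      qed
    qed
  qed
  show thesis
  proof (rule that[of \<xi>])
    show "\<xi> j holomorphic_on ball 0 r" for j
    proof (rule holomorphic_uniform_sequence[OF open_ball hit])
      fix x :: complex assume "x \<in> ball 0 r"
      then obtain d where "d > 0" "cball x d \<subseteq> ball 0 r" using open_contains_cball open_ball by blast
      then show "\<exists>d>0. cball x d \<subseteq> ball 0 r \<and> uniform_limit (cball x d) (\<lambda>m. it m j) (\<xi> j) sequentially"
        using uniform_limit_on_subset[OF ul] by blast
    qed
  next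
    fix T b j
    assume T: "T \<in> ball 0 r" and b: "\<And>k. norm (b k) \<le> \<rho>" and fb: "\<And>k. F T b k = b k"
    define d where "d = Max (range (\<lambda>k. norm (b k - \<xi> k T)))"
    have d: "norm (b k - \<xi> k T) \<le> d" for k by (simp add: d_def)
    have "norm (b k - \<xi> k T) \<le> d / 2" for k
      using lip[of T b "\<lambda>k. \<xi> k T" d k] T b b\<xi>[OF T] d by (simp add: fb fp[OF T])
    then have "d \<le> d / 2" unfolding d_def by (subst Max_le_iff) auto
    then have "norm (b j - \<xi> j T) \<le> 0" using d[of j] by linarith
    then show "b j = \<xi> j T" by simp
  qed (use b\<xi> fp in auto)
qed

text \<open>Phases \<open>x\<close> for which the row sums \<open>cnj (x j) * (\<Sum>k\<in>UNIV. C j k * x k)\<close> are real; conjugation is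
  replaced by \<open>\<sigma>\<close> to keep the equations holomorphic in \<open>T\<close>. Writing \<open>x = 1 + \<xi>\<close>, they are the
  fixed points of the quadratic map \<open>F\<close>, one Newton step at \<open>T = 0\<close>. There the rows of \<open>C\<close> coincide,
  so the linear part of \<open>F\<close> vanishes.\<close>

lemma phase_fixed_point:
  fixes C :: "complex \<Rightarrow> 'n::finite \<Rightarrow> 'n \<Rightarrow> complex" and s :: "'n \<Rightarrow> real" and \<sigma> :: "'n \<Rightarrow> 'n"
  assumes "r > 0" and holC: "\<And>j k. (\<lambda>T. C T j k) holomorphic_on ball 0 r"
    and C0: "\<And>j k. C 0 j k = of_real (s k)" and s: "\<And>k. s k > 0"
    and \<sigma>: "\<And>j. \<sigma> (\<sigma> j) = j"
    and dC: "\<And>j k. ((\<lambda>T. C T j k) has_field_derivative C' j k) (at 0)"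
    and C': "\<And>j. (\<Sum>k\<in>UNIV. C' (\<sigma> j) k) = (\<Sum>k\<in>UNIV. C' j k)"
  obtains r' x where "0 < r'" "r' \<le> r" "\<And>j. x j holomorphic_on ball 0 r'" "\<And>j. x j 0 = 1"
    "\<And>j. (x j has_field_derivative 0) (at 0)"
    "\<And>T j. T \<in> ball 0 r' \<Longrightarrow> x j T * x (\<sigma> j) T = 1"
    "\<And>T j. T \<in> ball 0 r' \<Longrightarrow> (\<Sum>k\<in>UNIV. C T j k * x k T) * x (\<sigma> j) T = (\<Sum>k\<in>UNIV. C T (\<sigma> j) k * x k T) * x j T"
    "\<And>T j. T \<in> ball 0 r' \<Longrightarrow> (\<And>j k. C T (\<sigma> j) (\<sigma> k) = cnj (C T j k)) \<Longrightarrow> x (\<sigma> j) T = cnj (x j T)"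
proof -
  define H where "H = (\<Sum>k\<in>UNIV. s k)"
  have H: "H > 0" unfolding H_def using s by (intro sum_pos) auto
  \<comment> \<open>With the radius 1/12 for \<open>\<xi>\<close>, the divisor 24 makes the start
    bound exactly half of the radius, and the Lipschitz constant below adds up to 49/144.\<close>
  define \<eta> where "\<eta> = H / (24 * CARD('n))"
  have \<eta>: "\<eta> > 0" "CARD('n) * \<eta> = H / 24" using H by (simp_all add: \<eta>_def)
  have "\<forall>\<^sub>F T in at 0. \<forall>j k. norm (C T j k - of_real (s k)) < \<eta>"
  proof (intro eventually_all_finite)
    fix j k
    have "isCont (\<lambda>T. C T j k) 0" using dC DERIV_isCont by blast
    then have "((\<lambda>T. C T j k) \<longlongrightarrow> of_real (s k)) (at 0)" by (simp add: isCont_def C0)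
    then show "\<forall>\<^sub>F T in at 0. norm (C T j k - of_real (s k)) < \<eta>"
      using tendstoD \<eta>(1) by (simp add: dist_norm[symmetric]) blast
  qed
  then obtain r0 where r0: "r0 > 0" "\<And>T j k. T \<noteq> 0 \<Longrightarrow> norm T < r0 \<Longrightarrow> norm (C T j k - of_real (s k)) < \<eta>"
    by (auto simp: eventually_at)
  define r' where "r' = min r r0"
  have r': "0 < r'" "r' \<le> r" using \<open>r > 0\<close> r0 by (auto simp: r'_def)
  have Cs: "norm (C T j k - of_real (s k)) \<le> \<eta>" if "T \<in> ball 0 r'" for T j k
    using r0(2)[of T j k] that \<eta> by (cases "T = 0") (auto simp: r'_def C0)
  define Z where "Z T a j = (\<Sum>k\<in>UNIV. C T j k * (1 + a k))" for T a j
  \<comment> \<open>With \<open>x = 1 + a\<close>, adding the equations \<open>F T a j = a j\<close>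
    at \<open>j\<close> and \<open>\<sigma> j\<close> gives the constraint
    \<open>x j * x (\<sigma> j) = 1\<close>; subtracting them gives the row-sum equation.\<close>
  define F where "F T a j = (- a j * a (\<sigma> j) + a j - a (\<sigma> j)
     - (Z T a (\<sigma> j) * (1 + a j) - Z T a j * (1 + a (\<sigma> j))) / of_real H) / 2" for T a j
  define X where "X a = (\<Sum>k\<in>UNIV. of_real (s k) * a k) / of_real H" for a :: "'n \<Rightarrow> complex"
  define E where "E T a j = (\<Sum>k\<in>UNIV. (C T j k - of_real (s k)) * (1 + a k)) / of_real H" for T a j
  have Z: "Z T a j = of_real H * (1 + X a + E T a j)" for T a j
  proof -
    have "Z T a j = (\<Sum>k\<in>UNIV. of_real (s k) + of_real (s k) * a k + (C T j k - of_real (s k)) * (1 + a k))"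
      unfolding Z_def by (intro sum.cong refl) (simp add: algebra_simps)
    also have "\<dots> = of_real H + of_real H * X a + of_real H * E T a j"
      using H by (simp add: sum.distrib X_def E_def) (simp add: H_def)
    finally show ?thesis by (simp add: algebra_simps)
  qed
  \<comment> \<open>The leading part \<open>H * (1 + X a)\<close> of the row sum does not depend on
    the row, so the linear terms in \<open>a j - a (\<sigma> j)\<close> cancel. What remains is
    quadratic in \<open>a\<close> or carries the small factor \<open>E\<close>.\<close>
  have F: "F T a j = (- (a j * a (\<sigma> j)) - (a j - a (\<sigma> j)) * X a
     - (E T a (\<sigma> j) * (1 + a j) - E T a j * (1 + a (\<sigma> j)))) / 2" for T a j
    using H by (simp add: F_def Z) (simp add: field_simps)
  have X: "norm (X a) \<le> d" if "\<And>k. norm (a k) \<le> d" for a d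
  proof -
    have "norm (\<Sum>k\<in>UNIV. of_real (s k) * a k) \<le> (\<Sum>k\<in>UNIV. s k * d)"
      using that s by (intro sum_norm_le) (auto simp: norm_mult less_imp_le intro!: mult_mono)
    also have "\<dots> = H * d" by (simp add: H_def sum_distrib_right)
    finally show ?thesis using H by (simp add: X_def norm_divide pos_divide_le_eq mult.commute)
  qed
  have E': "norm (\<Sum>k\<in>UNIV. (C T j k - of_real (s k)) * a k) / H \<le> d / 24"
    if "T \<in> ball 0 r'" "\<And>k. norm (a k) \<le> d" for T a d j
  proof -
    have "norm (\<Sum>k\<in>UNIV. (C T j k - of_real (s k)) * a k) \<le> (\<Sum>k\<in>(UNIV::'n set). \<eta> * d)"
      using that Cs \<eta> by (intro sum_norm_le) (auto simp: norm_mult less_imp_le intro!: mult_mono)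
    also have "\<dots> = H / 24 * d" using \<eta>(2) by simp
    finally show ?thesis using H by (simp add: field_simps)
  qed
  have E: "norm (E T a j) \<le> 13/288" if "T \<in> ball 0 r'" "\<And>k. norm (a k) \<le> 1/12" for T a j
  proof -
    have "norm (1 + a k) \<le> 13/12" for k using norm_triangle_ineq[of 1 "a k"] that(2)[of k] by simp
    from E'[OF that(1) this, of j] show ?thesis using H by (simp add: E_def norm_divide)
  qed
  have Ed: "norm (E T a j - E T b j) \<le> d / 24" if "T \<in> ball 0 r'" "\<And>k. norm (a k - b k) \<le> d" for T a b d j
  proof -
    have "E T a j - E T b j = (\<Sum>k\<in>UNIV. (C T j k - of_real (s k)) * (a k - b k)) / of_real H"
      by (simp add: E_def algebra_simps sum.distrib sum_subtractf diff_divide_distrib add_divide_distrib)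
    then show ?thesis using E'[OF that, of j] H by (simp add: norm_divide)
  qed
  have Xd: "norm (X a - X b) \<le> d" if "\<And>k. norm (a k - b k) \<le> d" for a b d
  proof -
    have "X a - X b = X (\<lambda>k. a k - b k)"
      by (simp add: X_def right_diff_distrib sum_subtractf diff_divide_distrib)
    then show ?thesis using X[OF that] by simp
  qed
  have smallF: "norm (F T (\<lambda>_. 0) j) \<le> (1/12) / 2" if "T \<in> ball 0 r'" for T j
  proof -
    have e: "norm (E T (\<lambda>_. 0) i) \<le> 1 / 24" for i
      using E'[OF that, of "\<lambda>_. 1" 1 i] H by (simp add: E_def norm_divide)
    have "norm (F T (\<lambda>_. 0) j) \<le> (norm (E T (\<lambda>_. 0) j) + norm (E T (\<lambda>_. 0) (\<sigma> j))) / 2"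
      using norm_triangle_ineq4[of "E T (\<lambda>_. 0) j" "E T (\<lambda>_. 0) (\<sigma> j)"] by (simp add: F norm_divide)
    then show ?thesis using e[of j] e[of "\<sigma> j"] by simp
  qed
  have lipF: "norm (F T a j - F T b j) \<le> d / 2"
    if T: "T \<in> ball 0 r'" and a: "\<And>k. norm (a k) \<le> 1/12" and b: "\<And>k. norm (b k) \<le> 1/12"
      and d: "\<And>k. norm (a k - b k) \<le> d" for T a b d j
  proof -
    let ?t = "\<sigma> j"
    have 0: "0 \<le> d" using d[of j] norm_ge_zero order.trans by blast
    have 1: "norm (a j * a ?t - b j * b ?t) \<le> 1/12 * d + d * (1/12)"
      by (rule norm_mult_diff_le) (rule a b d)+
    have "norm (a j - a ?t) \<le> 1/6" using norm_triangle_ineq4[of "a j" "a ?t"] a[of j] a[of ?t] by simp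
    moreover have "norm ((a j - a ?t) - (b j - b ?t)) \<le> 2 * d"
      using norm_triangle_ineq4[of "a j - b j" "a ?t - b ?t"] d[of j] d[of ?t] by (simp add: algebra_simps)
    ultimately have 2: "norm ((a j - a ?t) * X a - (b j - b ?t) * X b) \<le> 1/6 * d + (2 * d) * (1/12)"
      by (intro norm_mult_diff_le X[OF b] Xd[OF d])
    have o: "norm (1 + b k) \<le> 13/12" for k using norm_triangle_ineq[of 1 "b k"] b[of k] by simp
    have 3: "norm (E T a i * (1 + a k) - E T b i * (1 + b k)) \<le> 13/288 * d + (d/24) * (13/12)" for i k
      by (intro norm_mult_diff_le E[OF T a] o Ed[OF T d]) (use d[of k] in simp)
    have "F T a j - F T b j = (- (a j * a ?t - b j * b ?t) - ((a j - a ?t) * X a - (b j - b ?t) * X b)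
      - ((E T a ?t * (1 + a j) - E T b ?t * (1 + b j)) - (E T a j * (1 + a ?t) - E T b j * (1 + b ?t)))) / 2"
      unfolding F by (simp add: field_simps)
    moreover have "norm ((- p - q - (u - v)) / 2) \<le> (norm p + norm q + (norm u + norm v)) / 2" for p q u v :: complex
      using norm_triangle_ineq4[of "- p - q" "u - v"] norm_triangle_ineq4[of "-p" q] norm_triangle_ineq4[of u v]
      by (simp add: norm_divide)
    ultimately have "norm (F T a j - F T b j) \<le> (norm (a j * a ?t - b j * b ?t) + norm ((a j - a ?t) * X a - (b j - b ?t) * X b)
      + (norm (E T a ?t * (1 + a j) - E T b ?t * (1 + b j)) + norm (E T a j * (1 + a ?t) - E T b j * (1 + b ?t)))) / 2"
      by metis
    then show ?thesis using 1 2 3[of ?t j] 3[of j ?t] 0 by simp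
  qed
  have holF: "(\<lambda>T. F T (\<lambda>k. \<xi> k T) j) holomorphic_on ball 0 r'"
    if "\<And>k. \<xi> k holomorphic_on ball 0 r'" for \<xi> j
  proof -
    have h: "(\<lambda>T. C T i k) holomorphic_on ball 0 r'" for i k
      by (rule holomorphic_on_subset[OF holC]) (use r' in auto)
    show ?thesis unfolding F_def Z_def using H by (intro holomorphic_intros h that) auto
  qed
  obtain \<xi> where h\<xi>: "\<And>j. \<xi> j holomorphic_on ball 0 r'"
    and b\<xi>: "\<And>T j. T \<in> ball 0 r' \<Longrightarrow> norm (\<xi> j T) \<le> 1/12"
    and f\<xi>: "\<And>T j. T \<in> ball 0 r' \<Longrightarrow> F T (\<lambda>k. \<xi> k T) j = \<xi> j T"
    and u\<xi>: "\<And>T b j. T \<in> ball 0 r' \<Longrightarrow> (\<And>k. norm (b k) \<le> 1/12) \<Longrightarrow> (\<And>k. F T b k = b k) \<Longrightarrow> b j = \<xi> j T"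
  proof (rule holomorphic_contraction[of "1/12" r' F])
    show "0 < (1/12 :: real)" by simp
    show "(\<lambda>T. F T (\<lambda>k. \<xi> k T) j) holomorphic_on ball 0 r'" if "\<And>k. \<xi> k holomorphic_on ball 0 r'" for \<xi> j
      using that by (rule holF)
    show "norm (F T (\<lambda>_. 0) j) \<le> (1/12) / 2" if "T \<in> ball 0 r'" for T j
      using that by (rule smallF)
    show "norm (F T a j - F T b j) \<le> d / 2"
      if "T \<in> ball 0 r'" "\<And>k. norm (a k) \<le> 1/12" "\<And>k. norm (b k) \<le> 1/12" "\<And>k. norm (a k - b k) \<le> d" for T a b d j
      using that by (rule lipF)
  next
    fix \<xi> :: "'n \<Rightarrow> complex \<Rightarrow> complex"
    assume 1: "\<And>j. \<xi> j holomorphic_on ball 0 r'"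
      and 2: "\<And>T j. T \<in> ball 0 r' \<Longrightarrow> norm (\<xi> j T) \<le> 1/12"
      and 3: "\<And>T j. T \<in> ball 0 r' \<Longrightarrow> F T (\<lambda>k. \<xi> k T) j = \<xi> j T"
      and 4: "\<And>T b j. T \<in> ball 0 r' \<Longrightarrow> (\<And>k. norm (b k) \<le> 1/12) \<Longrightarrow> (\<And>k. F T b k = b k) \<Longrightarrow> b j = \<xi> j T"
    show thesis by (rule that) (fact 1, fact 2, fact 3, fact 4)
  qed
  define x where "x j T = 1 + \<xi> j T" for j T
  have xZ: "(\<Sum>k\<in>UNIV. C T j k * x k T) = Z T (\<lambda>k. \<xi> k T) j" for T j by (simp add: Z_def x_def)
  have x0: "x j 0 = 1" for j
  proof -
    have "F 0 (\<lambda>_. 0) k = 0" for k by (simp add: F_def Z_def C0)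
    then have "(\<lambda>_. 0) j = \<xi> j 0" using r' by (intro u\<xi>) auto
    then show ?thesis by (simp add: x_def)
  qed
  have e1: "x j T * x (\<sigma> j) T = 1" if "T \<in> ball 0 r'" for T j
  proof -
    have "\<xi> j T + \<xi> (\<sigma> j) T = F T (\<lambda>k. \<xi> k T) j + F T (\<lambda>k. \<xi> k T) (\<sigma> j)" by (simp add: f\<xi>[OF that])
    also have "\<dots> = - (\<xi> j T * \<xi> (\<sigma> j) T)" by (simp add: F \<sigma> field_simps)
    finally have "\<xi> j T + \<xi> (\<sigma> j) T = - (\<xi> j T * \<xi> (\<sigma> j) T)" .
    moreover have "x j T * x (\<sigma> j) T = 1 + (\<xi> j T + \<xi> (\<sigma> j) T) + \<xi> j T * \<xi> (\<sigma> j) T"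
      by (simp add: x_def algebra_simps)
    ultimately show ?thesis by simp
  qed
  have e2: "(\<Sum>k\<in>UNIV. C T j k * x k T) * x (\<sigma> j) T = (\<Sum>k\<in>UNIV. C T (\<sigma> j) k * x k T) * x j T" if "T \<in> ball 0 r'" for T j
  proof -
    let ?a = "\<lambda>k. \<xi> k T"
    have "?a j - ?a (\<sigma> j) = F T ?a j - F T ?a (\<sigma> j)" by (simp add: f\<xi>[OF that])
    also have "\<dots> = ?a j - ?a (\<sigma> j) - (Z T ?a (\<sigma> j) * (1 + ?a j) - Z T ?a j * (1 + ?a (\<sigma> j))) / of_real H"
      using H by (simp add: F_def \<sigma> field_simps)
    finally have "Z T ?a (\<sigma> j) * (1 + ?a j) - Z T ?a j * (1 + ?a (\<sigma> j)) = 0" using H by simp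
    then show ?thesis unfolding xZ by (simp add: x_def)
  qed
  \<comment> \<open>Differentiation of both identities at 0: the constraint gives
    \<open>D (\<sigma> j) = - D j\<close>. The row equation gives
    \<open>D (\<sigma> j) = D j\<close>, because the row sums of \<open>C'\<close> at
    \<open>j\<close> and \<open>\<sigma> j\<close> agree.\<close>
  have dx: "(x j has_field_derivative 0) (at 0)" for j
  proof -
    have "x k field_differentiable at 0" for k
      unfolding x_def using r' by (intro holomorphic_on_imp_differentiable_at[of _ "ball 0 r'"] holomorphic_intros h\<xi>) auto
    then obtain D where D: "\<And>k. (x k has_field_derivative D k) (at 0)" unfolding field_differentiable_def by metis
    have nb: "\<forall>\<^sub>F T in nhds 0. T \<in> ball 0 r'" using r' by (intro eventually_nhds_in_open) auto
    have "((\<lambda>T. x j T * x (\<sigma> j) T) has_field_derivative D j + D (\<sigma> j)) (at 0)"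
      by (rule derivative_eq_intros D refl)+ (simp add: x0)
    moreover have "((\<lambda>T. x j T * x (\<sigma> j) T) has_field_derivative 0) (at 0)"
      by (subst DERIV_cong_ev[OF refl _ refl, where g = "\<lambda>_. 1"]) (use nb in \<open>auto elim!: eventually_mono simp: e1\<close>)
    ultimately have 1: "D j + D (\<sigma> j) = 0" by (rule DERIV_unique)
    let ?S = "\<lambda>j. (\<Sum>k\<in>UNIV. C' j k) + (\<Sum>k\<in>UNIV. of_real (s k) * D k)"
    have dS: "((\<lambda>T. \<Sum>k\<in>UNIV. C T i k * x k T) has_field_derivative ?S i) (at 0)" for i
      by (rule derivative_eq_intros dC D refl)+ (simp add: x0 C0 sum.distrib algebra_simps)
    have S0: "(\<Sum>k\<in>UNIV. C 0 i k * x k 0) = of_real H" for i by (simp add: C0 x0 H_def)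
    have d2: "((\<lambda>T. (\<Sum>k\<in>UNIV. C T i k * x k T) * x l T) has_field_derivative ?S i + of_real H * D l) (at 0)" for i l
      by (rule DERIV_cong[OF DERIV_mult[OF dS D]]) (unfold S0, simp add: x0)
    have "((\<lambda>T. (\<Sum>k\<in>UNIV. C T j k * x k T) * x (\<sigma> j) T) has_field_derivative ?S (\<sigma> j) + of_real H * D j) (at 0)"
      by (subst DERIV_cong_ev[OF refl _ refl, where g = "\<lambda>T. (\<Sum>k\<in>UNIV. C T (\<sigma> j) k * x k T) * x j T"])
        (use nb d2 in \<open>auto elim!: eventually_mono simp: e2\<close>)
    from DERIV_unique[OF this d2] have "D j = D (\<sigma> j)" using H C' by simp
    then show ?thesis using 1 D[of j] by simp
  qed
  have hx: "x j holomorphic_on ball 0 r'" for j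
    unfolding x_def by (intro holomorphic_intros h\<xi>)
  show thesis
  proof (rule that[of r' x])
    fix T j
    assume T: "T \<in> ball 0 r'" and eq: "\<And>j k. C T (\<sigma> j) (\<sigma> k) = cnj (C T j k)"
    \<comment> \<open>The conjugated and permuted solution is again a small fixed point, so it
      equals \<open>\<xi>\<close> by uniqueness.\<close>
    define b where "b k = cnj (\<xi> (\<sigma> k) T)" for k
    have bij: "bij \<sigma>" using \<sigma> by (metis bijI')
    have Zb: "Z T b k = cnj (Z T (\<lambda>k. \<xi> k T) (\<sigma> k))" for k
    proof -
      have "cnj (Z T (\<lambda>k. \<xi> k T) (\<sigma> k)) = (\<Sum>i\<in>UNIV. cnj (C T (\<sigma> k) (\<sigma> i) * (1 + \<xi> (\<sigma> i) T)))"
        using sum.reindex_bij_betw[OF bij, of "\<lambda>i. cnj (C T (\<sigma> k) i * (1 + \<xi> i T))"] by (simp add: Z_def)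
      then show ?thesis by (simp add: Z_def b_def eq)
    qed
    have "F T b k = cnj (F T (\<lambda>k. \<xi> k T) (\<sigma> k))" for k
      by (simp add: F_def Zb) (simp add: b_def \<sigma>)
    then have "F T b k = b k" for k by (simp add: f\<xi>[OF T] b_def)
    moreover have "norm (b k) \<le> 1/12" for k using b\<xi>[OF T] by (simp add: b_def)
    ultimately have "b (\<sigma> j) = \<xi> (\<sigma> j) T" by (intro u\<xi>[OF T])
    then show "x (\<sigma> j) T = cnj (x j T)" by (simp add: b_def x_def \<sigma>)
  qed (fact r' hx x0 dx | rule e1 e2, assumption)+
qed

section \<open>Inverse Gram matrices and their dual certificates\<close>

abbreviation hform :: "('n::finite \<Rightarrow> 'n \<Rightarrow> complex) \<Rightarrow> ('n \<Rightarrow> complex) \<Rightarrow> complex" where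
  "hform S p \<equiv> (\<Sum>j\<in>UNIV. \<Sum>k\<in>UNIV. cnj (p j) * S j k * p k)"

lemma of_real_norm_square: "complex_of_real ((norm z)\<^sup>2) = cnj z * z"
  by (metis complex_norm_square mult.commute)

text \<open>\<open>diag y - S\<close> is a Laplacian with complex edge weights. The bounds by
  \<open>\<rho>\<close> tolerate small imaginary parts, so they hold for every \<open>S\<close>
  close enough to a matrix with positive entries.\<close>

lemma laplacian_form_nonneg:
  fixes S :: "'n::finite \<Rightarrow> 'n \<Rightarrow> complex" and p :: "'n \<Rightarrow> complex"
  assumes herm: "\<And>j k. S k j = cnj (S j k)" and row: "\<And>j. (\<Sum>k\<in>UNIV. S j k) = of_real (y j)"
    and re: "\<And>j k. \<rho> \<le> Re (S j k)" and im: "\<And>j k. \<bar>Im (S j k)\<bar> \<le> \<rho>"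
  shows "Re (hform S p) \<le> (\<Sum>j\<in>UNIV. y j * (norm (p j))\<^sup>2)"
proof -
  \<comment> \<open>Constants lie in the kernel of \<open>diag y - S\<close>, so \<open>p\<close> may be centred; then the terms
    \<open>Re (cnj (d j) * d k)\<close> sum to zero and absorb the imaginary part of \<open>S\<close>.\<close>
  define m where "m = (\<Sum>j\<in>UNIV. p j) / of_nat CARD('n)"
  define d where "d j = p j - m" for j
  have d0: "(\<Sum>j\<in>UNIV. d j) = 0" by (simp add: d_def sum_subtractf m_def)
  have col: "(\<Sum>j\<in>UNIV. S j k) = of_real (y k)" for k
  proof -
    have "(\<Sum>j\<in>UNIV. S j k) = cnj (\<Sum>j\<in>UNIV. S k j)" by (simp add: herm[of _ k])
    then show ?thesis by (simp add: row)
  qed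
  have y: "y j = (\<Sum>k\<in>UNIV. Re (S j k))" for j using arg_cong[OF row[of j], of Re] by simp
  have y': "y k = (\<Sum>j\<in>UNIV. Re (S j k))" for k using arg_cong[OF col[of k], of Re] by simp
  note n2 = of_real_norm_square
  have "(\<Sum>j\<in>UNIV. of_real (y j) * (cnj (p j) * p j)) - hform S p =
     (\<Sum>j\<in>UNIV. of_real (y j) * (cnj (d j) * d j)) - hform S d"
  proof -
    have p: "p j = d j + m" for j by (simp add: d_def)
    have 1: "(\<Sum>j\<in>UNIV. \<Sum>k\<in>UNIV. cnj (d j) * S j k * m) = (\<Sum>j\<in>UNIV. of_real (y j) * (cnj (d j) * m))"
      by (simp add: row mult_ac flip: sum_distrib_left sum_distrib_right)
    have 2: "(\<Sum>j\<in>UNIV. \<Sum>k\<in>UNIV. cnj m * S j k * p k) = (\<Sum>k\<in>UNIV. of_real (y k) * (cnj m * p k))"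
      by (subst sum.swap) (simp add: col mult_ac flip: sum_distrib_left sum_distrib_right)
    have "hform S p =
      hform S d + (\<Sum>j\<in>UNIV. \<Sum>k\<in>UNIV. cnj (d j) * S j k * m)
       + (\<Sum>j\<in>UNIV. \<Sum>k\<in>UNIV. cnj m * S j k * p k)"
      unfolding sum.distrib[symmetric] by (intro sum.cong refl) (simp add: p algebra_simps)
    moreover have "(\<Sum>j\<in>UNIV. of_real (y j) * (cnj (p j) * p j)) =
      (\<Sum>j\<in>UNIV. of_real (y j) * (cnj (d j) * d j)) + (\<Sum>j\<in>UNIV. of_real (y j) * (cnj (d j) * m))
       + (\<Sum>k\<in>UNIV. of_real (y k) * (cnj m * p k))"
      unfolding sum.distrib[symmetric] by (intro sum.cong refl) (simp add: p algebra_simps)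
    ultimately show ?thesis unfolding 1 2 by simp
  qed
  then have "(\<Sum>j\<in>UNIV. y j * (norm (p j))\<^sup>2) - Re (hform S p) =
     (\<Sum>j\<in>UNIV. y j * (norm (d j))\<^sup>2) - Re (hform S d)"
  proof -
    assume e: "(\<Sum>j\<in>UNIV. of_real (y j) * (cnj (p j) * p j)) - hform S p =
     (\<Sum>j\<in>UNIV. of_real (y j) * (cnj (d j) * d j)) - hform S d"
    have r: "Re (\<Sum>j\<in>UNIV. of_real (y j) * (cnj (q j) * q j)) = (\<Sum>j\<in>UNIV. y j * (norm (q j))\<^sup>2)" for q
      unfolding n2[symmetric] of_real_mult[symmetric] of_real_sum[symmetric] by (rule Re_complex_of_real)
    show ?thesis using arg_cong[OF e, of Re] unfolding minus_complex.simps(1) r .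
  qed
  moreover have "0 \<le> (\<Sum>j\<in>UNIV. y j * (norm (d j))\<^sup>2) - Re (hform S d)"
  proof -
    let ?q = "\<lambda>j k. (norm (d j))\<^sup>2 + (norm (d k))\<^sup>2"
    have a: "(\<Sum>j\<in>UNIV. y j * (norm (d j))\<^sup>2) = (\<Sum>j\<in>UNIV. \<Sum>k\<in>UNIV. Re (S j k) * (norm (d j))\<^sup>2)"
      by (simp add: y sum_distrib_right)
    have b: "(\<Sum>j\<in>UNIV. y j * (norm (d j))\<^sup>2) = (\<Sum>j\<in>UNIV. \<Sum>k\<in>UNIV. Re (S j k) * (norm (d k))\<^sup>2)"
      by (subst sum.swap) (simp add: y' sum_distrib_right)
    have yq: "(\<Sum>j\<in>UNIV. y j * (norm (d j))\<^sup>2) = (\<Sum>j\<in>UNIV. \<Sum>k\<in>UNIV. Re (S j k) * ?q j k / 2)"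
    proof -
      have "(\<Sum>j\<in>UNIV. \<Sum>k\<in>UNIV. Re (S j k) * ?q j k / 2) =
        ((\<Sum>j\<in>UNIV. \<Sum>k\<in>UNIV. Re (S j k) * (norm (d j))\<^sup>2) + (\<Sum>j\<in>UNIV. \<Sum>k\<in>UNIV. Re (S j k) * (norm (d k))\<^sup>2)) / 2"
        unfolding sum.distrib[symmetric] sum_divide_distrib by (intro sum.cong refl) (simp add: algebra_simps)
      then show ?thesis using a b by simp
    qed
    \<comment> \<open>The right-hand side is \<open>Re S * (Q - Re u) + Im S * Im u\<close>. The
      first term is at least \<open>\<rho> * (Q - Re u)\<close>, the second at least
      \<open>- \<rho> * norm u\<close>, and \<open>norm u \<le> Q\<close> by the inequality of
      means.\<close>
    have key: "- \<rho> * Re (cnj (d j) * d k) \<le> Re (S j k) * ?q j k / 2 - Re (cnj (d j) * S j k * d k)" for j k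
    proof -
      define u where "u = cnj (d j) * d k"
      have r: "Re (cnj (d j) * S j k * d k) = Re (S j k) * Re u - Im (S j k) * Im u"
        by (simp add: u_def algebra_simps)
      have nu: "norm u = norm (d j) * norm (d k)" by (simp add: u_def norm_mult)
      have q0: "0 \<le> (norm (d j) - norm (d k))\<^sup>2" by simp
      define Q where "Q = ?q j k / 2"
      have q: "norm u \<le> Q" unfolding nu Q_def using q0 by (simp add: power2_diff)
      have r0: "0 \<le> \<rho>" using im[of j k] abs_ge_zero order.trans by blast
      have "Im (S j k) * Im u \<ge> - (\<rho> * norm u)"
      proof -
        have "\<bar>Im (S j k) * Im u\<bar> \<le> \<rho> * norm u"
          unfolding abs_mult using im r0 by (intro mult_mono abs_Im_le_cmod) auto
        then show ?thesis by linarith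
      qed
      moreover have "\<rho> * norm u \<le> \<rho> * Q" using q r0 by (rule mult_left_mono)
      moreover have "(Re (S j k) - \<rho>) * (Q - Re u) \<ge> 0"
        using re[of j k] q complex_Re_le_cmod[of u] by (intro mult_nonneg_nonneg) auto
      ultimately have "- \<rho> * Re u \<le> Re (S j k) * Q - Re (cnj (d j) * S j k * d k)"
        unfolding r by (simp add: algebra_simps)
      then show ?thesis by (simp add: u_def Q_def)
    qed
    have "0 = - \<rho> * Re (cnj (\<Sum>j\<in>UNIV. d j) * (\<Sum>k\<in>UNIV. d k))" by (simp add: d0)
    also have "\<dots> = (\<Sum>j\<in>UNIV. \<Sum>k\<in>UNIV. - \<rho> * Re (cnj (d j) * d k))"
      unfolding cnj_sum sum_product Re_sum unfolding sum_distrib_left by (rule refl)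
    also have "\<dots> \<le> (\<Sum>j\<in>UNIV. \<Sum>k\<in>UNIV. Re (S j k) * ?q j k / 2 - Re (cnj (d j) * S j k * d k))"
      by (intro sum_mono key)
    also have "\<dots> = (\<Sum>j\<in>UNIV. y j * (norm (d j))\<^sup>2) - Re (hform S d)"
      unfolding yq Re_sum sum_subtractf by (rule refl)
    finally show ?thesis .
  qed
  ultimately show ?thesis by linarith
qed

text \<open>Inversion reverses the order of positive forms: an upper bound \<open>diag y\<close> for
  \<open>W\<close> becomes the lower bound \<open>diag (1 / y)\<close> for \<open>M\<close>. The
  unitary phases \<open>U\<close> leave a diagonal bound unchanged, so it suffices to bound
  \<open>S\<close>.\<close>

lemma inverse_form_lower_bound:
  fixes M W S :: "'n::finite \<Rightarrow> 'n \<Rightarrow> complex"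
  assumes inv: "\<And>j m. (\<Sum>k\<in>UNIV. M j k * W k m) = (if j = m then of_real t else 0)"
    and hM: "\<And>j k. M k j = cnj (M j k)" and t: "t > 0"
    and psd: "\<And>f. 0 \<le> Re (hform M f)"
    and W: "\<And>j k. W j k = U j * S j k * cnj (U k)" and U: "\<And>j. norm (U j) = 1"
    and S: "\<And>p. Re (hform S p) \<le> (\<Sum>j\<in>UNIV. y j * (norm (p j))\<^sup>2)"
    and y: "\<And>j. y j > 0"
  shows "t * (\<Sum>j\<in>UNIV. (norm (f j))\<^sup>2 / y j) \<le> Re (hform M f)"
proof -
  define B where "B f g = (\<Sum>j\<in>UNIV. \<Sum>k\<in>UNIV. cnj (f j) * M j k * g k)" for f g :: "'n \<Rightarrow> complex"
  define x where "x j = f j / of_real (y j)" for j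
  define w where "w k = (\<Sum>m\<in>UNIV. W k m * x m)" for k
  have Mw: "(\<Sum>k\<in>UNIV. M j k * w k) = of_real t * x j" for j
  proof -
    have "(\<Sum>k\<in>UNIV. M j k * w k) = (\<Sum>m\<in>UNIV. (\<Sum>k\<in>UNIV. M j k * W k m) * x m)"
      unfolding w_def sum_distrib_left sum_distrib_right mult.assoc by (rule sum.swap)
    also have "\<dots> = (\<Sum>m\<in>UNIV. if m = j then of_real t * x j else 0)"
      unfolding inv by (intro sum.cong refl) auto
    finally show ?thesis by simp
  qed
  have Bw: "B g w = of_real t * (\<Sum>j\<in>UNIV. cnj (g j) * x j)" for g
  proof -
    have "B g w = (\<Sum>j\<in>UNIV. cnj (g j) * (\<Sum>k\<in>UNIV. M j k * w k))"
      by (simp add: B_def sum_distrib_left mult.assoc)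
    then show ?thesis unfolding Mw by (simp add: sum_distrib_left mult.left_commute)
  qed
  have Bh: "B g h = cnj (B h g)" for g h
  proof -
    have "cnj (B h g) = (\<Sum>k\<in>UNIV. \<Sum>j\<in>UNIV. cnj (g j) * M j k * h k)"
      by (simp add: B_def hM[symmetric] mult_ac)
    then show ?thesis unfolding B_def by (subst sum.swap) simp
  qed
  let ?q = "\<Sum>j\<in>UNIV. (norm (f j))\<^sup>2 / y j"
  note n2 = of_real_norm_square
  have fx: "(\<Sum>j\<in>UNIV. cnj (f j) * x j) = of_real ?q"
    by (simp add: x_def flip: n2 of_real_power)
  \<comment> \<open>\<open>w = W x\<close> with \<open>x = f / y\<close>; expand the nonnegative form \<open>M\<close> at \<open>f - w\<close>.\<close>
  have "0 \<le> Re (B (\<lambda>j. f j - w j) (\<lambda>j. f j - w j))" unfolding B_def by (rule psd)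
  also have "B (\<lambda>j. f j - w j) (\<lambda>j. f j - w j) = B f f - B f w - B w f + B w w"
    by (simp add: B_def algebra_simps sum.distrib sum_subtractf)
  also have "Re \<dots> = Re (B f f) - 2 * (t * ?q) + Re (B w w)"
    unfolding Bh[of w f] Bw[of f] fx by (simp flip: of_real_mult del: of_real_sum)
  also have "Re (B w w) \<le> t * ?q"
  proof -
    have 1: "B w w = of_real t * cnj (\<Sum>j\<in>UNIV. cnj (x j) * w j)" unfolding Bw by (simp add: mult.commute)
    have 2: "(\<Sum>j\<in>UNIV. cnj (x j) * w j) = (\<Sum>j\<in>UNIV. \<Sum>k\<in>UNIV. cnj (cnj (U j) * x j) * S j k * (cnj (U k) * x k))"
      by (simp add: w_def W sum_distrib_left mult_ac)
    have 3: "Re (of_real t * cnj z) = t * Re z" for z by simp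
    have "Re (B w w) = t * Re (\<Sum>j\<in>UNIV. \<Sum>k\<in>UNIV. cnj (cnj (U j) * x j) * S j k * (cnj (U k) * x k))"
      unfolding 1 2 by (rule 3)
    also have "\<dots> \<le> t * (\<Sum>j\<in>UNIV. y j * (norm (cnj (U j) * x j))\<^sup>2)"
      using t by (intro mult_left_mono S) auto
    also have "(\<Sum>j\<in>UNIV. y j * (norm (cnj (U j) * x j))\<^sup>2) = ?q"
    proof (intro sum.cong refl)
      fix j
      show "y j * (norm (cnj (U j) * x j))\<^sup>2 = (norm (f j))\<^sup>2 / y j"
        using y[of j] by (simp add: norm_mult U x_def norm_divide power_divide power2_eq_square)
    qed
    finally show ?thesis .
  qed
  finally show ?thesis unfolding B_def by simp
qed

lemma scaled_left_inverse_imp_right: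
  fixes R B :: "'n::finite \<Rightarrow> 'n \<Rightarrow> complex"
  assumes "\<And>j m. (\<Sum>k\<in>UNIV. B j k * R k m) = (if j = m then c else 0)" "c \<noteq> 0"
  shows "(\<Sum>k\<in>UNIV. R j k * B k m) = (if j = m then c else 0)"
proof -
  define R' B' :: "complex^'n^'n" where "R' = (\<chi> j k. R j k)" and "B' = (\<chi> j k. B j k / c)"
  have "B' ** R' = mat 1"
    using assms by (simp add: R'_def B'_def vec_eq_iff matrix_matrix_mult_def mat_def flip: sum_divide_distrib)
  then have "R' ** B' = mat 1" by (simp add: matrix_left_right_inverse)
  then have "(\<Sum>k\<in>UNIV. R j k * B k m) / c = (if j = m then 1 else 0)"
    by (simp add: R'_def B'_def vec_eq_iff matrix_matrix_mult_def mat_def flip: sum_divide_distrib)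
  then show ?thesis using assms(2) by (auto simp: field_simps split: if_splits)
qed

text \<open>This carries symmetries of the Gram matrix over to its scaled inverse: each symmetry
  produces a second right inverse at the same scale.\<close>

lemma scaled_right_inverse_unique:
  fixes R B C :: "'n::finite \<Rightarrow> 'n \<Rightarrow> complex"
  assumes "\<And>j m. (\<Sum>k\<in>UNIV. R j k * B k m) = (if j = m then c else 0)"
    and "\<And>j m. (\<Sum>k\<in>UNIV. R j k * C k m) = (if j = m then c else 0)" "c \<noteq> 0"
  shows "B j m = C j m"
proof -
  define R' B' C' X :: "complex^'n^'n" where "R' = (\<chi> j k. R j k)" and "B' = (\<chi> j k. B j k)"
    and "C' = (\<chi> j k. C j k)" and "X = (\<chi> j k. B j k / c)"
  have "R' ** X = mat 1"
    using assms(1,3) by (simp add: R'_def X_def vec_eq_iff matrix_matrix_mult_def mat_def flip: sum_divide_distrib)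
  then have X: "X ** R' = mat 1" by (simp add: matrix_left_right_inverse)
  have "R' ** B' = R' ** C'" using assms by (simp add: R'_def B'_def C'_def vec_eq_iff matrix_matrix_mult_def)
  then have "X ** R' ** B' = X ** R' ** C'" by (simp flip: matrix_mul_assoc)
  then show ?thesis by (simp add: X B'_def C'_def vec_eq_iff)
qed

section \<open>Energies of exponential sums on the interval from 0 to \<open>T\<close>\<close>

context distinct_nodes
begin

text \<open>The closed form of the integral of \<open>exp ((lam j + cnj (lam k)) * t)\<close> over
  \<open>0 \<le> t \<le> T\<close>. The exponential factor is the value at the midpoint, the price
  of centring the interval.\<close>

definition expint :: "real \<Rightarrow> 'n \<Rightarrow> 'n \<Rightarrow> complex" where
  "expint T j k = of_real T * exp ((lam j + cnj (lam k)) * of_real (T / 2)) * expgram (of_real T) j k"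

text \<open>The conjugation is opposite to that in \<open>hform\<close>: \<open>expform T c\<close>
  is the real part of \<open>hform (expint T)\<close> at the conjugate of \<open>c\<close>.\<close>

definition expform :: "real \<Rightarrow> ('n \<Rightarrow> complex) \<Rightarrow> real" where
  "expform T c = Re (\<Sum>j\<in>UNIV. \<Sum>k\<in>UNIV. c j * cnj (c k) * expint T j k)"

lemma has_integral_exp_mult:
  fixes z :: complex
  assumes "T \<ge> 0"
  shows "((\<lambda>t. exp (z * of_real t)) has_integral of_real T * exp (z * of_real (T / 2)) * sinhc (of_real T * z)) {0..T}"
proof (cases "z = 0 \<or> T = 0")
  case True
  then show ?thesis using assms has_integral_const_real[of "1::complex" 0 T]
    by (auto simp: sinhc_def scaleR_conv_of_real)
next
  case False
  have "((\<lambda>t. exp (z * of_real t)) has_integral exp (z * of_real T) / z - exp (z * of_real 0) / z) {0..T}"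
  proof (rule fundamental_theorem_of_calculus[OF assms])
    fix t assume "t \<in> {0..T}"
    have "((\<lambda>w. exp (z * w) / z) has_field_derivative exp (z * of_real t)) (at (of_real t))"
      using False by (auto intro!: derivative_eq_intros)
    from has_vector_derivative_real_field[OF this]
    show "((\<lambda>t. exp (z * of_real t) / z) has_vector_derivative exp (z * of_real t)) (at t within {0..T})"
      by (rule has_vector_derivative_at_within)
  qed
  moreover have "exp (z * of_real T) / z - exp (z * of_real 0) / z =
      of_real T * exp (z * of_real (T / 2)) * sinhc (of_real T * z)"
  proof -
    have "exp (z * of_real (T / 2)) * exp (of_real T * z / 2) = exp (z * of_real T)"
      by (simp add: mult.commute flip: exp_add)
    moreover have "exp (z * of_real (T / 2)) * exp (- (of_real T * z) / 2) = 1"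
      by (simp add: mult.commute flip: exp_add)
    ultimately show ?thesis using False by (simp add: sinhc_def field_simps)
  qed
  ultimately show ?thesis by simp
qed

lemma has_integral_norm_exp_sum:
  assumes "T \<ge> 0"
  shows "((\<lambda>t. (norm (\<Sum>j\<in>UNIV. c j * exp (lam j * of_real t)))\<^sup>2) has_integral expform T c) {0..T}"
proof -
  have "((\<lambda>t. \<Sum>j\<in>UNIV. \<Sum>k\<in>UNIV. c j * cnj (c k) * exp ((lam j + cnj (lam k)) * of_real t)) has_integral
     (\<Sum>j\<in>UNIV. \<Sum>k\<in>UNIV. c j * cnj (c k) * expint T j k)) {0..T}"
    unfolding expint_def expgram_def by (intro has_integral_sum finite has_integral_mult_right has_integral_exp_mult assms)
  from has_integral_linear[OF this bounded_linear_Re]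
  have "((\<lambda>t. Re (\<Sum>j\<in>UNIV. \<Sum>k\<in>UNIV. c j * cnj (c k) * exp ((lam j + cnj (lam k)) * of_real t))) has_integral
     expform T c) {0..T}" by (simp only: o_def expform_def)
  moreover have "Re (\<Sum>j\<in>UNIV. \<Sum>k\<in>UNIV. c j * cnj (c k) * exp ((lam j + cnj (lam k)) * of_real t)) =
     (norm (\<Sum>j\<in>UNIV. c j * exp (lam j * of_real t)))\<^sup>2" for t
  proof -
    have "complex_of_real ((norm (\<Sum>j\<in>UNIV. c j * exp (lam j * of_real t)))\<^sup>2) =
       (\<Sum>j\<in>UNIV. c j * exp (lam j * of_real t)) * (\<Sum>k\<in>UNIV. cnj (c k) * exp (cnj (lam k) * of_real t))"
      unfolding complex_norm_square by (simp add: exp_cnj)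
    also have "\<dots> = (\<Sum>j\<in>UNIV. \<Sum>k\<in>UNIV. c j * cnj (c k) * exp ((lam j + cnj (lam k)) * of_real t))"
      unfolding sum_product distrib_right exp_add by (simp only: mult_ac)
    finally show ?thesis by (metis Re_complex_of_real)
  qed
  ultimately show ?thesis by simp
qed

lemma expint_hermitian: "expint T k j = cnj (expint T j k)"
  using expgram_cnj[of "of_real T" k j] by (simp add: expint_def exp_cnj add.commute)

lemma expint_psd:
  assumes "T \<ge> 0"
  shows "0 \<le> Re (hform (expint T) f)"
proof -
  have "0 \<le> expform T (\<lambda>j. cnj (f j))"
    by (rule has_integral_nonneg[OF has_integral_norm_exp_sum[OF assms]]) simp
  then show ?thesis by (simp add: expform_def mult_ac)
qed

end

section \<open>Nodes closed under conjugation and the certificate for small \<open>T\<close>\<close>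

locale conj_nodes = distinct_nodes lam for lam :: "'n::finite \<Rightarrow> complex" +
  fixes \<sigma> :: "'n \<Rightarrow> 'n"
  assumes \<sigma>_\<sigma> [simp]: "\<sigma> (\<sigma> j) = j" and lam_\<sigma>: "lam (\<sigma> j) = cnj (lam j)"
begin

lemma bij_\<sigma>: "bij \<sigma>"
  by (metis \<sigma>_\<sigma> bijI')

lemma sum_\<sigma>: "(\<Sum>k\<in>UNIV. f (\<sigma> k)) = (\<Sum>k\<in>UNIV. f k)"
  using sum.reindex_bij_betw[OF bij_\<sigma>, of f] .

lemma wt_\<sigma>: "wt (\<sigma> j) = cnj (wt j)"
proof -
  have "bij_betw \<sigma> (UNIV - {j}) (UNIV - {\<sigma> j})"
    using bij_betw_DiffI[of \<sigma> UNIV UNIV "{j}" "{\<sigma> j}"] bij_\<sigma> by auto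
  then have "(\<Prod>k\<in>UNIV - {\<sigma> j}. lam (\<sigma> j) - lam k) = (\<Prod>k\<in>UNIV - {j}. lam (\<sigma> j) - lam (\<sigma> k))"
    by (rule prod.reindex_bij_betw[symmetric])
  then show ?thesis by (simp add: wt_def lam_\<sigma>)
qed

definition wt_sum :: real where
  "wt_sum = (\<Sum>j\<in>UNIV. norm (wt j))"

text \<open>In the eigenbasis of \<open>A\<close> this weighted mean turns out to be
  \<open>alpha_n A\<close>, and \<open>1 / wt_sum\<close> to be \<open>delta_n A\<close>.\<close>

definition wt_mean :: real where
  "wt_mean = (\<Sum>j\<in>UNIV. norm (wt j) * Re (lam j)) / wt_sum"

lemma wt_sum_pos: "wt_sum > 0"
  unfolding wt_sum_def by (intro sum_pos) (simp_all add: wt_nonzero)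

lemma kappa_inv_pos: "kappa_inv m > 0"
  by (simp add: kappa_inv_def)

lemma expgram_\<sigma>: "expgram (of_real T) (\<sigma> j) (\<sigma> k) = cnj (expgram (of_real T) j k)"
  unfolding expgram_def sinhc_cnj[symmetric] by (simp add: lam_\<sigma>)

text \<open>A dual certificate for the optimality of the weights proportional to \<open>y\<close>: the form
  \<open>expform T\<close> dominates a diagonal form, with equality at a vector with moduli \<open>y\<close>.\<close>

definition certifies :: "real \<Rightarrow> ('n \<Rightarrow> real) \<Rightarrow> bool" where
  "certifies T y \<longleftrightarrow> (\<forall>j. y j > 0 \<and> y (\<sigma> j) = y j) \<and>
     (\<forall>f. T ^ (2 * CARD('n) - 1) * (\<Sum>j\<in>UNIV. (norm (f j))\<^sup>2 / y j) \<le> expform T f) \<and>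
     (\<exists>c. (\<forall>j. c (\<sigma> j) = cnj (c j) \<and> norm (c j) = y j) \<and>
        expform T c = T ^ (2 * CARD('n) - 1) * (\<Sum>j\<in>UNIV. y j))"

text \<open>\<open>Y j\<close> is the \<open>j\<close>-th row sum of the scaled inverse after the
  phases are stripped. The even matrix \<open>B\<close> and the phases are both stationary at 0, so
  the derivative of \<open>Y\<close> comes from the exponential factors \<open>E\<close> alone; this
  produces the mean of \<open>Re (lam j)\<close> and \<open>wt_mean\<close>.\<close>

lemma certificate:
  obtains R Y where "R > 0" "\<And>j. Y j holomorphic_on ball 0 R"
    "\<And>j. Y j 0 = of_real (kappa_inv CARD('n) * norm (wt j) * wt_sum)"
    "\<And>j. (Y j has_field_derivative
        of_real (- (kappa_inv CARD('n) * norm (wt j) * wt_sum * (Re (lam j) + wt_mean) / 2))) (at 0)"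
    "\<And>T. 0 < T \<Longrightarrow> T < R \<Longrightarrow> \<exists>y. certifies T y \<and> (\<forall>j. Y j (of_real T) = of_real (y j))"
proof -
  let ?n = "CARD('n)"
  obtain r B where r: "r > 0" and hB: "\<And>j k. (\<lambda>T. B T j k) holomorphic_on ball 0 r"
    and RB: "\<And>T j m. T \<in> ball 0 r \<Longrightarrow>
      (\<Sum>k\<in>UNIV. expgram T j k * B T k m) = (if j = m then T ^ (2 * ?n - 2) else 0)"
    and B0: "\<And>j m. B 0 j m = of_real (kappa_inv ?n) * cnj (wt j) * wt m"
    using expgram_scaled_inverse by blast
  define K where "K = kappa_inv ?n"
  have K: "K > 0" by (simp add: K_def kappa_inv_pos)
  define s where "s j = norm (wt j)" for j
  have s: "s j > 0" for j by (simp add: s_def wt_nonzero)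
  have s\<sigma>: "s (\<sigma> j) = s j" for j by (simp add: s_def wt_\<sigma>)
  \<comment> \<open>These phases turn the rank-one limit of \<open>B\<close> into the positive
    matrix with entries \<open>K * s j * s k\<close>.\<close>
  define u where "u j = cnj (wt j) / of_real (s j)" for j
  have u1: "cnj (u j) * cnj (wt j) = of_real (s j)" "wt j * u j = of_real (s j)" for j
    using s[of j] complex_norm_square[of "wt j"] by (simp_all add: u_def s_def power2_eq_square divide_eq_eq mult.commute)
  have nu: "norm (u j) = 1" for j using s[of j] by (simp add: u_def s_def norm_divide)
  have uu: "u j * cnj (u j) = 1" for j using complex_norm_square[of "u j"] by (simp add: nu)
  have u\<sigma>: "u (\<sigma> j) = cnj (u j)" for j by (simp add: u_def s\<sigma> wt_\<sigma>)
  \<comment> \<open>Centring makes \<open>expgram\<close> even in \<open>T\<close>, and its scaled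
    inverse is unique for \<open>T \<noteq> 0\<close>.\<close>
  have even: "B (- T) j m = B T j m" if "T \<in> ball 0 r" for T j m
  proof (cases "T = 0")
    case False
    have e: "(\<Sum>k\<in>UNIV. expgram T j k * B (- T) k m) = (if j = m then T ^ (2 * ?n - 2) else 0)" for j m
      using RB[of "- T" j m] that by (simp add: expgram_minus)
    show ?thesis
      by (rule scaled_right_inverse_unique[where R = "expgram T", OF e RB[OF that]]) (use False in simp)
  qed simp
  have dB: "((\<lambda>T. B T j k) has_field_derivative 0) (at 0)" for j k
  proof (rule even_DERIV_0[OF r])
    show "B (- T) j k = B T j k" if "T \<in> ball 0 r" for T using that by (rule even)
    show "(\<lambda>T. B T j k) field_differentiable at 0"
      by (rule holomorphic_on_imp_differentiable_at[OF hB]) (use r in auto)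
  qed
  \<comment> \<open>The modulus of the inverse midpoint factors. Their phases are unitary and are
    absorbed by \<open>\<phi>\<close> below.\<close>
  define E where "E T j k = exp (- (of_real ((Re (lam j) + Re (lam k)) / 2) * T))" for T :: complex and j k
  \<comment> \<open>Dividing row \<open>j\<close> by \<open>K * s j\<close> makes all rows equal at
    \<open>T = 0\<close>, as the fixed-point construction requires.\<close>
  define C where "C T j k = E T j k * (cnj (u j) * B T j k * u k) / of_real (K * s j)" for T j k
  define C' where "C' j k = complex_of_real (- ((Re (lam j) + Re (lam k)) / 2 * s k))" for j k
  have Ks: "complex_of_real (K * s j) \<noteq> 0" for j using K s[of j] by simp
  have uBu: "cnj (u j) * B 0 j k * u k = of_real (K * s j * s k)" for j k
    using u1(1)[of j] u1(2)[of k] by (simp add: B0 K_def mult_ac) (metis (no_types, opaque_lifting) mult.assoc mult.commute mult.left_commute)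
  have holC: "(\<lambda>T. C T j k) holomorphic_on ball 0 r" for j k
    unfolding C_def E_def using Ks[of j] by (intro holomorphic_intros hB) auto
  have C0: "C 0 j k = of_real (s k)" for j k
    using Ks[of j] unfolding C_def uBu by (simp add: E_def)
  have dE: "((\<lambda>T. E T j k) has_field_derivative - of_real ((Re (lam j) + Re (lam k)) / 2)) (at 0)" for j k
    unfolding E_def by (auto intro!: derivative_eq_intros)
  have dC: "((\<lambda>T. C T j k) has_field_derivative C' j k) (at 0)" for j k
  proof -
    have "((\<lambda>T. E T j k * (cnj (u j) * B T j k * u k)) has_field_derivative
        (- of_real ((Re (lam j) + Re (lam k)) / 2)) * of_real (K * s j * s k)) (at 0)"
      by (rule DERIV_cong[OF DERIV_mult[OF dE DERIV_cmult_right[OF DERIV_cmult[OF dB]]]])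
        (simp add: uBu del: of_real_divide of_real_add of_real_mult)
    from DERIV_cdivide[OF this, of "of_real (K * s j)"]
    have "((\<lambda>T. C T j k) has_field_derivative
        (- of_real ((Re (lam j) + Re (lam k)) / 2)) * of_real (K * s j * s k) / of_real (K * s j)) (at 0)"
      unfolding C_def .
    moreover have "(- of_real ((Re (lam j) + Re (lam k)) / 2)) * of_real (K * s j * s k) / of_real (K * s j) = C' j k"
      using K s[of j] by (simp add: C'_def field_simps)
    ultimately show ?thesis by simp
  qed
  have C': "(\<Sum>k\<in>UNIV. C' (\<sigma> j) k) = (\<Sum>k\<in>UNIV. C' j k)" for j by (simp add: C'_def lam_\<sigma>)
  obtain r' x where r': "0 < r'" "r' \<le> r" and hx: "\<And>j. x j holomorphic_on ball 0 r'" and x0: "\<And>j. x j 0 = 1"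
    and dx: "\<And>j. (x j has_field_derivative 0) (at 0)"
    and e1: "\<And>T j. T \<in> ball 0 r' \<Longrightarrow> x j T * x (\<sigma> j) T = 1"
    and e2: "\<And>T j. T \<in> ball 0 r' \<Longrightarrow> (\<Sum>k\<in>UNIV. C T j k * x k T) * x (\<sigma> j) T = (\<Sum>k\<in>UNIV. C T (\<sigma> j) k * x k T) * x j T"
    and e3: "\<And>T j. T \<in> ball 0 r' \<Longrightarrow> (\<And>j k. C T (\<sigma> j) (\<sigma> k) = cnj (C T j k)) \<Longrightarrow> x (\<sigma> j) T = cnj (x j T)"
    using phase_fixed_point[of r C s \<sigma> C', OF r holC C0 s \<sigma>_\<sigma> dC C'] by blast
  define Y where "Y j T = of_real (K * s j) * ((\<Sum>k\<in>UNIV. C T j k * x k T) * x (\<sigma> j) T)" for j T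
  define S where "S T j k = E T j k * (cnj (u j) * B T j k * u k) * x k T * x (\<sigma> j) T" for T j k
  have rowS: "(\<Sum>k\<in>UNIV. S T j k) = Y j T" for T j
  proof -
    have "S T j k = of_real (K * s j) * (C T j k * x k T * x (\<sigma> j) T)" for k
      using Ks[of j] by (simp add: S_def C_def)
    then show ?thesis by (simp add: Y_def sum_distrib_left sum_distrib_right)
  qed
  \<comment> \<open>Half of the smallest entry of the limit: entries within \<open>\<mu>\<close> of
    the limit have real part at least \<open>\<mu>\<close> and imaginary part at most
    \<open>\<mu>\<close>.\<close>
  define \<mu> where "\<mu> = Min (range (\<lambda>(j,k). K * s j * s k)) / 2"
  have \<mu>: "0 < \<mu>" "2 * \<mu> \<le> K * s j * s k" for j k
  proof -
    have "0 < Min (range (\<lambda>(j,k). K * s j * s k))" using K s by (subst Min_gr_iff) auto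
    then show "0 < \<mu>" by (simp add: \<mu>_def)
    have "Min (range (\<lambda>(j,k). K * s j * s k)) \<le> K * s j * s k" by (rule Min_le) (auto intro: range_eqI[of _ _ "(j,k)"])
    then show "2 * \<mu> \<le> K * s j * s k" by (simp add: \<mu>_def)
  qed
  have "\<forall>\<^sub>F T in at 0. \<forall>j k. dist (S T j k) (of_real (K * s j * s k)) < \<mu>"
  proof (intro eventually_all_finite)
    fix j k
    have "isCont (\<lambda>T. S T j k) 0"
      unfolding S_def by (intro continuous_intros DERIV_isCont[OF dE] DERIV_isCont[OF dB] DERIV_isCont[OF dx])
    then have "((\<lambda>T. S T j k) \<longlongrightarrow> S 0 j k) (at 0)" by (simp add: isCont_def)
    moreover have "S 0 j k = of_real (K * s j * s k)" unfolding S_def uBu by (simp add: E_def x0)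
    ultimately show "\<forall>\<^sub>F T in at 0. dist (S T j k) (of_real (K * s j * s k)) < \<mu>"
      using tendstoD \<mu>(1) by metis
  qed
  then obtain R0 where R0: "R0 > 0" "\<And>T j k. T \<noteq> 0 \<Longrightarrow> norm T < R0 \<Longrightarrow> dist (S T j k) (of_real (K * s j * s k)) < \<mu>"
    by (auto simp: eventually_at)
  define R where "R = min r' R0"
  have R: "R > 0" "R \<le> r'" "R \<le> R0" using r' R0 by (auto simp: R_def)
  have H: "(\<Sum>k\<in>UNIV. s k) = wt_sum" by (simp add: wt_sum_def s_def)
  have HA: "(\<Sum>k\<in>UNIV. s k * Re (lam k)) = wt_sum * wt_mean" using wt_sum_pos by (simp add: wt_mean_def s_def)
  show thesis
  proof (rule that[of R Y])
    show "R > 0" by (rule R)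
    have "(\<lambda>T. C T j k) holomorphic_on ball 0 R" "x j holomorphic_on ball 0 R" for j k
      by (rule holomorphic_on_subset[OF holC] holomorphic_on_subset[OF hx]; use R r' in auto)+
    then show "Y j holomorphic_on ball 0 R" for j
      unfolding Y_def by (intro holomorphic_intros)
    show "Y j 0 = of_real (kappa_inv ?n * norm (wt j) * wt_sum)" for j
      by (simp add: Y_def C0 x0 K_def s_def wt_sum_def)
    have "((\<lambda>T. \<Sum>k\<in>UNIV. C T j k * x k T) has_field_derivative (\<Sum>k\<in>UNIV. C' j k)) (at 0)" for j
      by (rule derivative_eq_intros dC dx refl)+ (simp add: x0)
    then have "(Y j has_field_derivative of_real (K * s j) * ((\<Sum>k\<in>UNIV. C' j k) * x (\<sigma> j) 0 + 0 * (\<Sum>k\<in>UNIV. C 0 j k * x k 0))) (at 0)" for j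
      unfolding Y_def by (intro DERIV_cmult DERIV_mult dx)
    moreover have "of_real (K * s j) * ((\<Sum>k\<in>UNIV. C' j k) * x (\<sigma> j) 0 + 0 * (\<Sum>k\<in>UNIV. C 0 j k * x k 0)) =
      of_real (- (kappa_inv ?n * norm (wt j) * wt_sum * (Re (lam j) + wt_mean) / 2))" for j
    proof -
      have "(\<Sum>k\<in>UNIV. - ((Re (lam j) + Re (lam k)) / 2 * s k)) = - ((Re (lam j) * (\<Sum>k\<in>UNIV. s k) + (\<Sum>k\<in>UNIV. s k * Re (lam k))) / 2)"
        unfolding sum_distrib_left sum.distrib[symmetric] sum_divide_distrib sum_negf[symmetric]
        by (intro sum.cong refl) (simp add: algebra_simps)
      then have "(\<Sum>k\<in>UNIV. - ((Re (lam j) + Re (lam k)) / 2 * s k)) = - (wt_sum * (Re (lam j) + wt_mean) / 2)"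
        unfolding H HA by (simp add: algebra_simps)
      then have "(\<Sum>k\<in>UNIV. C' j k) = of_real (- (wt_sum * (Re (lam j) + wt_mean) / 2))"
        unfolding C'_def of_real_sum[symmetric] by simp
      then show ?thesis by (simp add: x0 K_def s_def)
    qed
    ultimately show "(Y j has_field_derivative
        of_real (- (kappa_inv ?n * norm (wt j) * wt_sum * (Re (lam j) + wt_mean) / 2))) (at 0)" for j
      by simp
  next
    fix T :: real assume T: "0 < T" "T < R"
    define t where "t = complex_of_real T"
    have tb: "t \<in> ball 0 r" "t \<in> ball 0 r'" "t \<noteq> 0" "norm t < R0" using T R r' by (auto simp: t_def)
    have ct: "cnj t = t" by (simp add: t_def)
    let ?c = "t ^ (2 * ?n - 2)"
    have c0: "?c \<noteq> 0" using tb by simp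
    have cc: "cnj ?c = ?c" by (simp add: ct)
    have hR: "expgram t k j = cnj (expgram t j k)" for j k using expgram_cnj[of t k j] by (simp add: ct)
    have sR: "expgram t (\<sigma> j) (\<sigma> k) = cnj (expgram t j k)" for j k unfolding t_def by (rule expgram_\<sigma>)
    \<comment> \<open>The adjoint of \<open>B t\<close> is a left inverse of the Hermitian Gram
      matrix at the same scale, hence a right inverse, hence \<open>B t\<close> itself.\<close>
    have hB': "B t k j = cnj (B t j k)" for j k
    proof -
      have "(\<Sum>k\<in>UNIV. cnj (B t k j) * expgram t k m) = (if j = m then ?c else 0)" for j m
      proof -
        have "(\<Sum>k\<in>UNIV. cnj (B t k j) * expgram t k m) = cnj (\<Sum>k\<in>UNIV. expgram t m k * B t k j)"
          by (simp add: hR[of _ m] mult.commute)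
        then show ?thesis unfolding RB[OF tb(1)] using cc by auto
      qed
      from scaled_left_inverse_imp_right[of "\<lambda>j k. cnj (B t k j)", OF this c0]
      have "cnj (B t j k) = B t k j"
        using scaled_right_inverse_unique[of "expgram t" "\<lambda>j k. cnj (B t k j)" ?c "B t"] RB[OF tb(1)] c0 by blast
      then show ?thesis by simp
    qed
    have sB: "B t (\<sigma> j) (\<sigma> k) = cnj (B t j k)" for j k
    proof -
      have "(\<Sum>k\<in>UNIV. expgram t j k * cnj (B t (\<sigma> k) (\<sigma> m))) = (if j = m then ?c else 0)" for j m
      proof -
        have "expgram t j k = cnj (expgram t (\<sigma> j) (\<sigma> k))" for k by (simp add: sR)
        then have "(\<Sum>k\<in>UNIV. expgram t j k * cnj (B t (\<sigma> k) (\<sigma> m))) =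
            cnj (\<Sum>k\<in>UNIV. expgram t (\<sigma> j) (\<sigma> k) * B t (\<sigma> k) (\<sigma> m))" by simp
        also have "(\<Sum>k\<in>UNIV. expgram t (\<sigma> j) (\<sigma> k) * B t (\<sigma> k) (\<sigma> m)) = (if \<sigma> j = \<sigma> m then ?c else 0)"
          unfolding sum_\<sigma>[of "\<lambda>k. expgram t (\<sigma> j) k * B t k (\<sigma> m)"] by (rule RB[OF tb(1)])
        finally show ?thesis using cc bij_\<sigma> by (auto simp: bij_def inj_def)
      qed
      from scaled_right_inverse_unique[of "expgram t" "\<lambda>k m. cnj (B t (\<sigma> k) (\<sigma> m))" ?c "B t", OF this RB[OF tb(1)] c0, of j k]
      show ?thesis by (metis complex_cnj_cnj)
    qed
    have cE: "cnj (E t j k) = E t j k" "E t k j = E t j k" "E t (\<sigma> j) (\<sigma> k) = E t j k" for j k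
      by (simp_all add: E_def exp_cnj ct add.commute lam_\<sigma>)
    have sC: "C t (\<sigma> j) (\<sigma> k) = cnj (C t j k)" for j k
      by (simp add: C_def cE sB u\<sigma> s\<sigma>)
    have x\<sigma>: "x (\<sigma> j) t = cnj (x j t)" for j by (rule e3[OF tb(2) sC])
    have xx: "x j t * cnj (x j t) = 1" for j using e1[OF tb(2), of j] by (simp add: x\<sigma>)
    have hS: "S t k j = cnj (S t j k)" for j k
      by (simp add: S_def cE(1) cE(2)[of k j] hB'[of k j] x\<sigma> mult_ac)
    have Y\<sigma>: "Y (\<sigma> j) t = Y j t" for j using e2[OF tb(2), of j] by (simp add: Y_def s\<sigma>)
    have cY: "cnj (Y j t) = Y j t" for j
    proof -
      have "cnj (Y j t) = of_real (K * s j) * ((\<Sum>k\<in>UNIV. C t (\<sigma> j) (\<sigma> k) * x (\<sigma> k) t) * x j t)"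
        by (simp add: Y_def sC x\<sigma>)
      also have "\<dots> = Y (\<sigma> j) t" unfolding sum_\<sigma>[of "\<lambda>k. C t (\<sigma> j) k * x k t"] by (simp add: Y_def s\<sigma>)
      finally show ?thesis by (simp add: Y\<sigma>)
    qed
    define y where "y j = Re (Y j t)" for j
    have Yy: "Y j t = of_real (y j)" for j using cY[of j] by (simp add: y_def complex_eq_iff)
    have Sb: "\<mu> \<le> Re (S t j k)" "\<bar>Im (S t j k)\<bar> \<le> \<mu>" for j k
    proof -
      have d: "norm (S t j k - of_real (K * s j * s k)) < \<mu>" using R0(2)[OF tb(3,4)] by (simp add: dist_norm)
      show "\<mu> \<le> Re (S t j k)"
        using \<mu>(2)[of j k] d abs_Re_le_cmod[of "S t j k - of_real (K * s j * s k)"] by (simp del: of_real_mult)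
      show "\<bar>Im (S t j k)\<bar> \<le> \<mu>"
        using d abs_Im_le_cmod[of "S t j k - of_real (K * s j * s k)"] by (simp del: of_real_mult)
    qed
    have ypos: "y j > 0" for j
    proof -
      have "y j = (\<Sum>k\<in>UNIV. Re (S t j k))" using arg_cong[OF rowS[where j = j and T = t], of Re] by (simp add: y_def)
      also have "\<dots> > 0" using Sb(1) \<mu>(1) by (intro sum_pos) (auto intro: less_le_trans)
      finally show ?thesis .
    qed
    have row: "(\<Sum>k\<in>UNIV. S t j k) = of_real (y j)" for j by (simp add: rowS Yy)
    define \<phi> where "\<phi> j = exp (\<i> * of_real (Im (lam j)) * t / 2)" for j
    have c\<phi>: "cnj (\<phi> j) = exp (- (\<i> * of_real (Im (lam j)) * t / 2))" for j by (simp add: \<phi>_def exp_cnj ct)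
    have \<phi>\<phi>: "\<phi> j * cnj (\<phi> j) = 1" for j unfolding c\<phi> by (simp add: \<phi>_def flip: exp_add)
    have \<phi>\<sigma>: "\<phi> (\<sigma> j) = cnj (\<phi> j)" for j unfolding c\<phi> by (simp add: \<phi>_def lam_\<sigma>)
    \<comment> \<open>The inverse of \<open>expint T\<close> is \<open>W\<close> up to the factor \<open>T ^ (2 * CARD('n) - 1)\<close>, and the unitary phases
      \<open>U\<close> conjugate \<open>W\<close> to \<open>S t\<close>.\<close>
    define U where "U j = \<phi> j * u j * x j t" for j
    have UU: "U j * cnj (U j) = 1" for j
    proof -
      have "U j * cnj (U j) = (\<phi> j * cnj (\<phi> j)) * (u j * cnj (u j)) * (x j t * cnj (x j t))"
        by (simp add: U_def mult_ac)
      then show ?thesis by (simp add: \<phi>\<phi> uu xx)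
    qed
    have nU: "norm (U j) = 1" for j
      using UU[of j] complex_norm_square[of "U j"] by (metis norm_ge_zero of_real_eq_1_iff power2_eq_1_iff neg_0_le_iff_le not_one_le_zero)
    have U\<sigma>: "U (\<sigma> j) = cnj (U j)" for j by (simp add: U_def \<phi>\<sigma> u\<sigma> x\<sigma>)
    define W where "W j k = U j * S t j k * cnj (U k)" for j k
    have W: "W k m = exp (- ((cnj (lam k) + lam m) * t / 2)) * B t k m" for k m
    proof -
      have "W k m = (\<phi> k * E t k m * cnj (\<phi> m)) * B t k m * (u k * cnj (u k)) * (x k t * cnj (x k t)) * (u m * cnj (u m)) * (x m t * cnj (x m t))"
        by (simp add: W_def U_def S_def x\<sigma> mult_ac)
      also have "\<dots> = (\<phi> k * E t k m * cnj (\<phi> m)) * B t k m" by (simp add: uu xx)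
      also have "\<phi> k * E t k m * cnj (\<phi> m) = exp (- ((cnj (lam k) + lam m) * t / 2))"
      proof -
        have 1: "- ((a - \<i> * b + (c + \<i> * d)) * t / 2) = \<i> * b * t / 2 + - ((a + c) / 2 * t) + - (\<i> * d * t / 2)" for a b c d
          by (simp add: algebra_simps add_divide_distrib diff_divide_distrib)
        have 2: "cnj (lam k) = of_real (Re (lam k)) - \<i> * of_real (Im (lam k))" by (simp add: complex_eq_iff)
        have 3: "lam m = of_real (Re (lam m)) + \<i> * of_real (Im (lam m))" by (simp add: complex_eq_iff)
        have "- ((cnj (lam k) + lam m) * t / 2) = \<i> * of_real (Im (lam k)) * t / 2
            + - ((of_real (Re (lam k)) + of_real (Re (lam m))) / 2 * t) + - (\<i> * of_real (Im (lam m)) * t / 2)"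
          by (subst 3, subst 2) (rule 1)
        then have eq: "exp (- ((cnj (lam k) + lam m) * t / 2)) = exp (\<i> * of_real (Im (lam k)) * t / 2
            + - ((of_real (Re (lam k)) + of_real (Re (lam m))) / 2 * t) + - (\<i> * of_real (Im (lam m)) * t / 2))"
          by (rule arg_cong)
        have 4: "complex_of_real ((Re (lam k) + Re (lam m)) / 2) = (of_real (Re (lam k)) + of_real (Re (lam m))) / 2"
          by simp
        show ?thesis unfolding eq c\<phi> exp_add unfolding \<phi>_def E_def 4 by (rule refl)
      qed
      finally show ?thesis .
    qed
    have inv: "(\<Sum>k\<in>UNIV. expint T j k * W k m) = (if j = m then of_real (T ^ (2 * ?n - 1)) else 0)" for j m
    proof -
      have e: "exp ((lam j + cnj (lam k)) * of_real (T / 2)) * exp (- ((cnj (lam k) + lam m) * t / 2)) =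
          exp ((lam j - lam m) * t / 2)" for k
      proof -
        have "(lam j + cnj (lam k)) * of_real (T / 2) + - ((cnj (lam k) + lam m) * t / 2) = (lam j - lam m) * t / 2"
          by (simp add: t_def algebra_simps add_divide_distrib diff_divide_distrib)
        then show ?thesis unfolding exp_add[symmetric] by (rule arg_cong)
      qed
      have "(\<Sum>k\<in>UNIV. expint T j k * W k m) = (\<Sum>k\<in>UNIV. t * (exp ((lam j + cnj (lam k)) * of_real (T / 2)) * exp (- ((cnj (lam k) + lam m) * t / 2))) *
          (expgram t j k * B t k m))"
        unfolding expint_def W t_def by (intro sum.cong refl) (simp only: mult_ac)
      also have "\<dots> = t * exp ((lam j - lam m) * t / 2) * (\<Sum>k\<in>UNIV. expgram t j k * B t k m)"
        unfolding e by (simp add: sum_distrib_left)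
      also have "\<dots> = (if j = m then t * t ^ (2 * ?n - 2) else 0)" unfolding RB[OF tb(1)] by simp
      also have "t * t ^ (2 * ?n - 2) = of_real (T ^ (2 * ?n - 1))"
      proof -
        have "2 * ?n - 1 = Suc (2 * ?n - 2)" using zero_less_card_finite[where 'a='n] by arith
        then show ?thesis by (simp add: t_def)
      qed
      finally show ?thesis .
    qed
    \<comment> \<open>Since \<open>W\<close> maps \<open>U\<close> to \<open>U k * y k\<close>, the
      vector \<open>cnj (c k)\<close> is the image of \<open>U\<close> under \<open>W\<close>, and
      \<open>expint T\<close> maps it back to a multiple of \<open>U\<close>. This makes the value
      at \<open>c\<close> explicit.\<close>
    define c where "c j = cnj (U j) * of_real (y j)" for j
    have lower: "T ^ (2 * ?n - 1) * (\<Sum>j\<in>UNIV. (norm (f j))\<^sup>2 / y j) \<le> expform T f" for f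
    proof -
      have "T ^ (2 * ?n - 1) * (\<Sum>j\<in>UNIV. (norm (cnj (f j)))\<^sup>2 / y j) \<le>
         Re (\<Sum>j\<in>UNIV. \<Sum>k\<in>UNIV. cnj (cnj (f j)) * expint T j k * cnj (f k))"
      proof (rule inverse_form_lower_bound[where U = U and S = "S t" and W = W])
        show "Re (hform (S t) p) \<le> (\<Sum>j\<in>UNIV. y j * (norm (p j))\<^sup>2)" for p
          by (rule laplacian_form_nonneg[where \<rho> = \<mu>]) (rule hS row Sb)+
        show "0 < T ^ (2 * ?n - 1)" using T by simp
        show "0 \<le> Re (hform (expint T) f)" for f
          by (rule expint_psd) (use T in simp)
      qed (fact inv, fact expint_hermitian, fact W_def, fact nU, fact ypos)
      then show ?thesis by (simp add: expform_def mult_ac)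
    qed
    have val: "expform T c = T ^ (2 * ?n - 1) * (\<Sum>j\<in>UNIV. y j)"
    proof -
      have WU: "(\<Sum>m\<in>UNIV. W k m * U m) = U k * of_real (y k)" for k
      proof -
        have "(\<Sum>m\<in>UNIV. W k m * U m) = (\<Sum>m\<in>UNIV. U k * S t k m * (U m * cnj (U m)))"
          unfolding W_def by (intro sum.cong refl) (simp only: mult_ac)
        then show ?thesis by (simp add: UU row flip: sum_distrib_left)
      qed
      have MU: "(\<Sum>k\<in>UNIV. expint T j k * cnj (c k)) = of_real (T ^ (2 * ?n - 1)) * U j" for j
      proof -
        have "(\<Sum>k\<in>UNIV. expint T j k * cnj (c k)) = (\<Sum>k\<in>UNIV. expint T j k * (\<Sum>m\<in>UNIV. W k m * U m))"
          by (simp add: WU c_def)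
        also have "\<dots> = (\<Sum>m\<in>UNIV. (\<Sum>k\<in>UNIV. expint T j k * W k m) * U m)"
          unfolding sum_distrib_left sum_distrib_right mult.assoc by (rule sum.swap)
        also have "\<dots> = (\<Sum>m\<in>UNIV. if m = j then of_real (T ^ (2 * ?n - 1)) * U m else 0)"
          unfolding inv by (intro sum.cong refl) auto
        finally show ?thesis by simp
      qed
      have "(\<Sum>j\<in>UNIV. \<Sum>k\<in>UNIV. c j * cnj (c k) * expint T j k) = (\<Sum>j\<in>UNIV. c j * (\<Sum>k\<in>UNIV. expint T j k * cnj (c k)))"
        unfolding sum_distrib_left by (intro sum.cong refl) (simp only: mult_ac)
      also have "\<dots> = (\<Sum>j\<in>UNIV. of_real (T ^ (2 * ?n - 1)) * of_real (y j) * (U j * cnj (U j)))"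
        unfolding MU unfolding c_def by (intro sum.cong refl) (simp only: mult_ac)
      also have "\<dots> = of_real (T ^ (2 * ?n - 1) * (\<Sum>j\<in>UNIV. y j))"
        by (simp add: UU sum_distrib_left)
      finally show ?thesis unfolding expform_def by (metis Re_complex_of_real)
    qed
    have "y (\<sigma> j) = y j" for j by (simp add: y_def Y\<sigma>)
    moreover have "c (\<sigma> j) = cnj (c j)" for j by (simp add: c_def U\<sigma> y_def Y\<sigma>)
    moreover have "norm (c j) = y j" for j using ypos[of j] by (simp add: c_def norm_mult nU)
    ultimately have "certifies T y" unfolding certifies_def using ypos lower val by blast
    then show "\<exists>y. certifies T y \<and> (\<forall>j. Y j (of_real T) = of_real (y j))"
      using Yy unfolding t_def by blast
  qed
qed

end

section \<open>Smallest eigenvalues of symmetric matrices\<close>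

text \<open>The Rayleigh quotient attains its minimum on the unit sphere by compactness. The
  minimiser is an eigenvector, since otherwise moving along the residual \<open>r\<close> would
  lower the quotient.\<close>

lemma lambda_min_properties:
  fixes M :: "real^'n^'n"
  assumes sym: "transpose M = M"
  shows lambda_min_le: "lambda_min M * (x \<bullet> x) \<le> x \<bullet> (M *v x)"
    and lambda_min_attained: "\<exists>x. norm x = 1 \<and> x \<bullet> (M *v x) = lambda_min M"
proof -
  have swap: "x \<bullet> (M *v y) = (M *v x) \<bullet> y" for x y
    using dot_lmul_matrix[of x M y] vector_transpose_matrix[of x M] by (simp add: sym)
  have "continuous_on (sphere 0 1) (\<lambda>x. x \<bullet> (M *v x))"
    by (intro continuous_intros linear_continuous_on matrix_vector_mul_bounded_linear)
  moreover have "sphere (0 :: real^'n) 1 \<noteq> {}" by simp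
  ultimately obtain x0 where x0: "x0 \<in> sphere 0 1" and min: "\<And>x. x \<in> sphere 0 1 \<Longrightarrow> x0 \<bullet> (M *v x0) \<le> x \<bullet> (M *v x)"
    using continuous_attains_inf[OF compact_sphere] by blast
  define m where "m = x0 \<bullet> (M *v x0)"
  have xx0: "x0 \<bullet> x0 = 1" "norm x0 = 1" using x0 by (simp_all add: dot_square_norm)
  have low: "m * (x \<bullet> x) \<le> x \<bullet> (M *v x)" for x
  proof (cases "x = 0")
    case False
    have "m \<le> (x /\<^sub>R norm x) \<bullet> (M *v (x /\<^sub>R norm x))" unfolding m_def by (rule min) (use False in simp)
    also have "\<dots> = (x \<bullet> (M *v x)) / (x \<bullet> x)"
      by (simp add: matrix_vector_mult_scaleR dot_square_norm power2_eq_square divide_inverse)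
    finally show ?thesis using False by (simp add: pos_le_divide_eq)
  qed simp
  define r where "r = M *v x0 - m *\<^sub>R x0"
  have "r = 0"
  proof (rule ccontr)
    assume "r \<noteq> 0"
    define c where "c = r \<bullet> (M *v r) - m * (r \<bullet> r)"
    have c: "c \<ge> 0" using low[of r] by (simp add: c_def)
    have rr: "r \<bullet> r > 0" using \<open>r \<noteq> 0\<close> by simp
    have q: "0 \<le> 2 * t * (r \<bullet> r) + t\<^sup>2 * c" for t
    proof -
      have "(x0 + t *\<^sub>R r) \<bullet> (M *v (x0 + t *\<^sub>R r)) - m * ((x0 + t *\<^sub>R r) \<bullet> (x0 + t *\<^sub>R r)) =
        (x0 \<bullet> (M *v x0) - m * (x0 \<bullet> x0)) + t * (x0 \<bullet> (M *v r) + r \<bullet> (M *v x0) - 2 * m * (r \<bullet> x0)) + t\<^sup>2 * c"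
        by (simp add: c_def matrix_vector_right_distrib matrix_vector_mult_scaleR inner_add_left inner_add_right
            inner_commute[of x0 r] power2_eq_square algebra_simps)
      also have "x0 \<bullet> (M *v r) + r \<bullet> (M *v x0) - 2 * m * (r \<bullet> x0) = 2 * (r \<bullet> r)"
      proof -
        have "r \<bullet> r = r \<bullet> (M *v x0) - m * (r \<bullet> x0)" by (subst (2) r_def) (simp add: inner_diff_right)
        moreover have "x0 \<bullet> (M *v r) = r \<bullet> (M *v x0)" by (rule trans[OF swap inner_commute])
        ultimately show ?thesis by simp
      qed
      finally show ?thesis using low[of "x0 + t *\<^sub>R r"] xx0 by (simp add: m_def algebra_simps)
    qed
    \<comment> \<open>A step along \<open>r\<close> that makes the quadratic negative; the
      denominator \<open>c + 1\<close> in place of \<open>c\<close> also covers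
      \<open>c = 0\<close>.\<close>
    define t where "t = - (r \<bullet> r) / (c + 1)"
    have "2 * t * (r \<bullet> r) + t\<^sup>2 * c = - ((r \<bullet> r)\<^sup>2 * (c + 2) / (c + 1)\<^sup>2)"
      using c by (simp add: t_def power2_eq_square divide_simps) (simp add: algebra_simps)
    moreover have "(r \<bullet> r)\<^sup>2 * (c + 2) / (c + 1)\<^sup>2 > 0" using rr c by (intro divide_pos_pos mult_pos_pos) auto
    ultimately show False using q[of t] by linarith
  qed
  define E where "E = {l. \<exists>x. x \<noteq> 0 \<and> M *v x = l *s x}"
  have mE: "m \<in> E" unfolding E_def using \<open>r = 0\<close> xx0 by (auto simp: r_def scalar_mult_eq_scaleR intro!: exI[of _ x0])
  have Eb: "m \<le> l" if l: "l \<in> E" for l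
  proof -
    obtain x where "x \<noteq> 0" "M *v x = l *s x" using l by (auto simp: E_def)
    then show ?thesis using low[of x] by (simp add: scalar_mult_eq_scaleR)
  qed
  \<comment> \<open>\<open>Min\<close> needs a finite set: eigenvectors for different eigenvalues of
    a symmetric matrix are orthogonal, hence independent.\<close>
  have finE: "finite E"
  proof -
    have "\<forall>l. \<exists>x. l \<in> E \<longrightarrow> x \<noteq> 0 \<and> M *v x = l *\<^sub>R x" by (auto simp: E_def scalar_mult_eq_scaleR)
    then obtain f where f: "\<And>l. l \<in> E \<Longrightarrow> f l \<noteq> 0 \<and> M *v f l = l *\<^sub>R f l" by metis
    have orth: "f l \<bullet> f l' = 0" if "l \<in> E" "l' \<in> E" "l \<noteq> l'" for l l'
      using swap[of "f l" "f l'"] f[OF that(1)] f[OF that(2)] that(3) by auto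
    have inj: "inj_on f E" using f orth by (metis inj_onI inner_eq_zero_iff)
    have "independent (f ` E)"
      using f orth by (intro pairwise_orthogonal_independent) (auto simp: pairwise_def orthogonal_def)
    then show ?thesis using inj finiteI_independent finite_imageD by blast
  qed
  have "lambda_min M = m" unfolding lambda_min_def E_def[symmetric] by (rule Min_eqI[OF finE Eb mE])
  then show "lambda_min M * (x \<bullet> x) \<le> x \<bullet> (M *v x)" "\<exists>x. norm x = 1 \<and> x \<bullet> (M *v x) = lambda_min M"
    using low xx0 m_def by auto
qed

lemma lambda_min_greatest:
  assumes "transpose M = M" "\<And>x. l * (x \<bullet> x) \<le> x \<bullet> (M *v x)"
  shows "l \<le> lambda_min M"
  using lambda_min_attained[OF assms(1)] assms(2) by (metis dot_square_norm mult.right_neutral one_power2)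

section \<open>Coordinates in a unitary eigenbasis\<close>

locale unitary_spectrum =
  fixes A :: "real^'n^'n" and v :: "'n \<Rightarrow> complex^'n" and lam :: "'n \<Rightarrow> complex"
  assumes simple: "simple_spectrum (cmat A)" and basis: "unitary_eigenbasis A v lam"
begin

lemma herm_v: "herm (v j) (v k) = (if j = k then 1 else 0)"
  and eig: "cmat A *v v k = lam k *s v k"
  using basis by (auto simp: unitary_eigenbasis_def)

lemma v_nonzero: "v k \<noteq> 0"
  using herm_v[of k k] by (auto simp: herm_def)

lemma inj_v: "inj v"
  using herm_v by (metis injI zero_neq_one)

text \<open>The eigenvector matrix is square, so orthonormal columns imply orthonormal rows.\<close>

lemma completeness: "(\<Sum>j\<in>UNIV. v j $ a * cnj (v j $ b)) = (if a = b then 1 else 0)"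
proof -
  define V V' :: "complex^'n^'n" where "V = (\<chi> i j. v j $ i)" and "V' = (\<chi> j i. cnj (v j $ i))"
  have "(\<Sum>k\<in>UNIV. cnj (v i $ k) * v j $ k) = (if i = j then 1 else 0)" for i j
    using herm_v[of j i] by (auto simp: herm_def mult.commute)
  then have "V' ** V = mat 1"
    by (simp add: V_def V'_def vec_eq_iff matrix_matrix_mult_def mat_def)
  then have "V ** V' = mat 1" by (simp add: matrix_left_right_inverse)
  then show ?thesis by (simp add: V_def V'_def vec_eq_iff matrix_matrix_mult_def mat_def)
qed

lemma expansion: "x $ a = (\<Sum>j\<in>UNIV. herm x (v j) * v j $ a)"
proof -
  have "(\<Sum>j\<in>UNIV. herm x (v j) * v j $ a) = (\<Sum>i\<in>UNIV. x $ i * (\<Sum>j\<in>UNIV. v j $ a * cnj (v j $ i)))"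
    unfolding herm_def sum_distrib_left sum_distrib_right by (subst sum.swap) (simp add: mult_ac)
  also have "\<dots> = (\<Sum>i\<in>UNIV. if i = a then x $ i else 0)"
    unfolding completeness by (intro sum.cong refl) auto
  finally show ?thesis by simp
qed

lemma herm_sum_v: "herm (\<chi> a. \<Sum>j\<in>UNIV. c j * v j $ a) (v k) = c k"
proof -
  have "herm (\<chi> a. \<Sum>j\<in>UNIV. c j * v j $ a) (v k) = (\<Sum>j\<in>UNIV. c j * herm (v j) (v k))"
    unfolding herm_def vec_lambda_beta sum_distrib_left sum_distrib_right by (subst sum.swap) (simp add: mult_ac)
  also have "\<dots> = (\<Sum>j\<in>UNIV. if j = k then c j else 0)"
    unfolding herm_v by (intro sum.cong refl) auto
  finally show ?thesis by simp
qed

lemma cmat_mult_expansion: "(cmat A *v x) $ a = (\<Sum>j\<in>UNIV. lam j * herm x (v j) * v j $ a)"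
proof -
  have "(cmat A *v x) $ a = (\<Sum>b\<in>UNIV. cmat A $ a $ b * (\<Sum>j\<in>UNIV. herm x (v j) * v j $ b))"
    unfolding matrix_vector_mult_def vec_lambda_beta expansion[of x, symmetric] by (rule refl)
  also have "\<dots> = (\<Sum>j\<in>UNIV. herm x (v j) * (cmat A *v v j) $ a)"
    unfolding matrix_vector_mult_def vec_lambda_beta sum_distrib_left by (subst sum.swap) (simp add: mult_ac)
  finally show ?thesis unfolding eig by (simp add: mult_ac)
qed

lemma herm_cmat_mult: "herm (cmat A *v x) (v k) = lam k * herm x (v k)"
proof -
  have "cmat A *v x = (\<chi> a. \<Sum>j\<in>UNIV. (lam j * herm x (v j)) * v j $ a)"
    by (simp add: vec_eq_iff cmat_mult_expansion)
  then show ?thesis by (simp only: herm_sum_v)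
qed

text \<open>By counting: every eigenvalue occurs among the \<open>lam j\<close>, and a simple
  spectrum has as many eigenvalues as there are indices.\<close>

lemma inj_lam: "inj lam"
proof -
  let ?E = "{z. \<exists>x. x \<noteq> 0 \<and> cmat A *v x = z *s x}"
  have "?E \<subseteq> range lam"
  proof
    fix z assume "z \<in> ?E"
    then obtain x where x: "x \<noteq> 0" "cmat A *v x = z *s x" by auto
    obtain j where j: "herm x (v j) \<noteq> 0"
    proof (rule ccontr)
      assume "\<not> thesis"
      then have "herm x (v j) = 0" for j using that by blast
      then have "x $ a = 0" for a using expansion[of x a] by simp
      then show False using x(1) by (simp add: vec_eq_iff)
    qed
    have "herm (z *s x) (v j) = z * herm x (v j)" by (simp add: herm_def sum_distrib_left mult.assoc)
    then have "z = lam j" using herm_cmat_mult[of x j] j by (simp add: x(2))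
    then show "z \<in> range lam" by simp
  qed
  then have "card ?E \<le> card (range lam)" by (intro card_mono) auto
  then have "CARD('n) \<le> card (range lam)" using simple by (simp add: simple_spectrum_def)
  moreover have "card (range lam) \<le> CARD('n)" by (rule card_image_le) simp
  ultimately show ?thesis by (intro eq_card_imp_inj_on) auto
qed

text \<open>The choice is unambiguous because \<open>v\<close> is injective.\<close>

definition \<sigma> :: "'n \<Rightarrow> 'n" where
  "\<sigma> j = (SOME l. v l = cnj_vec (v j))"

lemma v_\<sigma>: "v (\<sigma> j) $ a = cnj (v j $ a)"
proof -
  have "v (\<sigma> j) = cnj_vec (v j)"
    unfolding \<sigma>_def by (rule someI_ex) (use basis in \<open>auto simp: unitary_eigenbasis_def\<close>)
  then show ?thesis by (simp add: cnj_vec_def)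
qed

lemma \<sigma>_involution: "\<sigma> (\<sigma> j) = j"
  by (rule injD[OF inj_v]) (simp add: vec_eq_iff v_\<sigma>)

lemma lam_\<sigma>: "lam (\<sigma> j) = cnj (lam j)"
proof -
  obtain a where a: "v (\<sigma> j) $ a \<noteq> 0" using v_nonzero[of "\<sigma> j"] by (auto simp: vec_eq_iff)
  have "(cmat A *v v (\<sigma> j)) $ a = cnj ((cmat A *v v j) $ a)"
    by (simp add: matrix_vector_mult_def cmat_def v_\<sigma>)
  then have "lam (\<sigma> j) * v (\<sigma> j) $ a = cnj (lam j) * v (\<sigma> j) $ a"
    unfolding eig by (simp add: v_\<sigma>)
  then show ?thesis using a by simp
qed

sublocale conj_nodes lam \<sigma>
  by unfold_locales (rule inj_lam, rule \<sigma>_involution, rule lam_\<sigma>)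

definition coord :: "real^'n \<Rightarrow> 'n \<Rightarrow> complex" where
  "coord b j = herm (cvec b) (v j)"

abbreviation weight :: "real^'n \<Rightarrow> 'n \<Rightarrow> real" where
  "weight b j \<equiv> (norm (coord b j))\<^sup>2"

lemma spectral_weights_coord: "spectral_weights v b j = weight b j"
  by (simp add: spectral_weights_def coord_def)

lemma coord_alt: "coord b j = (\<Sum>a\<in>UNIV. of_real (b $ a) * cnj (v j $ a))"
  by (simp add: coord_def herm_def cvec_def)

lemma coord_recon: "of_real (b $ a) = (\<Sum>j\<in>UNIV. coord b j * v j $ a)"
  using expansion[of "cvec b" a] by (simp add: coord_def cvec_def)

lemma coord_eqI:
  assumes "\<And>a. of_real (b $ a) = (\<Sum>l\<in>UNIV. c l * v l $ a)"
  shows "coord b j = c j"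
proof -
  have "cvec b = (\<chi> a. \<Sum>l\<in>UNIV. c l * v l $ a)" by (simp add: vec_eq_iff cvec_def assms)
  then show ?thesis by (simp only: coord_def herm_sum_v)
qed

lemma coord_\<sigma>: "coord b (\<sigma> j) = cnj (coord b j)"
  by (simp add: coord_alt v_\<sigma>)

lemma parseval: "of_real (b \<bullet> x) = (\<Sum>j\<in>UNIV. coord b j * cnj (coord x j))"
proof -
  have "of_real (b \<bullet> x) = (\<Sum>a\<in>UNIV. of_real (x $ a) * (\<Sum>j\<in>UNIV. coord b j * v j $ a))"
    unfolding coord_recon[symmetric] by (simp add: inner_vec_def mult.commute)
  also have "\<dots> = (\<Sum>j\<in>UNIV. coord b j * cnj (coord x j))"
    unfolding coord_alt[of x] cnj_sum sum_distrib_left by (subst sum.swap) (simp add: mult_ac)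
  finally show ?thesis .
qed

lemma parseval_norm: "x \<bullet> x = (\<Sum>j\<in>UNIV. weight x j)"
proof -
  have "complex_of_real (x \<bullet> x) = of_real (\<Sum>j\<in>UNIV. weight x j)"
    unfolding parseval of_real_sum complex_norm_square by (rule refl)
  then show ?thesis by (simp only: of_real_eq_iff)
qed

lemma coord_zero_imp: "(\<And>j. coord b j = 0) \<Longrightarrow> b = 0"
  using parseval_norm[of b] by simp

text \<open>Conjugation symmetry is the only constraint on the coordinates of a real vector. All
  test vectors and maximisers are produced from it.\<close>

lemma ex_coord:
  assumes "\<And>j. c (\<sigma> j) = cnj (c j)"
  shows "\<exists>b. \<forall>j. coord b j = c j"
proof -
  define b where "b = (\<chi> a. Re (\<Sum>j\<in>UNIV. c j * v j $ a))"
  have "of_real (b $ a) = (\<Sum>j\<in>UNIV. c j * v j $ a)" for a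
  proof -
    have "cnj (\<Sum>j\<in>UNIV. c j * v j $ a) = (\<Sum>j\<in>UNIV. c (\<sigma> j) * v (\<sigma> j) $ a)"
      by (simp add: assms v_\<sigma>)
    also have "\<dots> = (\<Sum>j\<in>UNIV. c j * v j $ a)" by (rule sum_\<sigma>)
    finally have "Im (\<Sum>j\<in>UNIV. c j * v j $ a) = 0" by (metis Reals_cnj_iff complex_is_Real_iff)
    then show ?thesis by (simp add: b_def complex_eq_iff)
  qed
  then show ?thesis using coord_eqI by blast
qed

section \<open>The matrix, its powers and its exponential in the eigenbasis\<close>

lemma coord_mult: "coord (A *v b) j = lam j * coord b j"
proof (rule coord_eqI)
  fix a
  have "complex_of_real ((A *v b) $ a) = (cmat A *v cvec b) $ a"
    by (simp add: matrix_vector_mult_def cmat_def cvec_def)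
  then show "of_real ((A *v b) $ a) = (\<Sum>l\<in>UNIV. lam l * coord b l * v l $ a)"
    by (simp add: cmat_mult_expansion coord_def)
qed

lemma mpow_Suc: "mpow B (Suc k) = B ** mpow B k"
  by (simp add: mpow_def)

lemma coord_krylov: "coord (krylov A b k) j = lam j ^ k * coord b j"
proof (induction k)
  case 0
  then show ?case by (simp add: krylov_def mpow_def)
next
  case (Suc k)
  have "krylov A b (Suc k) = A *v krylov A b k" by (simp add: krylov_def mpow_Suc matrix_vector_mul_assoc)
  then show ?case using Suc by (simp add: coord_mult)
qed

lemma mpow_entry: "of_real (mpow A k $ a $ b) = (\<Sum>l\<in>UNIV. lam l ^ k * (v l $ a * cnj (v l $ b)))"
proof (induction k arbitrary: a)
  case 0
  then show ?case by (simp add: mpow_def mat_def completeness)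
next
  case (Suc k)
  have "of_real (mpow A (Suc k) $ a $ b) = (\<Sum>c\<in>UNIV. cmat A $ a $ c * of_real (mpow A k $ c $ b))"
    by (simp add: mpow_Suc matrix_matrix_mult_def cmat_def)
  also have "\<dots> = (\<Sum>l\<in>UNIV. lam l ^ k * cnj (v l $ b) * (cmat A *v v l) $ a)"
    unfolding Suc matrix_vector_mult_def vec_lambda_beta sum_distrib_left by (subst sum.swap) (simp add: mult_ac)
  finally show ?case unfolding eig by (simp add: mult_ac)
qed

lemma mpow_transpose: "mpow (transpose B) k = transpose (mpow (B :: real^'n^'n) k)"
proof (induction k)
  case 0
  show ?case by (simp add: mpow_def transpose_mat)
next
  case (Suc k)
  have c: "mpow B k ** B = B ** mpow B k" for k
    by (induction k) (simp_all add: mpow_def matrix_mul_assoc[symmetric])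
  have "mpow (transpose B) (Suc k) = transpose (mpow B k ** B)"
    by (simp only: mpow_Suc Suc matrix_transpose_mul)
  then show ?case by (simp only: c mpow_Suc)
qed

lemma mpow_scaleR: "mpow (t *\<^sub>R B) k = t ^ k *\<^sub>R mpow (B :: real^'n^'n) k"
proof (induction k)
  case 0
  show ?case by (simp add: mpow_def)
next
  case (Suc k)
  show ?case unfolding mpow_Suc Suc
    by (simp add: vec_eq_iff matrix_matrix_mult_def sum_distrib_left mult_ac)
qed

lemma transpose_entry: "transpose X $ i $ j = X $ j $ i"
  by (simp add: transpose_def)

lemma mexp_series:
  "(\<lambda>k. (1 / fact k) *\<^sub>R mpow (t *\<^sub>R A) k) sums
     (\<chi> a b. Re (\<Sum>l\<in>UNIV. exp (lam l * of_real t) * (v l $ a * cnj (v l $ b))))" (is "?f sums ?E")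
  and mexp_entry_real: "Im (\<Sum>l\<in>UNIV. exp (lam l * of_real t) * (v l $ a * cnj (v l $ b))) = 0"
proof -
  have s: "(\<lambda>k. complex_of_real (?f k $ a $ b)) sums (\<Sum>l\<in>UNIV. exp (lam l * of_real t) * (v l $ a * cnj (v l $ b)))" for a b
  proof -
    have "(\<lambda>k. \<Sum>l\<in>UNIV. ((lam l * of_real t) ^ k /\<^sub>R fact k) * (v l $ a * cnj (v l $ b))) sums
       (\<Sum>l\<in>UNIV. exp (lam l * of_real t) * (v l $ a * cnj (v l $ b)))"
      by (intro sums_sum sums_mult2 exp_converges)
    moreover have "(\<Sum>l\<in>UNIV. ((lam l * of_real t) ^ k /\<^sub>R fact k) * (v l $ a * cnj (v l $ b))) = complex_of_real (?f k $ a $ b)" for k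
    proof -
      have f: "?f k $ a $ b = (t ^ k / fact k) * mpow A k $ a $ b" by (simp add: mpow_scaleR)
      show ?thesis unfolding f of_real_mult mpow_entry sum_distrib_left
        by (intro sum.cong refl) (simp add: field_simps scaleR_conv_of_real power_mult_distrib)
    qed
    ultimately show ?thesis by simp
  qed
  show "Im (\<Sum>l\<in>UNIV. exp (lam l * of_real t) * (v l $ a * cnj (v l $ b))) = 0"
    using sums_Im[OF s[of a b]] unfolding Im_complex_of_real by (rule sums_unique2[OF _ sums_zero])
  have "(\<lambda>k. ?f k $ a $ b) sums ?E $ a $ b" for a b
    using sums_Re[OF s[of a b]] unfolding Re_complex_of_real by (simp only: vec_lambda_beta)
  then show "?f sums ?E"
    unfolding sums_def by (intro vec_tendstoI) (simp add: sum_component)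
qed

lemma mexp_entry:
  "of_real (mexp (t *\<^sub>R A) $ a $ b) = (\<Sum>l\<in>UNIV. exp (lam l * of_real t) * (v l $ a * cnj (v l $ b)))"
proof -
  have "mexp (t *\<^sub>R A) = (\<chi> a b. Re (\<Sum>l\<in>UNIV. exp (lam l * of_real t) * (v l $ a * cnj (v l $ b))))"
    unfolding mexp_def by (rule sums_unique[symmetric, OF mexp_series])
  then show ?thesis using mexp_entry_real[of t a b] by (simp add: complex_eq_iff)
qed

lemma mexp_transpose: "mexp (t *\<^sub>R transpose A) = transpose (mexp (t *\<^sub>R A))"
proof -
  have e: "mexp (t *\<^sub>R A) = (\<chi> a b. Re (\<Sum>l\<in>UNIV. exp (lam l * of_real t) * (v l $ a * cnj (v l $ b))))" (is "_ = ?E")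
    unfolding mexp_def by (rule sums_unique[symmetric, OF mexp_series])
  have "(\<lambda>k. ((1 / fact k) *\<^sub>R mpow (t *\<^sub>R A) k) $ b $ a) sums ?E $ b $ a" for a b
  proof -
    have "(\<lambda>n. (\<Sum>k<n. (1 / fact k) *\<^sub>R mpow (t *\<^sub>R A) k) $ b $ a) \<longlonglongrightarrow> ?E $ b $ a"
      using mexp_series[of t] unfolding sums_def by (intro tendsto_vec_nth)
    then show ?thesis unfolding sums_def sum_component .
  qed
  then have "(\<lambda>k. (1 / fact k) *\<^sub>R mpow (t *\<^sub>R transpose A) k) sums transpose ?E"
    unfolding sums_def by (intro vec_tendstoI) (simp add: sum_component mpow_scaleR mpow_transpose transpose_entry)
  then show ?thesis unfolding mexp_def[of "t *\<^sub>R transpose A"] e by (rule sums_unique[symmetric])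
qed

text \<open>The transpose of a real matrix is its adjoint, which acts in a unitary eigenbasis by the
  conjugate eigenvalues.\<close>

lemma coord_mexp_transpose:
  "coord (transpose (mexp (t *\<^sub>R A)) *v x) j = exp (cnj (lam j) * of_real t) * coord x j"
proof (rule coord_eqI)
  fix b
  have "complex_of_real ((transpose (mexp (t *\<^sub>R A)) *v x) $ b) = cnj (\<Sum>a\<in>UNIV. of_real (mexp (t *\<^sub>R A) $ a $ b) * of_real (x $ a))"
    by (simp add: matrix_vector_mult_def transpose_def)
  also have "\<dots> = (\<Sum>l\<in>UNIV. exp (cnj (lam l) * of_real t) * (\<Sum>a\<in>UNIV. of_real (x $ a) * cnj (v l $ a)) * v l $ b)"
    unfolding mexp_entry cnj_sum sum_distrib_left sum_distrib_right by (subst sum.swap) (simp add: mult_ac exp_cnj)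
  finally show "of_real ((transpose (mexp (t *\<^sub>R A)) *v x) $ b) = (\<Sum>l\<in>UNIV. exp (cnj (lam l) * of_real t) * coord x l * v l $ b)"
    by (simp add: coord_alt)
qed

end

section \<open>Optimal spectral weights of the Gramians\<close>

text \<open>The Cauchy-Schwarz inequality with its defect written as a sum of squares; the defect
  settles the case of equality and hence the uniqueness of optimal weights.\<close>

lemma sum_square_div_eq:
  fixes y \<pi> :: "'n::finite \<Rightarrow> real"
  assumes "\<And>j. \<pi> j > 0" "(\<Sum>j\<in>UNIV. \<pi> j) = 1"
  shows "(\<Sum>j\<in>UNIV. (y j)\<^sup>2 / \<pi> j) =
    (\<Sum>j\<in>UNIV. y j)\<^sup>2 + (\<Sum>j\<in>UNIV. (y j - (\<Sum>j\<in>UNIV. y j) * \<pi> j)\<^sup>2 / \<pi> j)"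
proof -
  define Y where "Y = (\<Sum>j\<in>UNIV. y j)"
  have "(y j - Y * \<pi> j)\<^sup>2 / \<pi> j = (y j)\<^sup>2 / \<pi> j - 2 * Y * y j + Y\<^sup>2 * \<pi> j" for j
    using assms(1)[of j] by (simp add: power2_eq_square field_simps)
  then have "(\<Sum>j\<in>UNIV. (y j - Y * \<pi> j)\<^sup>2 / \<pi> j) = (\<Sum>j\<in>UNIV. (y j)\<^sup>2 / \<pi> j) - 2 * Y * Y + Y\<^sup>2"
    by (simp add: sum.distrib sum_subtractf assms(2) Y_def flip: sum_distrib_left)
  then show ?thesis unfolding Y_def[symmetric] by (simp add: power2_eq_square)
qed

lemma sum_square_div_ge:
  fixes y \<pi> :: "'n::finite \<Rightarrow> real"
  assumes "\<And>j. \<pi> j > 0" "(\<Sum>j\<in>UNIV. \<pi> j) = 1"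
  shows "(\<Sum>j\<in>UNIV. y j)\<^sup>2 \<le> (\<Sum>j\<in>UNIV. (y j)\<^sup>2 / \<pi> j)"
    and "(\<Sum>j\<in>UNIV. (y j)\<^sup>2 / \<pi> j) \<le> (\<Sum>j\<in>UNIV. y j)\<^sup>2 \<Longrightarrow> y j = (\<Sum>j\<in>UNIV. y j) * \<pi> j"
proof -
  define d where "d j = (y j - (\<Sum>j\<in>UNIV. y j) * \<pi> j)\<^sup>2 / \<pi> j" for j
  have d: "d j \<ge> 0" for j using assms(1)[of j] by (simp add: d_def)
  have e: "(\<Sum>j\<in>UNIV. (y j)\<^sup>2 / \<pi> j) = (\<Sum>j\<in>UNIV. y j)\<^sup>2 + (\<Sum>j\<in>UNIV. d j)"
    unfolding d_def by (rule sum_square_div_eq[OF assms])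
  then show "(\<Sum>j\<in>UNIV. y j)\<^sup>2 \<le> (\<Sum>j\<in>UNIV. (y j)\<^sup>2 / \<pi> j)" using d by (simp add: sum_nonneg)
  assume "(\<Sum>j\<in>UNIV. (y j)\<^sup>2 / \<pi> j) \<le> (\<Sum>j\<in>UNIV. y j)\<^sup>2"
  then have "(\<Sum>j\<in>UNIV. d j) \<le> 0" using e by simp
  then have "d j = 0" using d by (metis UNIV_I finite sum_nonneg sum_nonneg_eq_0_iff order_antisym)
  then show "y j = (\<Sum>j\<in>UNIV. y j) * \<pi> j" using assms(1)[of j] by (simp add: d_def)
qed

context unitary_spectrum
begin

abbreviation E :: "real \<Rightarrow> real^'n^'n" where
  "E t \<equiv> mexp (t *\<^sub>R A)"

lemma continuous_on_mexp_entry: "continuous_on S (\<lambda>t. E t $ a $ b)"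
proof -
  have "E t $ a $ b = Re (\<Sum>l\<in>UNIV. exp (lam l * of_real t) * (v l $ a * cnj (v l $ b)))" for t
    unfolding mexp_entry[symmetric] by simp
  then show ?thesis by (simp only:) (intro continuous_intros)
qed

lemma gram_integrand_integrable:
  "(\<lambda>t. E t ** X ** mexp (t *\<^sub>R transpose A)) integrable_on {0..T}"
proof (rule integrable_continuous_real)
  have "E t ** X ** mexp (t *\<^sub>R transpose A) = (\<chi> i j. \<Sum>c\<in>UNIV. (\<Sum>d\<in>UNIV. E t $ i $ d * X $ d $ c) * E t $ j $ c)" for t
    unfolding mexp_transpose by (simp add: matrix_matrix_mult_def transpose_entry vec_eq_iff)
  then show "continuous_on {0..T} (\<lambda>t. E t ** X ** mexp (t *\<^sub>R transpose A))"
    by (simp only:) (intro continuous_on_vec_lambda continuous_intros continuous_on_mexp_entry)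
qed

lemma gram_int_has_integral:
  "((\<lambda>t. (transpose (E t) *v x) \<bullet> (X *v (transpose (E t) *v y))) has_integral x \<bullet> (gram_int A T X *v y)) {0..T}"
proof -
  have "linear (\<lambda>M :: real^'n^'n. x \<bullet> (M *v y))"
    by (rule linearI) (simp_all add: inner_vec_def matrix_vector_mult_def sum.distrib sum_distrib_left algebra_simps)
  then have bl: "bounded_linear (\<lambda>M :: real^'n^'n. x \<bullet> (M *v y))" by (simp add: linear_conv_bounded_linear)
  have "x \<bullet> ((E t ** X ** mexp (t *\<^sub>R transpose A)) *v y) = (transpose (E t) *v x) \<bullet> (X *v (transpose (E t) *v y))" for t
    by (simp only: mexp_transpose matrix_vector_mul_assoc[symmetric] transpose_matrix_vector dot_lmul_matrix)
  then show ?thesis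
    using has_integral_linear[OF integrable_integral[OF gram_integrand_integrable[of X T]] bl]
    by (simp add: o_def gram_int_def)
qed

lemma gram_int_symmetric:
  assumes "transpose X = X"
  shows "transpose (gram_int A T X) = gram_int A T X"
proof -
  let ?G = "gram_int A T X"
  have X: "a \<bullet> (X *v b) = b \<bullet> (X *v a)" for a b
    using dot_lmul_matrix[of a X b] vector_transpose_matrix[of a X] by (simp add: assms inner_commute)
  have sw: "x \<bullet> (?G *v y) = y \<bullet> (?G *v x)" for x y
    using gram_int_has_integral[of x X y T] gram_int_has_integral[of y X x T]
    by (subst (asm) X) (rule has_integral_unique)
  have "x \<bullet> (transpose ?G *v y) = x \<bullet> (?G *v y)" for x y
    using dot_lmul_matrix[of y ?G x] sw[of y x] by (simp add: inner_commute)
  then have "transpose ?G *v y = ?G *v y" for y by (metis vector_eq_ldot)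
  then show ?thesis by (simp add: matrix_eq)
qed

lemma rank_one_mult: "((columnvector b :: real^1^'n) ** (rowvector b :: real^'n^1)) *v z = (b \<bullet> z) *\<^sub>R (b :: real^'n)"
  by (simp add: vec_eq_iff matrix_vector_mult_def matrix_matrix_mult_def columnvector_def rowvector_def inner_vec_def sum_distrib_left mult_ac)

lemma gramian_symmetric: "transpose (gramian A T b) = gramian A T b"
  unfolding gramian_def
  by (rule gram_int_symmetric) (simp add: vec_eq_iff transpose_def matrix_matrix_mult_def columnvector_def rowvector_def mult.commute)

lemma gramian_form:
  assumes "T \<ge> 0"
  shows "x \<bullet> (gramian A T b *v x) = expform T (\<lambda>j. coord b j * cnj (coord x j))"
proof -
  have "(transpose (E t) *v x) \<bullet> (((columnvector b :: real^1^'n) ** (rowvector b :: real^'n^1)) *v (transpose (E t) *v x)) =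
     (norm (\<Sum>j\<in>UNIV. coord b j * cnj (coord x j) * exp (lam j * of_real t)))\<^sup>2" for t
  proof -
    have "complex_of_real (b \<bullet> (transpose (E t) *v x)) = (\<Sum>j\<in>UNIV. coord b j * cnj (coord x j) * exp (lam j * of_real t))"
      unfolding parseval coord_mexp_transpose by (simp add: exp_cnj mult_ac)
    then have "norm (\<Sum>j\<in>UNIV. coord b j * cnj (coord x j) * exp (lam j * of_real t)) = \<bar>b \<bullet> (transpose (E t) *v x)\<bar>"
      by (metis norm_of_real)
    then show ?thesis by (simp add: rank_one_mult inner_commute power2_eq_square)
  qed
  then have "((\<lambda>t. (norm (\<Sum>j\<in>UNIV. coord b j * cnj (coord x j) * exp (lam j * of_real t)))\<^sup>2) has_integral
      x \<bullet> (gramian A T b *v x)) {0..T}"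
    using gram_int_has_integral[of x "(columnvector b :: real^1^'n) ** (rowvector b :: real^'n^1)" x T]
    by (simp add: gramian_def)
  then show ?thesis by (rule has_integral_unique) (rule has_integral_norm_exp_sum[OF assms])
qed

lemma coord_norm_sum:
  assumes "norm b = 1"
  shows "(\<Sum>j\<in>UNIV. weight b j) = 1"
  using parseval_norm[of b] assms by (simp add: dot_square_norm)

lemma ex_unit_weights:
  assumes "\<And>j. p j \<ge> 0" "\<And>j. p (\<sigma> j) = p j" "(\<Sum>j\<in>UNIV. p j) = 1"
  obtains b where "norm b = 1" "\<And>j. weight b j = p j"
proof -
  obtain b where b: "\<And>j. coord b j = of_real (sqrt (p j))"
    using ex_coord[of "\<lambda>j. of_real (sqrt (p j))"] assms(2) by auto
  have n: "weight b j = p j" for j using assms(1)[of j] by (simp add: b)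
  have "b \<bullet> b = 1" using parseval_norm[of b] assms(3) by (simp add: n)
  then have "norm b = 1" by (simp add: norm_eq_1)
  then show thesis using n by (rule that)
qed

text \<open>A real test vector supported on one conjugate pair. It detects a vanishing coordinate of
  \<open>b\<close>: such a \<open>b\<close> is not cyclic, and its Gramian has no positive smallest
  eigenvalue.\<close>

lemma ex_pair_vector: "\<exists>x. \<forall>j. coord x j = (if j = j0 \<or> j = \<sigma> j0 then 1 else 0)"
proof -
  have "\<sigma> j = j0 \<longleftrightarrow> j = \<sigma> j0" "\<sigma> j = \<sigma> j0 \<longleftrightarrow> j = j0" for j by (metis \<sigma>_\<sigma>)+
  then show ?thesis by (intro ex_coord) auto
qed

text \<open>The equality vector of the certificate bounds \<open>l b\<close> from above for every
  \<open>b\<close>, and the defect in the Cauchy-Schwarz inequality decides which weights reach the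
  bound. The diagonal lower bound shows that it is attained.\<close>

lemma gamma_1_from_certificate:
  assumes T: "T > 0" and cert: "certifies T y"
  shows "gamma_1 A T = T ^ (2 * CARD('n) - 1) / (\<Sum>j\<in>UNIV. y j)" and "gamma_1_maximizers A T \<noteq> {}"
    and "b \<in> gamma_1_maximizers A T \<Longrightarrow> spectral_weights v b j = y j / (\<Sum>j\<in>UNIV. y j)"
proof -
  define s where "s = T ^ (2 * CARD('n) - 1)"
  have s: "s > 0" using T by (simp add: s_def)
  obtain c where y: "\<And>j. y j > 0" and y\<sigma>: "\<And>j. y (\<sigma> j) = y j"
    and c\<sigma>: "\<And>j. c (\<sigma> j) = cnj (c j)" and c: "\<And>j. norm (c j) = y j"
    and lower: "\<And>f. s * (\<Sum>j\<in>UNIV. (norm (f j))\<^sup>2 / y j) \<le> expform T f"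
    and val: "expform T c = s * (\<Sum>j\<in>UNIV. y j)"
    using cert unfolding certifies_def s_def by auto
  define Y where "Y = (\<Sum>j\<in>UNIV. y j)"
  have Y: "Y > 0" unfolding Y_def using y by (intro sum_pos) auto
  define l where "l b = lambda_min (gramian A T b)" for b
  have form: "l b * (\<Sum>j\<in>UNIV. weight x j) \<le> expform T (\<lambda>j. coord b j * cnj (coord x j))" for b x
    using lambda_min_le[OF gramian_symmetric, of T b x] unfolding parseval_norm gramian_form[OF less_imp_le[OF T]] l_def .
  have ub: "l b \<le> s / Y \<and> (s / Y \<le> l b \<longrightarrow> (\<forall>j. weight b j = y j / Y))" if b: "norm b = 1" for b
  proof (cases "\<forall>j. coord b j \<noteq> 0")
    case True
    define p where "p j = weight b j" for j
    have p: "p j > 0" for j using True by (simp add: p_def)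
    have p1: "(\<Sum>j\<in>UNIV. p j) = 1" unfolding p_def by (rule coord_norm_sum[OF b])
    \<comment> \<open>The test vector whose products with \<open>b\<close> in the eigenbasis are the equality vector \<open>c\<close>.\<close>
    obtain x where x: "\<And>j. coord x j = cnj (c j / coord b j)"
      using ex_coord[of "\<lambda>j. cnj (c j / coord b j)"] by (auto simp: c\<sigma> coord_\<sigma>)
    have bx: "coord b j * cnj (coord x j) = c j" for j using True by (simp add: x)
    have nx: "weight x j = (y j)\<^sup>2 / p j" for j by (simp add: x norm_divide power_divide c p_def)
    have le: "l b * (\<Sum>j\<in>UNIV. (y j)\<^sup>2 / p j) \<le> s * Y"
      using form[of b x] unfolding bx nx val Y_def .
    have cs: "Y\<^sup>2 \<le> (\<Sum>j\<in>UNIV. (y j)\<^sup>2 / p j)" unfolding Y_def by (rule sum_square_div_ge(1)[OF p p1])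
    have "l b \<le> s / Y"
    proof (rule ccontr)
      assume "\<not> l b \<le> s / Y"
      then have a: "s / Y < l b" by simp
      have "s * Y = s / Y * Y\<^sup>2" using Y by (simp add: power2_eq_square)
      also have "\<dots> < l b * Y\<^sup>2" using a Y by (intro mult_strict_right_mono) auto
      also have "\<dots> \<le> l b * (\<Sum>j\<in>UNIV. (y j)\<^sup>2 / p j)"
        using cs a s Y by (intro mult_left_mono) (auto intro: less_imp_le[OF less_trans[of 0 "s / Y"]])
      finally show False using le by simp
    qed
    moreover have "weight b j = y j / Y" if ge: "s / Y \<le> l b" for j
    proof -
      have "s / Y * (\<Sum>j\<in>UNIV. (y j)\<^sup>2 / p j) \<le> l b * (\<Sum>j\<in>UNIV. (y j)\<^sup>2 / p j)"
        using ge p by (intro mult_right_mono sum_nonneg) (auto simp: less_imp_le)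
      then have "s / Y * (\<Sum>j\<in>UNIV. (y j)\<^sup>2 / p j) \<le> s * Y" using le by simp
      then have "(\<Sum>j\<in>UNIV. (y j)\<^sup>2 / p j) \<le> Y\<^sup>2" using s Y by (simp add: field_simps power2_eq_square)
      then have "y j = Y * p j" unfolding Y_def by (rule sum_square_div_ge(2)[OF p p1])
      then show ?thesis using Y by (simp add: p_def)
    qed
    ultimately show ?thesis by blast
  next
    case False
    then obtain j0 where j0: "coord b j0 = 0" by auto
    obtain x where x: "\<And>j. coord x j = (if j = j0 \<or> j = \<sigma> j0 then 1 else 0)" using ex_pair_vector by blast
    have z: "coord b j * cnj (coord x j) = 0" for j using j0 coord_\<sigma>[of b j0] by (auto simp: x)
    have "0 < weight x j0" by (simp add: x)
    also have "\<dots> \<le> (\<Sum>j\<in>UNIV. weight x j)" by (rule member_le_sum) auto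
    finally have "l b \<le> 0" using form[of b x] unfolding z by (simp add: expform_def mult_le_0_iff)
    then show ?thesis using s Y by (smt (verit) divide_pos_pos)
  qed
  \<comment> \<open>With these weights the diagonal lower bound becomes a multiple of the
    identity.\<close>
  obtain b0 where b0: "norm b0 = 1" "\<And>j. weight b0 j = y j / Y"
    by (rule ex_unit_weights[of "\<lambda>j. y j / Y"]) (use y y\<sigma> Y in \<open>auto simp: less_imp_le Y_def simp flip: sum_divide_distrib\<close>)
  have "s / Y \<le> l b0" unfolding l_def
  proof (rule lambda_min_greatest[OF gramian_symmetric])
    fix x
    have "(norm (coord b0 j * cnj (coord x j)))\<^sup>2 / y j = weight x j / Y" for j
      using y[of j] by (simp add: norm_mult power_mult_distrib b0)
    then have "s * (\<Sum>j\<in>UNIV. weight x j / Y) \<le> x \<bullet> (gramian A T b0 *v x)"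
      unfolding gramian_form[OF less_imp_le[OF T]] using lower[of "\<lambda>j. coord b0 j * cnj (coord x j)"] by simp
    then show "s / Y * (x \<bullet> x) \<le> x \<bullet> (gramian A T b0 *v x)"
      by (simp add: parseval_norm flip: sum_divide_distrib)
  qed
  then have lb0: "l b0 = s / Y" using ub[OF b0(1)] by simp
  show g: "gamma_1 A T = T ^ (2 * CARD('n) - 1) / (\<Sum>j\<in>UNIV. y j)"
    unfolding gamma_1_def l_def[symmetric] Y_def[symmetric] s_def[symmetric]
    by (rule cSup_eq_maximum) (use lb0 b0 ub in \<open>force+\<close>)
  show "gamma_1_maximizers A T \<noteq> {}"
    unfolding gamma_1_maximizers_def using b0(1) lb0 g by (auto simp: l_def Y_def s_def)
  show "spectral_weights v b j = y j / (\<Sum>j\<in>UNIV. y j)" if "b \<in> gamma_1_maximizers A T"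
    using that ub[of b] g by (auto simp: gamma_1_maximizers_def spectral_weights_coord l_def Y_def s_def)
qed

section \<open>The relaxed problem and the energies of single exponentials\<close>

definition rho :: "real \<Rightarrow> 'n \<Rightarrow> real" where
  "rho T j = Re (expint T j j)"

lemma rho_has_integral:
  assumes "T \<ge> 0"
  shows "((\<lambda>t. (norm (exp (lam j * of_real t)))\<^sup>2) has_integral rho T j) {0..T}"
proof -
  have 1: "(\<Sum>i\<in>UNIV. (if i = j then 1 else 0) * exp (lam i * of_real t)) = exp (lam j * of_real t)" for t
  proof -
    have "(\<Sum>i\<in>UNIV. (if i = j then 1 else 0) * exp (lam i * of_real t)) = (\<Sum>i\<in>UNIV. if i = j then exp (lam i * of_real t) else 0)"
      by (intro sum.cong refl) auto
    then show ?thesis by simp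
  qed
  have 2: "expform T (\<lambda>i. if i = j then 1 else 0) = rho T j"
  proof -
    have "(\<Sum>i\<in>UNIV. \<Sum>k\<in>UNIV. (if i = j then 1 else 0) * cnj (if k = j then 1 else 0) * expint T i k) =
        (\<Sum>i\<in>UNIV. \<Sum>k\<in>UNIV. if k = j then (if i = j then expint T i k else 0) else 0)"
      by (intro sum.cong refl) auto
    then show ?thesis by (simp add: expform_def rho_def)
  qed
  show ?thesis using has_integral_norm_exp_sum[OF assms, of "\<lambda>i. if i = j then 1 else 0"]
    unfolding 1 2 .
qed

lemma rho_pos:
  assumes "T > 0"
  shows "rho T j > 0"
proof -
  define m where "m = exp (- (2 * \<bar>Re (lam j)\<bar> * T))"
  have "((\<lambda>t. m) has_integral m * T) {0..T}"
    using has_integral_const_real[of m 0 T] assms by (simp add: mult.commute)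
  moreover have "m \<le> (norm (exp (lam j * of_real t)))\<^sup>2" if "t \<in> {0..T}" for t
  proof -
    have "\<bar>Re (lam j) * t\<bar> \<le> \<bar>Re (lam j)\<bar> * T" unfolding abs_mult using that by (intro mult_left_mono) auto
    then have "- (2 * \<bar>Re (lam j)\<bar> * T) \<le> 2 * (Re (lam j) * t)" by linarith
    then show ?thesis by (simp add: m_def norm_exp_eq_Re flip: exp_double)
  qed
  ultimately have "m * T \<le> rho T j"
    using assms by (intro has_integral_le[OF _ rho_has_integral]) auto
  moreover have "m * T > 0" using assms by (simp add: m_def)
  ultimately show ?thesis by linarith
qed

lemma sum_mexp_v: "(\<Sum>a\<in>UNIV. of_real (E t $ a $ b) * v j $ a) = exp (cnj (lam j) * of_real t) * v j $ b"
proof -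
  have "complex_of_real (E t $ a $ b) = (\<Sum>l\<in>UNIV. exp (cnj (lam l) * of_real t) * (cnj (v l $ a) * v l $ b))" for a
  proof -
    have "complex_of_real (E t $ a $ b) = cnj (complex_of_real (E t $ a $ b))" by simp
    then show ?thesis unfolding mexp_entry cnj_sum by (simp add: exp_cnj)
  qed
  then have "(\<Sum>a\<in>UNIV. of_real (E t $ a $ b) * v j $ a) =
      (\<Sum>l\<in>UNIV. exp (cnj (lam l) * of_real t) * v l $ b * herm (v j) (v l))"
    unfolding herm_def sum_distrib_left sum_distrib_right by (simp only:) (subst sum.swap, simp add: sum_distrib_left sum_distrib_right mult_ac)
  also have "\<dots> = (\<Sum>l\<in>UNIV. if l = j then exp (cnj (lam l) * of_real t) * v l $ b else 0)"
    unfolding herm_v by (intro sum.cong refl) auto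
  finally show ?thesis by simp
qed

text \<open>In the eigenbasis the diagonal entries of \<open>gram_int A T X\<close> are
  \<open>rho T j * x j\<close>, where the \<open>x j\<close> sum to the trace of \<open>X\<close>.
  The smallest eigenvalue lies below each of them, and the best choice makes them all equal.\<close>

lemma gamma_rel_eq:
  assumes T: "T > 0"
  shows "gamma_rel A T = 1 / (\<Sum>j\<in>UNIV. 1 / rho T j)"
proof -
  define R where "R = (\<Sum>j\<in>UNIV. 1 / rho T j)"
  have R: "R > 0" unfolding R_def using rho_pos[OF T] by (intro sum_pos) auto
  define p q where "p j = (\<chi> a. Re (v j $ a))" and "q j = (\<chi> a. Im (v j $ a))" for j
  have pq1: "p j \<bullet> p j + q j \<bullet> q j = 1" for j
  proof -
    have "Re (herm (v j) (v j)) = p j \<bullet> p j + q j \<bullet> q j"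
      by (simp add: herm_def p_def q_def inner_vec_def sum.distrib)
    then show ?thesis by (simp add: herm_v)
  qed
  have tr: "(\<Sum>j\<in>UNIV. p j \<bullet> (X *v p j) + q j \<bullet> (X *v q j)) = trace X" for X :: "real^'n^'n"
  proof -
    have "(\<Sum>j\<in>UNIV. p j \<bullet> (X *v p j) + q j \<bullet> (X *v q j)) =
      (\<Sum>j\<in>UNIV. \<Sum>a\<in>UNIV. \<Sum>b\<in>UNIV. X $ a $ b * Re (v j $ a * cnj (v j $ b)))"
      unfolding inner_vec_def matrix_vector_mult_def sum.distrib[symmetric]
      by (intro sum.cong refl) (simp add: p_def q_def sum_distrib_left algebra_simps flip: sum.distrib)
    also have "\<dots> = (\<Sum>a\<in>UNIV. \<Sum>b\<in>UNIV. \<Sum>j\<in>UNIV. X $ a $ b * Re (v j $ a * cnj (v j $ b)))"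
      by (subst sum.swap, rule sum.cong[OF refl], rule sum.swap)
    also have "\<dots> = (\<Sum>a\<in>UNIV. \<Sum>b\<in>UNIV. X $ a $ b * Re (\<Sum>j\<in>UNIV. v j $ a * cnj (v j $ b)))"
      unfolding Re_sum sum_distrib_left by (rule refl)
    also have "\<dots> = (\<Sum>a\<in>UNIV. \<Sum>b\<in>UNIV. if b = a then X $ a $ b else 0)"
      unfolding completeness by (intro sum.cong refl) auto
    finally show ?thesis by (simp add: trace_def)
  qed
  \<comment> \<open>Test against the real and imaginary parts \<open>p j\<close>, \<open>q j\<close> of the eigenvectors.\<close>
  have ub: "lambda_min (gram_int A T X) \<le> 1 / R" if X: "psd X" "trace X = 1" for X
  proof -
    let ?G = "gram_int A T X" and ?l = "lambda_min (gram_int A T X)"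
    have sym: "transpose ?G = ?G" using X(1) by (intro gram_int_symmetric) (simp add: psd_def)
    define x where "x j = p j \<bullet> (X *v p j) + q j \<bullet> (X *v q j)" for j
    have "?l \<le> rho T j * x j" for j
    proof -
      \<comment> \<open>The transposed exponential acts on the pair \<open>p j\<close>,
        \<open>q j\<close> as a scaled rotation, so the cross terms cancel in the sum of the two
        forms.\<close>
      have "(transpose (E t) *v p j) \<bullet> (X *v (transpose (E t) *v p j)) + (transpose (E t) *v q j) \<bullet> (X *v (transpose (E t) *v q j)) =
        (norm (exp (lam j * of_real t)))\<^sup>2 * x j" for t
      proof -
        define e where "e = exp (cnj (lam j) * of_real t)"
        have "(transpose (E t) *v p j) $ b = Re (\<Sum>a\<in>UNIV. of_real (E t $ a $ b) * v j $ a)" for b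
          by (simp add: matrix_vector_mult_def transpose_entry p_def)
        then have 1: "transpose (E t) *v p j = Re e *\<^sub>R p j - Im e *\<^sub>R q j"
          unfolding sum_mexp_v by (simp add: vec_eq_iff e_def p_def q_def)
        have "(transpose (E t) *v q j) $ b = Im (\<Sum>a\<in>UNIV. of_real (E t $ a $ b) * v j $ a)" for b
          by (simp add: matrix_vector_mult_def transpose_entry q_def)
        then have 2: "transpose (E t) *v q j = Re e *\<^sub>R q j + Im e *\<^sub>R p j"
          unfolding sum_mexp_v by (simp add: vec_eq_iff e_def p_def q_def)
        have ne: "norm (exp (lam j * of_real t)) = norm e" by (simp add: e_def norm_exp_eq_Re)
        have 3: "(norm (exp (lam j * of_real t)))\<^sup>2 = Re e * Re e + Im e * Im e"
          unfolding ne cmod_power2 by (simp add: power2_eq_square)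
        show ?thesis unfolding 1 2 3 x_def
          by (simp add: matrix_vector_mult_diff_distrib matrix_vector_right_distrib matrix_vector_mult_scaleR
              inner_add_left inner_add_right inner_diff_left inner_diff_right algebra_simps)
      qed
      then have "((\<lambda>t. (norm (exp (lam j * of_real t)))\<^sup>2 * x j) has_integral p j \<bullet> (?G *v p j) + q j \<bullet> (?G *v q j)) {0..T}"
        using has_integral_add[OF gram_int_has_integral[of "p j" X "p j" T] gram_int_has_integral[of "q j" X "q j" T]] by simp
      moreover have "((\<lambda>t. (norm (exp (lam j * of_real t)))\<^sup>2 * x j) has_integral rho T j * x j) {0..T}"
        using T by (intro has_integral_mult_left rho_has_integral) simp
      ultimately have "p j \<bullet> (?G *v p j) + q j \<bullet> (?G *v q j) = rho T j * x j" by (rule has_integral_unique)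
      moreover have "?l * (p j \<bullet> p j) + ?l * (q j \<bullet> q j) \<le> p j \<bullet> (?G *v p j) + q j \<bullet> (?G *v q j)"
        by (intro add_mono lambda_min_le[OF sym])
      moreover have "?l * (p j \<bullet> p j) + ?l * (q j \<bullet> q j) = ?l" unfolding distrib_left[symmetric] pq1 by simp
      ultimately show ?thesis by simp
    qed
    then have "?l * (1 / rho T j) \<le> x j" for j using rho_pos[OF T, of j] by (simp add: divide_le_eq mult.commute)
    then have "(\<Sum>j\<in>UNIV. ?l * (1 / rho T j)) \<le> (\<Sum>j\<in>UNIV. x j)" by (intro sum_mono)
    then have "?l * R \<le> 1" unfolding x_def tr X(2) R_def sum_distrib_left .
    then show ?thesis using R by (simp add: pos_le_divide_eq)
  qed
  \<comment> \<open>Eigenvalues inversely proportional to \<open>rho T j\<close> equalise the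
    diagonal entries; dividing by \<open>R\<close> gives trace one.\<close>
  define \<tau> where "\<tau> j = 1 / (R * rho T j)" for j
  define X where "X = (\<chi> a b. Re (\<Sum>j\<in>UNIV. of_real (\<tau> j) * (v j $ a * cnj (v j $ b))))"
  have Xform: "x \<bullet> (X *v x) = (\<Sum>j\<in>UNIV. \<tau> j * weight x j)" for x
  proof -
    have "x \<bullet> (X *v x) = Re (\<Sum>a\<in>UNIV. \<Sum>b\<in>UNIV. \<Sum>j\<in>UNIV. of_real (\<tau> j) * (of_real (x $ b) * cnj (v j $ b) * (of_real (x $ a) * v j $ a)))"
      unfolding inner_vec_def matrix_vector_mult_def X_def vec_lambda_beta Re_sum
      by (simp add: sum_distrib_left sum_distrib_right algebra_simps)
    also have "(\<Sum>a\<in>UNIV. \<Sum>b\<in>UNIV. \<Sum>j\<in>UNIV. of_real (\<tau> j) * (of_real (x $ b) * cnj (v j $ b) * (of_real (x $ a) * v j $ a))) =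
       (\<Sum>j\<in>UNIV. \<Sum>b\<in>UNIV. \<Sum>a\<in>UNIV. of_real (\<tau> j) * (of_real (x $ b) * cnj (v j $ b) * (of_real (x $ a) * v j $ a)))"
      by (subst sum.swap, subst (2) sum.swap, subst sum.swap, rule refl)
    also have "\<dots> = (\<Sum>j\<in>UNIV. of_real (\<tau> j) * (coord x j * cnj (coord x j)))"
      unfolding coord_alt cnj_sum sum_product unfolding sum_distrib_left by simp
    also have "\<dots> = of_real (\<Sum>j\<in>UNIV. \<tau> j * weight x j)"
      by (simp only: complex_norm_square[symmetric] of_real_sum of_real_mult)
    finally show ?thesis by (simp only: Re_complex_of_real)
  qed
  have \<tau>: "\<tau> j \<ge> 0" for j using R rho_pos[OF T, of j] by (simp add: \<tau>_def less_imp_le)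
  have psdX: "psd X"
    unfolding psd_def Xform
  proof (intro conjI allI sum_nonneg mult_nonneg_nonneg \<tau>)
    show "transpose X = X" by (simp add: X_def vec_eq_iff transpose_def mult.commute)
  qed auto
  have trX: "trace X = 1"
  proof -
    have "trace X = Re (\<Sum>j\<in>UNIV. of_real (\<tau> j) * herm (v j) (v j))"
      unfolding trace_def X_def vec_lambda_beta herm_def Re_sum[symmetric] sum_distrib_left by (subst sum.swap) (rule refl)
    also have "\<dots> = (\<Sum>j\<in>UNIV. \<tau> j)" by (simp add: herm_v)
    also have "\<dots> = (1 / R) * R" unfolding R_def[symmetric] \<tau>_def by (subst (3) R_def) (simp add: sum_distrib_left)
    finally show ?thesis using R by simp
  qed
  have "1 / R \<le> lambda_min (gram_int A T X)"
  proof (rule lambda_min_greatest)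
    show "transpose (gram_int A T X) = gram_int A T X" using psdX by (intro gram_int_symmetric) (simp add: psd_def)
    fix x
    have "(transpose (E t) *v x) \<bullet> (X *v (transpose (E t) *v x)) =
        (\<Sum>j\<in>UNIV. (norm (exp (lam j * of_real t)))\<^sup>2 * (\<tau> j * weight x j))" for t
      unfolding Xform coord_mexp_transpose
      by (intro sum.cong refl) (simp add: norm_mult power_mult_distrib norm_exp_eq_Re)
    then have "((\<lambda>t. \<Sum>j\<in>UNIV. (norm (exp (lam j * of_real t)))\<^sup>2 * (\<tau> j * weight x j)) has_integral x \<bullet> (gram_int A T X *v x)) {0..T}"
      using gram_int_has_integral[of x X x T] by simp
    moreover have "((\<lambda>t. \<Sum>j\<in>UNIV. (norm (exp (lam j * of_real t)))\<^sup>2 * (\<tau> j * weight x j)) has_integral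
        (\<Sum>j\<in>UNIV. rho T j * (\<tau> j * weight x j))) {0..T}"
      using T by (intro has_integral_sum finite has_integral_mult_left rho_has_integral) simp
    ultimately have "x \<bullet> (gram_int A T X *v x) = (\<Sum>j\<in>UNIV. rho T j * (\<tau> j * weight x j))"
      by (rule has_integral_unique)
    also have "\<dots> = (\<Sum>j\<in>UNIV. 1 / R * weight x j)"
    proof (intro sum.cong refl)
      fix j show "rho T j * (\<tau> j * weight x j) = 1 / R * weight x j"
        using rho_pos[OF T, of j] by (simp add: \<tau>_def)
    qed
    finally show "1 / R * (x \<bullet> x) \<le> x \<bullet> (gram_int A T X *v x)" unfolding parseval_norm sum_distrib_left by simp
  qed
  then have eq: "lambda_min (gram_int A T X) = 1 / R" using ub[OF psdX trX] by simp
  show ?thesis unfolding gamma_rel_def R_def[symmetric]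
    by (rule cSup_eq_maximum) (use eq psdX trX ub in \<open>force+\<close>)
qed

end

section \<open>The distance functional\<close>

text \<open>The last conjunct is the induction invariant: the projection of the next vector stays in
  the span of the earlier ones, so the residual \<open>u\<close> is nonzero.\<close>

lemma gram_schmidt:
  fixes a :: "nat \<Rightarrow> 'a::real_inner"
  assumes "\<And>k. k < N \<Longrightarrow> a k \<notin> span (a ` {..<k})"
  shows "\<exists>q r. (\<forall>i<N. \<forall>j<N. q i \<bullet> q j = (if i = j then 1 else 0)) \<and>
     (\<forall>j<N. a j = (\<Sum>i<N. r i j *\<^sub>R q i)) \<and> (\<forall>i<N. \<forall>j<i. r i j = 0) \<and> (\<forall>i<N. 0 < r i i) \<and>
     (\<forall>i<N. q i \<in> span (a ` {..<N}))"
  using assms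
proof (induction N)
  case 0
  then show ?case by simp
next
  case (Suc N)
  have "\<exists>q r. (\<forall>i<N. \<forall>j<N. q i \<bullet> q j = (if i = j then 1 else 0)) \<and>
     (\<forall>j<N. a j = (\<Sum>i<N. r i j *\<^sub>R q i)) \<and> (\<forall>i<N. \<forall>j<i. r i j = 0) \<and> (\<forall>i<N. 0 < r i i) \<and>
     (\<forall>i<N. q i \<in> span (a ` {..<N}))"
    by (rule Suc.IH) (rule Suc.prems, simp)
  then obtain q :: "nat \<Rightarrow> 'a" and r :: "nat \<Rightarrow> nat \<Rightarrow> real" where
    Q: "(\<forall>i<N. \<forall>j<N. q i \<bullet> q j = (if i = j then 1 else 0)) \<and>
     (\<forall>j<N. a j = (\<Sum>i<N. r i j *\<^sub>R q i)) \<and> (\<forall>i<N. \<forall>j<i. r i j = 0) \<and> (\<forall>i<N. 0 < r i i) \<and>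
     (\<forall>i<N. q i \<in> span (a ` {..<N}))"
    by (elim exE) (rule that)
  have qq: "\<And>i j. i < N \<Longrightarrow> j < N \<Longrightarrow> q i \<bullet> q j = (if i = j then 1 else 0)"
    and a: "\<And>j. j < N \<Longrightarrow> a j = (\<Sum>i<N. r i j *\<^sub>R q i)"
    and r0: "\<And>i j. i < N \<Longrightarrow> j < i \<Longrightarrow> r i j = 0" and rp: "\<And>i. i < N \<Longrightarrow> 0 < r i i"
    and qs: "\<And>i. i < N \<Longrightarrow> q i \<in> span (a ` {..<N})"
    using Q by blast+
  define u where "u = a N - (\<Sum>i<N. (a N \<bullet> q i) *\<^sub>R q i)"
  have "(\<Sum>i<N. (a N \<bullet> q i) *\<^sub>R q i) \<in> span (a ` {..<N})"
    by (intro span_sum span_scale qs) auto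
  moreover have "a N = u + (\<Sum>i<N. (a N \<bullet> q i) *\<^sub>R q i)" by (simp add: u_def)
  ultimately have "u \<noteq> 0" using Suc.prems[of N] by auto
  have uq: "u \<bullet> q j = 0" if "j < N" for j
  proof -
    have "(\<Sum>i<N. (a N \<bullet> q i) * (q i \<bullet> q j)) = (\<Sum>i<N. if i = j then a N \<bullet> q i else 0)"
      by (intro sum.cong refl) (use qq that in auto)
    then show ?thesis using that by (simp add: u_def inner_diff_left inner_sum_left)
  qed
  have qu: "q j \<bullet> u = 0" if "j < N" for j using uq[OF that] by (simp add: inner_commute)
  define q' where "q' = q(N := u /\<^sub>R norm u)"
  define r' where "r' i j = (if j = N then (if i < N then a N \<bullet> q i else if i = N then norm u else 0)
     else if i = N then 0 else r i j)" for i j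
  have sub: "span (a ` {..<N}) \<subseteq> span (a ` {..<Suc N})" by (intro span_mono) auto
  have "(u /\<^sub>R norm u) \<bullet> (u /\<^sub>R norm u) = 1"
    unfolding norm_eq_1[symmetric] using \<open>u \<noteq> 0\<close> by simp
  then have "\<forall>i<Suc N. \<forall>j<Suc N. q' i \<bullet> q' j = (if i = j then 1 else 0)"
    using qq uq qu by (auto simp: q'_def less_Suc_eq simp del: inner_scaleR_left inner_scaleR_right)
      (simp_all only: inner_scaleR_left inner_scaleR_right qu uq mult_zero_right)
  moreover have "\<forall>j<Suc N. a j = (\<Sum>i<Suc N. r' i j *\<^sub>R q' i)"
  proof (intro allI impI)
    fix j assume "j < Suc N"
    show "a j = (\<Sum>i<Suc N. r' i j *\<^sub>R q' i)"
    proof (cases "j = N")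
      case True
      have "(\<Sum>i<N. r' i N *\<^sub>R q' i) = (\<Sum>i<N. (a N \<bullet> q i) *\<^sub>R q i)"
        by (intro sum.cong) (auto simp: r'_def q'_def)
      then show ?thesis using True \<open>u \<noteq> 0\<close> by (simp add: r'_def q'_def u_def)
    next
      case False
      then have "j < N" using \<open>j < Suc N\<close> by simp
      have "(\<Sum>i<N. r' i j *\<^sub>R q' i) = (\<Sum>i<N. r i j *\<^sub>R q i)"
        using False by (intro sum.cong) (auto simp: r'_def q'_def)
      then show ?thesis using False a[OF \<open>j < N\<close>] by (simp add: r'_def)
    qed
  qed
  moreover have "\<forall>i<Suc N. \<forall>j<i. r' i j = 0" using r0 by (auto simp: r'_def less_Suc_eq)
  moreover have "\<forall>i<Suc N. 0 < r' i i" using rp \<open>u \<noteq> 0\<close> by (auto simp: r'_def less_Suc_eq)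
  moreover have "\<forall>i<Suc N. q' i \<in> span (a ` {..<Suc N})"
  proof (intro allI impI)
    fix i assume "i < Suc N"
    have "a N \<in> span (a ` {..<Suc N})" by (intro span_base) auto
    then have "u \<in> span (a ` {..<Suc N})" unfolding u_def using qs sub
      by (intro span_diff span_sum span_scale) auto
    then show "q' i \<in> span (a ` {..<Suc N})"
      using \<open>i < Suc N\<close> qs sub by (auto simp: q'_def less_Suc_eq intro!: span_scale)
  qed
  ultimately show ?case by blast
qed

context unitary_spectrum
begin

lemma inner_krylov: "of_real (krylov A b k \<bullet> x) = (\<Sum>j\<in>UNIV. lam j ^ k * (coord b j * cnj (coord x j)))"
  by (simp add: parseval coord_krylov mult.assoc)

text \<open>The inner products are Vandermonde sums of \<open>coord b j * cnj (coord x j)\<close>,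
  so all these products vanish.\<close>

lemma orthogonal_krylov_imp_zero:
  assumes "\<And>j. coord b j \<noteq> 0" "\<And>k. k < CARD('n) \<Longrightarrow> krylov A b k \<bullet> x = 0"
  shows "x = 0"
proof (rule coord_zero_imp)
  fix j
  have "coord b j * cnj (coord x j) = 0"
    by (rule vandermonde_injective) (simp add: assms(2) flip: inner_krylov)
  then show "coord x j = 0" using assms(1) by simp
qed

lemma cyclic_vector_iff: "cyclic_vector A b \<longleftrightarrow> (\<forall>j. coord b j \<noteq> 0)"
proof
  assume cyc: "cyclic_vector A b"
  show "\<forall>j. coord b j \<noteq> 0"
  proof (intro allI notI)
    fix j0 assume j0: "coord b j0 = 0"
    obtain x where x: "\<And>j. coord x j = (if j = j0 \<or> j = \<sigma> j0 then 1 else 0)" using ex_pair_vector by blast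
    have z: "coord b j * cnj (coord x j) = 0" for j using j0 coord_\<sigma>[of b j0] by (auto simp: x)
    have "krylov A b k \<bullet> x = 0" for k using inner_krylov[of b k x] unfolding z by simp
    then have "orthogonal x y" if "y \<in> krylov A b ` {..<CARD('n)}" for y
      using that by (auto simp: orthogonal_def inner_commute)
    then have "orthogonal x x"
      using orthogonal_to_span[of x "krylov A b ` {..<CARD('n)}" x] cyc by (auto simp: cyclic_vector_def)
    then have "x = 0" by (simp add: orthogonal_self)
    then have "coord x j0 = 0" by (simp add: coord_alt)
    then show False by (simp add: x)
  qed
next
  assume nz: "\<forall>j. coord b j \<noteq> 0"
  show "cyclic_vector A b" unfolding cyclic_vector_def
  proof (rule ccontr)
    assume "span (krylov A b ` {..<CARD('n)}) \<noteq> UNIV"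
    then obtain x where x: "x \<noteq> 0" "\<forall>y\<in>span (krylov A b ` {..<CARD('n)}). x \<bullet> y = 0"
      using span_not_UNIV_orthogonal by blast
    have "krylov A b k \<bullet> x = 0" if "k < CARD('n)" for k
      using x(2) span_base[of "krylov A b k" "krylov A b ` {..<CARD('n)}"] that by (auto simp: inner_commute)
    then show False using orthogonal_krylov_imp_zero[of b x] nz x(1) by blast
  qed
qed

text \<open>This \<open>q\<close> is normal to the hyperplane defining \<open>d_n A b\<close>; hence \<open>d_n A b = 1 / norm q\<close> and
  \<open>q_n A b = q / norm q\<close>.\<close>

lemma ex_krylov_dual:
  assumes "\<And>j. coord b j \<noteq> 0"
  obtains q where "\<And>j. coord q j = cnj (wt j / coord b j)"
    "\<And>k. k < CARD('n) \<Longrightarrow> krylov A b k \<bullet> q = (if k = CARD('n) - 1 then 1 else 0)"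
proof -
  obtain q where q: "\<And>j. coord q j = cnj (wt j / coord b j)"
    using ex_coord[of "\<lambda>j. cnj (wt j / coord b j)"] by (auto simp: wt_\<sigma> coord_\<sigma>)
  have "krylov A b k \<bullet> q = (if k = CARD('n) - 1 then 1 else 0)" if "k < CARD('n)" for k
  proof -
    have "coord b j * cnj (coord q j) = wt j" for j using assms[of j] by (simp add: q)
    then have "complex_of_real (krylov A b k \<bullet> q) = (\<Sum>j\<in>UNIV. lam j ^ k * wt j)"
      using inner_krylov[of b k q] by simp
    also have "\<dots> = (if k = CARD('n) - 1 then 1 else 0)" by (rule sum_power_wt[OF that])
    finally show ?thesis by (simp split: if_splits)
  qed
  with q show thesis by (rule that)
qed

text \<open>The distance to the hyperplane with normal vector \<open>q\<close>, on which the last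
  Krylov vector takes the value 1: the foot of the perpendicular bounds it from above, the
  Cauchy-Schwarz inequality from below.\<close>

lemma d_n_dual:
  assumes b: "\<And>j. coord b j \<noteq> 0"
    and q: "\<And>k. k < CARD('n) \<Longrightarrow> krylov A b k \<bullet> q = (if k = CARD('n) - 1 then 1 else 0)"
  shows "d_n A b = 1 / norm q"
proof -
  define m where "m = CARD('n) - 1"
  have mn: "CARD('n) = Suc m" using zero_less_card_finite[where 'a='n] by (simp add: m_def)
  define S where "S = span (krylov A b ` {..<m})"
  define a where "a = krylov A b m"
  have aq: "a \<bullet> q = 1" using q[of m] by (simp add: a_def mn)
  have "q \<noteq> 0" using aq by auto
  have Sq: "z \<bullet> q = 0" if "z \<in> S" for z
  proof -
    have "orthogonal q y" if "y \<in> krylov A b ` {..<m}" for y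
      using that q by (auto simp: orthogonal_def inner_commute[of q] mn)
    then have "orthogonal q z" using orthogonal_to_span[of z "krylov A b ` {..<m}" q] \<open>z \<in> S\<close> by (auto simp: S_def)
    then show ?thesis by (simp add: orthogonal_def inner_commute)
  qed
  define z where "z = a - (1 / (norm q)\<^sup>2) *\<^sub>R q"
  have zq: "z \<bullet> q = 0" using \<open>q \<noteq> 0\<close> aq by (simp add: z_def inner_diff_left dot_square_norm)
  have "z \<in> span (krylov A b ` {..<CARD('n)})"
    using cyclic_vector_iff[of b] b by (auto simp: cyclic_vector_def)
  then have "z \<in> span (insert a (krylov A b ` {..<m}))" by (simp add: mn lessThan_Suc a_def)
  \<comment> \<open>The foot of the perpendicular differs from an element of \<open>S\<close> by a
    multiple of \<open>a\<close>. Pairing with \<open>q\<close>, which kills \<open>z\<close> and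
    \<open>S\<close> but not \<open>a\<close>, shows that this multiple is zero.\<close>
  then obtain k where k: "z - k *\<^sub>R a \<in> S" by (auto simp: S_def span_breakdown_eq)
  have "k = 0" using Sq[OF k] zq aq by (simp add: inner_diff_left)
  then have zS: "z \<in> S" using k by simp
  have "infdist a S \<le> dist a z" by (rule infdist_le[OF zS])
  also have "dist a z = 1 / norm q" using \<open>q \<noteq> 0\<close> by (simp add: z_def dist_norm power2_eq_square)
  finally have 1: "infdist a S \<le> 1 / norm q" .
  have 2: "1 / norm q \<le> infdist a S"
  proof -
    have ne: "S \<noteq> {}" using zS by auto
    show ?thesis unfolding infdist_notempty[OF ne]
    proof (rule cINF_greatest[OF ne])
      fix z assume "z \<in> S"
      then have "(a - z) \<bullet> q = 1" using Sq[of z] aq by (simp add: inner_diff_left)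
      then have "1 \<le> norm (a - z) * norm q" using norm_cauchy_schwarz[of "a - z" q] by simp
      then show "1 / norm q \<le> dist a z" using \<open>q \<noteq> 0\<close> by (simp add: divide_le_eq dist_norm)
    qed
  qed
  have "cyclic_vector A b" using cyclic_vector_iff b by blast
  then show ?thesis using 1 2 unfolding d_n_def a_def S_def m_def by simp
qed

lemma norm_krylov_dual:
  assumes "\<And>j. coord q j = cnj (wt j / coord b j)"
  shows "(norm q)\<^sup>2 = (\<Sum>j\<in>UNIV. (norm (wt j))\<^sup>2 / weight b j)"
  using parseval_norm[of q] by (simp add: assms dot_square_norm norm_divide power_divide)

text \<open>For cyclic \<open>b\<close> this is the Cauchy-Schwarz inequality with
  \<open>y j = norm (wt j)\<close>. Otherwise some weight of \<open>b\<close> is zero, while the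
  optimal weights are all positive.\<close>

lemma d_n_le:
  assumes b: "norm b = 1"
  shows "d_n A b \<le> 1 / wt_sum"
    and "d_n A b = 1 / wt_sum \<longleftrightarrow> (\<forall>j. weight b j = norm (wt j) / wt_sum)"
proof -
  have *: "d_n A b \<le> 1 / wt_sum \<and> (d_n A b = 1 / wt_sum \<longleftrightarrow> (\<forall>j. weight b j = norm (wt j) / wt_sum))"
  proof (cases "\<forall>j. coord b j \<noteq> 0")
    case False
    then have "d_n A b = 0" unfolding d_n_def using cyclic_vector_iff[of b] by auto
    moreover obtain j0 where "coord b j0 = 0" using False by auto
    then have "weight b j0 \<noteq> norm (wt j0) / wt_sum" using wt_sum_pos wt_nonzero[of j0] by simp
    ultimately show ?thesis using wt_sum_pos by auto
  next
    case True
    define p where "p j = weight b j" for j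
    have p: "p j > 0" for j using True by (simp add: p_def)
    have p1: "(\<Sum>j\<in>UNIV. p j) = 1" unfolding p_def by (rule coord_norm_sum[OF b])
    obtain q where q: "\<And>j. coord q j = cnj (wt j / coord b j)"
      "\<And>k. k < CARD('n) \<Longrightarrow> krylov A b k \<bullet> q = (if k = CARD('n) - 1 then 1 else 0)"
      using ex_krylov_dual[of b] True by blast
    have d: "d_n A b = 1 / norm q" by (rule d_n_dual) (use True q in auto)
    have nq: "(norm q)\<^sup>2 = (\<Sum>j\<in>UNIV. (norm (wt j))\<^sup>2 / p j)" unfolding p_def by (rule norm_krylov_dual[OF q(1)])
    have "wt_sum\<^sup>2 \<le> (norm q)\<^sup>2" unfolding nq wt_sum_def by (rule sum_square_div_ge(1)[OF p p1])
    then have le: "wt_sum \<le> norm q" by (rule power2_le_imp_le) simp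
    have "(norm q = wt_sum) = (\<forall>j. p j = norm (wt j) / wt_sum)"
    proof
      assume "norm q = wt_sum"
      then have "(\<Sum>j\<in>UNIV. (norm (wt j))\<^sup>2 / p j) \<le> (\<Sum>j\<in>UNIV. norm (wt j))\<^sup>2" using nq by (simp add: wt_sum_def)
      then have "norm (wt j) = wt_sum * p j" for j unfolding wt_sum_def by (rule sum_square_div_ge(2)[OF p p1])
      then show "\<forall>j. p j = norm (wt j) / wt_sum" using wt_sum_pos by simp
    next
      assume e: "\<forall>j. p j = norm (wt j) / wt_sum"
      have "(norm (wt j))\<^sup>2 / p j = wt_sum * norm (wt j)" for j
        using e wt_nonzero[of j] wt_sum_pos by (simp add: power2_eq_square)
      then have "(norm q)\<^sup>2 = wt_sum\<^sup>2" unfolding nq by (simp add: wt_sum_def power2_eq_square flip: sum_distrib_left)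
      then show "norm q = wt_sum" using wt_sum_pos by (simp add: power2_eq_iff_nonneg)
    qed
    moreover have "1 / norm q \<le> 1 / wt_sum" using le wt_sum_pos by (intro divide_left_mono mult_pos_pos) auto
    moreover have "(1 / norm q = 1 / wt_sum) = (norm q = wt_sum)"
      using le wt_sum_pos by (subst frac_eq_eq) auto
    ultimately show ?thesis unfolding d p_def by blast
  qed
  then show "d_n A b \<le> 1 / wt_sum" "d_n A b = 1 / wt_sum \<longleftrightarrow> (\<forall>j. weight b j = norm (wt j) / wt_sum)"
    by blast+
qed

lemma ex_optimal_vector:
  obtains b where "norm b = 1" "\<And>j. weight b j = norm (wt j) / wt_sum"
  by (rule ex_unit_weights[of "\<lambda>j. norm (wt j) / wt_sum"])
    (use wt_sum_pos in \<open>auto simp: wt_\<sigma> wt_sum_def simp flip: sum_divide_distrib\<close>)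

lemma delta_n_eq: "delta_n A = 1 / wt_sum"
proof -
  obtain b where "norm b = 1" "\<And>j. weight b j = norm (wt j) / wt_sum" using ex_optimal_vector by blast
  then have "d_n A b = 1 / wt_sum" "norm b = 1" using d_n_le(2) by blast+
  then show ?thesis unfolding delta_n_def
    by (intro cSup_eq_maximum) (auto intro!: image_eqI[of _ _ b] d_n_le(1))
qed

lemma d_n_maximizers_iff:
  "norm b = 1 \<Longrightarrow> b \<in> d_n_maximizers A \<longleftrightarrow> (\<forall>j. weight b j = norm (wt j) / wt_sum)"
  using d_n_le(2)[of b] by (simp add: d_n_maximizers_def delta_n_eq)

lemma d_n_maximizers_nonempty: "d_n_maximizers A \<noteq> {}"
  using ex_optimal_vector d_n_maximizers_iff by (metis empty_iff)

text \<open>Cyclicity gives \<open>n\<close> spanning vectors in dimension \<open>n\<close>, so they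
  are distinct and independent.\<close>

lemma krylov_independent:
  assumes b: "\<And>j. coord b j \<noteq> 0" and k: "k < CARD('n)"
  shows "krylov A b k \<notin> span (krylov A b ` {..<k})"
proof -
  let ?B = "krylov A b ` {..<CARD('n)}"
  have sp: "span ?B = UNIV" using cyclic_vector_iff b unfolding cyclic_vector_def by blast
  have c: "card ?B \<le> CARD('n)" using card_image_le[of "{..<CARD('n)}" "krylov A b"] by simp
  have d: "dim (UNIV :: (real^'n) set) = CARD('n)" by simp
  have ind: "independent ?B" by (rule card_le_dim_spanning[of _ UNIV]) (use sp c d in auto)
  have "dim (span ?B) \<le> card ?B" by (simp add: dim_le_card')
  then have "card ?B = card {..<CARD('n)}" using c unfolding sp d by simp
  then have inj: "inj_on (krylov A b) {..<CARD('n)}" by (intro eq_card_imp_inj_on) auto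
  have "krylov A b ` {..<k} \<subseteq> ?B - {krylov A b k}"
    using inj k by (auto simp: inj_on_def)
  moreover have "krylov A b k \<notin> span (?B - {krylov A b k})"
    using ind k unfolding dependent_def by blast
  ultimately show ?thesis using span_mono by blast
qed

text \<open>The last column of \<open>Q\<close> and a suitable multiple of \<open>q\<close> have the
  same inner products with all Krylov vectors, hence coincide; the positive diagonal of
  \<open>R\<close> fixes the sign. This also gives the uniqueness behind the definite description in
  \<open>q_n\<close>.\<close>

lemma q_n_dual:
  assumes b: "\<And>j. coord b j \<noteq> 0"
    and q: "\<And>k. k < CARD('n) \<Longrightarrow> krylov A b k \<bullet> q = (if k = CARD('n) - 1 then 1 else 0)"
  shows "q_n A b = q /\<^sub>R norm q"
proof -
  define m where "m = CARD('n) - 1"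
  have mn: "CARD('n) = Suc m" using zero_less_card_finite[where 'a='n] by (simp add: m_def)
  have uniq: "Q m = q /\<^sub>R norm q" if QR: "is_QR (krylov A b) Q r" for Q r
  proof -
    have orth: "\<And>i j. i \<le> m \<Longrightarrow> j \<le> m \<Longrightarrow> Q i \<bullet> Q j = (if i = j then 1 else 0)"
      and kr: "\<And>j. j \<le> m \<Longrightarrow> krylov A b j = (\<Sum>i<Suc m. r i j *\<^sub>R Q i)"
      and tri: "\<And>i j. i \<le> m \<Longrightarrow> j < i \<Longrightarrow> r i j = 0" and pos: "0 < r m m"
      using QR unfolding is_QR_def mn by (auto simp: less_Suc_eq_le)
    have kQ: "krylov A b j \<bullet> Q m = r m j" if "j \<le> m" for j
    proof -
      have "krylov A b j \<bullet> Q m = (\<Sum>i<Suc m. r i j * (Q i \<bullet> Q m))"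
        by (simp add: kr[OF that] inner_sum_left inner_add_left)
      also have "\<dots> = (\<Sum>i<Suc m. if i = m then r i j else 0)"
        by (intro sum.cong refl) (use orth in auto)
      finally show ?thesis by simp
    qed
    have "Q m - r m m *\<^sub>R q = 0"
    proof (rule orthogonal_krylov_imp_zero[OF b])
      fix k assume "k < CARD('n)"
      then show "krylov A b k \<bullet> (Q m - r m m *\<^sub>R q) = 0"
        using kQ[of k] tri[of m k] q[of k] by (auto simp: inner_diff_right mn less_Suc_eq)
    qed
    then have Qm: "Q m = r m m *\<^sub>R q" by simp
    have "norm (Q m) = 1" using orth[of m m] by (simp add: norm_eq_1)
    then have "r m m * norm q = 1" using pos by (simp add: Qm)
    then have "r m m = inverse (norm q)" using inverse_unique[of "norm q" "r m m"] by (simp add: mult.commute)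
    then show ?thesis using Qm by simp
  qed
  obtain Q r where QR: "is_QR (krylov A b) Q r"
    using gram_schmidt[of "CARD('n)" "krylov A b"] krylov_independent[OF b] unfolding is_QR_def by blast
  show ?thesis unfolding q_n_def m_def[symmetric]
  proof (rule the_equality)
    show "\<exists>Q r. is_QR (krylov A b) Q r \<and> q /\<^sub>R norm q = Q m" using QR uniq[OF QR] by metis
    show "u = q /\<^sub>R norm q" if "\<exists>Q r. is_QR (krylov A b) Q r \<and> u = Q m" for u
      using that uniq by metis
  qed
qed

text \<open>The squared moduli of the coordinates of \<open>q\<close> depend only on the weights of
  \<open>b\<close>, which all maximisers share. The quadratic form is therefore constant on
  \<open>d_n_maximizers A\<close>, and the supremum is over a singleton.\<close>

lemma alpha_n_eq: "alpha_n A = wt_mean"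
proof -
  have "q_n A b \<bullet> (A *v q_n A b) = wt_mean" if "b \<in> d_n_maximizers A" for b
  proof -
    have p: "weight b j = norm (wt j) / wt_sum" for j
      using that d_n_maximizers_iff[of b] by (auto simp: d_n_maximizers_def)
    have nz: "coord b j \<noteq> 0" for j using p[of j] wt_sum_pos wt_nonzero[of j] by auto
    obtain q where q: "\<And>j. coord q j = cnj (wt j / coord b j)"
      "\<And>k. k < CARD('n) \<Longrightarrow> krylov A b k \<bullet> q = (if k = CARD('n) - 1 then 1 else 0)"
      using ex_krylov_dual[of b] nz by blast
    have cq: "weight q j = wt_sum * norm (wt j)" for j
      using wt_nonzero[of j] by (simp add: q(1) norm_divide power_divide p) (simp add: power2_eq_square)
    have nq: "(norm q)\<^sup>2 = wt_sum\<^sup>2"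
      using parseval_norm[of q] unfolding cq by (simp add: dot_square_norm power2_eq_square wt_sum_def flip: sum_distrib_left)
    have "complex_of_real (q \<bullet> (A *v q)) = (\<Sum>j\<in>UNIV. cnj (lam j) * of_real (weight q j))"
      unfolding parseval coord_mult complex_norm_square by (intro sum.cong refl) (simp add: mult_ac)
    then have "Re (complex_of_real (q \<bullet> (A *v q))) = (\<Sum>j\<in>UNIV. Re (lam j) * weight q j)"
      by simp
    then have qAq: "q \<bullet> (A *v q) = wt_sum * (\<Sum>j\<in>UNIV. norm (wt j) * Re (lam j))"
      unfolding cq by (simp add: sum_distrib_left mult_ac)
    have "q_n A b \<bullet> (A *v q_n A b) = (q \<bullet> (A *v q)) / (norm q)\<^sup>2"
      by (subst (1 2) q_n_dual[OF nz q(2)]) (simp_all add: matrix_vector_mult_scaleR power2_eq_square divide_inverse)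
    then show ?thesis unfolding qAq nq wt_mean_def using wt_sum_pos by (simp add: power2_eq_square)
  qed
  then have "(\<lambda>b. q_n A b \<bullet> (A *v q_n A b)) ` d_n_maximizers A = {wt_mean}"
    using d_n_maximizers_nonempty by auto
  then show ?thesis by (simp add: alpha_n_def)
qed

section \<open>Characteristic polynomial and trace from the eigenvalues\<close>

lemma char_fun_eq: "char_fun A z = (\<Prod>j\<in>UNIV. z - lam j)"
proof -
  define V V' :: "complex^'n^'n" where "V = (\<chi> i j. v j $ i)" and "V' = (\<chi> j i. cnj (v j $ i))"
  define D :: "complex^'n^'n" where "D = (\<chi> i j. if i = j then z - lam i else 0)"
  have "V ** V' = mat 1"
    by (simp add: V_def V'_def vec_eq_iff matrix_matrix_mult_def mat_def completeness)
  then have "det V * det V' = 1" by (metis det_I det_mul)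
  then have dV: "det V \<noteq> 0" by auto
  have "((mat z - cmat A) ** V) $ i $ j = (V ** D) $ i $ j" for i j
  proof -
    have "((mat z - cmat A) ** V) $ i $ j = (\<Sum>k\<in>UNIV. (if i = k then z * v j $ k else 0) - cmat A $ i $ k * v j $ k)"
      unfolding matrix_matrix_mult_def V_def vec_lambda_beta by (intro sum.cong refl) (simp add: mat_def left_diff_distrib)
    also have "\<dots> = z * v j $ i - (cmat A *v v j) $ i" by (simp add: sum_subtractf matrix_vector_mult_def)
    also have "\<dots> = v j $ i * (z - lam j)" by (simp add: eig algebra_simps)
    also have "\<dots> = (\<Sum>k\<in>UNIV. if k = j then v k $ i * (z - lam k) else 0)" by simp
    also have "\<dots> = (V ** D) $ i $ j"
      unfolding matrix_matrix_mult_def V_def D_def vec_lambda_beta by (intro sum.cong refl) simp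
    finally show ?thesis .
  qed
  then have "(mat z - cmat A) ** V = V ** D" by (simp add: vec_eq_iff)
  then have "char_fun A z * det V = det V * det D" unfolding char_fun_def by (metis det_mul)
  moreover have "det D = (\<Prod>j\<in>UNIV. z - lam j)" by (subst det_diagonal) (simp_all add: D_def)
  ultimately show ?thesis using dV by simp
qed

text \<open>At the root \<open>lam k\<close> the product rule leaves only the product over the other
  nodes, the denominator of \<open>wt k\<close>.\<close>

lemma norm_deriv_char_fun: "norm (deriv (char_fun A) (lam k)) = 1 / norm (wt k)"
proof -
  define g where "g z = (\<Prod>j\<in>UNIV - {k}. z - lam j)" for z
  have "g holomorphic_on UNIV" unfolding g_def by (intro holomorphic_intros)
  then have "g field_differentiable at (lam k)" by (simp add: holomorphic_on_def)
  then obtain d where d: "(g has_field_derivative d) (at (lam k))" by (auto simp: field_differentiable_def)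
  have "char_fun A = (\<lambda>z. (z - lam k) * g z)"
    by (rule ext) (simp add: char_fun_eq g_def prod.remove[of UNIV k])
  moreover have "((\<lambda>z. (z - lam k) * g z) has_field_derivative g (lam k)) (at (lam k))"
    using d by (auto intro!: derivative_eq_intros)
  ultimately have "deriv (char_fun A) (lam k) = g (lam k)" by (simp add: DERIV_imp_deriv)
  moreover have "wt k = 1 / g (lam k)" by (simp add: wt_def g_def)
  ultimately show ?thesis by (simp add: norm_divide)
qed

lemma trace_eq: "trace A = (\<Sum>j\<in>UNIV. Re (lam j))"
proof -
  have "mpow A 1 = A" by (simp add: mpow_def)
  then have "complex_of_real (trace A) = (\<Sum>a\<in>UNIV. \<Sum>l\<in>UNIV. lam l * (v l $ a * cnj (v l $ a)))"
    using mpow_entry[of 1] by (simp add: trace_def)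
  also have "\<dots> = (\<Sum>l\<in>UNIV. lam l * herm (v l) (v l))"
    unfolding herm_def sum_distrib_left by (rule sum.swap)
  finally have "complex_of_real (trace A) = (\<Sum>l\<in>UNIV. lam l)" by (simp add: herm_v)
  then show ?thesis by (metis Re_complex_of_real Re_sum)
qed

end

section \<open>Expansions at time zero\<close>

text \<open>The ball of radius \<open>R - x\<close> around \<open>x\<close> lies inside
  \<open>ball 0 R\<close>; at real arguments the real parts of the Taylor coefficients
  suffice.\<close>

lemma real_analytic_on_Re_holomorphic:
  assumes "f holomorphic_on ball 0 R"
  shows "real_analytic_on (\<lambda>t. Re (f (of_real t))) {0<..<R}"
  unfolding real_analytic_on_def
proof
  fix x assume x: "x \<in> {0<..<R}"
  have sub: "ball (of_real x) (R - x) \<subseteq> ball (0::complex) R"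
  proof
    fix z :: complex assume "z \<in> ball (of_real x) (R - x)"
    then show "z \<in> ball 0 R"
      using norm_triangle_sub[of z "of_real x"] x by (simp add: dist_norm norm_minus_commute)
  qed
  have rr: "Re (c * complex_of_real t) = Re c * t" for c t by simp
  show "\<exists>e>0. \<exists>a. \<forall>y. \<bar>y - x\<bar> < e \<longrightarrow> (\<lambda>k. a k * (y - x) ^ k) sums Re (f (of_real y))"
  proof (intro exI conjI allI impI)
    show "0 < R - x" using x by simp
    fix y assume "\<bar>y - x\<bar> < R - x"
    then have "complex_of_real y \<in> ball (of_real x) (R - x)"
      by (simp add: dist_norm abs_minus_commute flip: of_real_diff)
    from sums_Re[OF holomorphic_power_series[OF holomorphic_on_subset[OF assms sub] this]]
    show "(\<lambda>k. Re ((deriv ^^ k) f (of_real x) / fact k) * (y - x) ^ k) sums Re (f (of_real y))"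
      unfolding of_real_diff[symmetric] of_real_power[symmetric] by (simp only: rr)
  qed
qed

text \<open>Removing the singularity of the difference quotient twice writes the remainder as
  \<open>z ^ 2 * h z\<close> with \<open>h\<close> holomorphic, hence bounded near 0.\<close>

lemma holomorphic_quadratic_remainder:
  assumes f: "f holomorphic_on ball 0 R" and "R > 0" and D: "(f has_field_derivative D) (at 0)"
  shows "(\<lambda>T. Re (f (of_real T)) - (Re (f 0) + Re D * T)) \<in> O[at_right 0](\<lambda>T. T\<^sup>2)"
proof -
  define g where "g z = (if z = 0 then deriv f 0 else (f z - f 0) / (z - 0))" for z
  define h where "h z = (if z = 0 then deriv g 0 else (g z - g 0) / (z - 0))" for z
  have "g holomorphic_on ball 0 R" unfolding g_def by (rule pole_lemma_open[OF f]) simp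
  then have h: "h holomorphic_on ball 0 R" unfolding h_def by (rule pole_lemma_open) simp
  have g0: "g 0 = D" using D by (simp add: g_def DERIV_imp_deriv)
  have fz: "f z - (f 0 + D * z) = z\<^sup>2 * h z" for z
    by (simp add: h_def g0) (simp add: g_def power2_eq_square field_simps)
  have "isCont h 0"
    using holomorphic_on_imp_continuous_on[OF h] \<open>R > 0\<close> by (simp add: continuous_on_eq_continuous_at)
  then have "\<forall>\<^sub>F z in at 0. dist (h z) (h 0) < 1" unfolding isCont_def by (rule tendstoD) simp
  then obtain d where d: "d > 0" "\<And>z. z \<noteq> 0 \<Longrightarrow> norm z < d \<Longrightarrow> dist (h z) (h 0) < 1"
    by (auto simp: eventually_at)
  have "\<forall>\<^sub>F T in at_right 0. norm (Re (f (of_real T)) - (Re (f 0) + Re D * T)) \<le> (norm (h 0) + 1) * norm (T\<^sup>2)"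
    unfolding eventually_at_right_field
  proof (intro exI conjI allI impI)
    show "d > 0" by (rule d)
    fix T :: real assume T: "0 < T" "T < d"
    have "norm (h (of_real T)) \<le> norm (h 0) + 1"
      using d(2)[of "of_real T"] T norm_triangle_sub[of "h (of_real T)" "h 0"] by (simp add: dist_norm)
    then have "norm ((of_real T)\<^sup>2 * h (of_real T)) \<le> (norm (h 0) + 1) * T\<^sup>2"
      by (simp add: norm_mult norm_power mult.commute mult_right_mono)
    moreover have "Re (f (of_real T)) - (Re (f 0) + Re D * T) = Re ((of_real T)\<^sup>2 * h (of_real T))"
      unfolding fz[symmetric] by simp
    ultimately show "norm (Re (f (of_real T)) - (Re (f 0) + Re D * T)) \<le> (norm (h 0) + 1) * norm (T\<^sup>2)"
      using abs_Re_le_cmod[of "(of_real T)\<^sup>2 * h (of_real T)"] by simp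
  qed
  then show ?thesis by (rule bigoI)
qed

lemma sinhc_holomorphic: "sinhc holomorphic_on UNIV"
proof -
  have "sinhc holomorphic_on ball 0 r" for r
    by (rule power_series_holomorphic[where a = "\<lambda>k. nu k / fact k"]) (simp only: diff_zero sinhc_sums)
  then have "sinhc field_differentiable at z" for z
    by (rule holomorphic_on_imp_differentiable_at[of _ "ball 0 (norm z + 1)"]) auto
  then show ?thesis by (simp add: holomorphic_on_def)
qed

lemma DERIV_sinhc_0: "(sinhc has_field_derivative 0) (at 0)"
  by (rule even_DERIV_0[of 1])
    (use sinhc_minus sinhc_holomorphic in \<open>simp_all add: holomorphic_on_def\<close>)

lemma kappa_kappa_inv: "kappa n = 1 / kappa_inv n"
  by (simp add: kappa_def kappa_inv_def)

context unitary_spectrum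
begin

text \<open>Both functions are quotients by the sum \<open>S\<close> of all \<open>Y j\<close>. The
  logarithmic derivatives at 0 are \<open>- (Re (lam j) + wt_mean) / 2\<close> for
  \<open>Y j\<close> and \<open>- wt_mean\<close> for \<open>S\<close>; their difference explains
  the factor 1/2 in the weights.\<close>

lemma gamma_1_holomorphic_expansion:
  obtains T0 G g where "T0 > 0" "\<And>j. G j holomorphic_on ball 0 T0" "\<And>j. G j 0 = of_real (norm (wt j) / wt_sum)"
    "\<And>j. (G j has_field_derivative of_real (norm (wt j) / wt_sum * ((wt_mean - Re (lam j)) / 2))) (at 0)"
    "g holomorphic_on ball 0 T0" "g 0 = 1" "(g has_field_derivative of_real wt_mean) (at 0)"
    "\<And>T. 0 < T \<Longrightarrow> T < T0 \<Longrightarrow> of_real (gamma_1 A T) = of_real (T ^ (2 * CARD('n) - 1) / (kappa_inv CARD('n) * wt_sum\<^sup>2)) * g (of_real T)"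
    "\<And>T. 0 < T \<Longrightarrow> T < T0 \<Longrightarrow> gamma_1_maximizers A T \<noteq> {}"
    "\<And>T b j. 0 < T \<Longrightarrow> T < T0 \<Longrightarrow> b \<in> gamma_1_maximizers A T \<Longrightarrow> spectral_weights v b j = Re (G j (of_real T))"
proof -
  let ?n = "CARD('n)"
  obtain R Y where R: "R > 0" and hY: "\<And>j. Y j holomorphic_on ball 0 R"
    and Y0: "\<And>j. Y j 0 = of_real (kappa_inv ?n * norm (wt j) * wt_sum)"
    and dY: "\<And>j. (Y j has_field_derivative
        of_real (- (kappa_inv ?n * norm (wt j) * wt_sum * (Re (lam j) + wt_mean) / 2))) (at 0)"
    and cert: "\<And>T. 0 < T \<Longrightarrow> T < R \<Longrightarrow> \<exists>y. certifies T y \<and> (\<forall>j. Y j (of_real T) = of_real (y j))"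
    using certificate by blast
  define K where "K = kappa_inv ?n"
  define H where "H = wt_sum"
  have KH: "K > 0" "H > 0" by (simp_all add: K_def H_def kappa_inv_pos wt_sum_pos)
  have Hs: "(\<Sum>j\<in>UNIV. norm (wt j)) = H" by (simp add: H_def wt_sum_def)
  have Ha: "(\<Sum>j\<in>UNIV. norm (wt j) * Re (lam j)) = H * wt_mean" using KH by (simp add: H_def wt_mean_def)
  define S where "S z = (\<Sum>j\<in>UNIV. Y j z)" for z
  have hS: "S holomorphic_on ball 0 R" unfolding S_def by (intro holomorphic_intros hY)
  have S0: "S 0 = of_real (K * H\<^sup>2)"
  proof -
    have "(\<Sum>j\<in>UNIV. K * norm (wt j) * H) = K * H\<^sup>2"
      unfolding sum_distrib_left[symmetric] sum_distrib_right[symmetric] Hs by (simp add: power2_eq_square)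
    then show ?thesis unfolding S_def Y0 K_def[symmetric] H_def[symmetric] of_real_sum[symmetric] by simp
  qed
  have dS: "(S has_field_derivative of_real (- (K * H\<^sup>2 * wt_mean))) (at 0)"
  proof -
    have "(\<Sum>j\<in>UNIV. - (K * norm (wt j) * H * (Re (lam j) + wt_mean) / 2)) =
        - (K * H / 2 * ((\<Sum>j\<in>UNIV. norm (wt j) * Re (lam j)) + (\<Sum>j\<in>UNIV. norm (wt j)) * wt_mean))"
      unfolding sum_distrib_right sum.distrib[symmetric] sum_distrib_left sum_negf[symmetric]
      by (intro sum.cong refl) (simp add: algebra_simps)
    also have "\<dots> = - (K * H\<^sup>2 * wt_mean)" unfolding Ha Hs by (simp add: power2_eq_square)
    finally have "(\<Sum>j\<in>UNIV. complex_of_real (- (K * norm (wt j) * H * (Re (lam j) + wt_mean) / 2))) = of_real (- (K * H\<^sup>2 * wt_mean))"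
      unfolding of_real_sum[symmetric] by simp
    moreover have "(S has_field_derivative (\<Sum>j\<in>UNIV. complex_of_real (- (K * norm (wt j) * H * (Re (lam j) + wt_mean) / 2)))) (at 0)"
      unfolding S_def K_def H_def by (intro DERIV_sum dY)
    ultimately show ?thesis by simp
  qed
  have S0n: "S 0 \<noteq> 0" unfolding S0 using KH by simp
  then obtain r where r: "r > 0" "\<And>z. norm z < r \<Longrightarrow> z \<in> ball 0 R \<Longrightarrow> S z \<noteq> 0"
    using continuous_on_open_avoid[OF holomorphic_on_imp_continuous_on[OF hS] open_ball, of 0 0] R
    by (auto simp: continuous_on_avoid)
  define T0 where "T0 = min R r"
  have T0: "T0 > 0" "T0 \<le> R" using R r by (auto simp: T0_def)
  have Sn: "S z \<noteq> 0" if "z \<in> ball 0 T0" for z using that r(2)[of z] by (auto simp: T0_def)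
  define G where "G j z = Y j z / S z" for j z
  define g where "g z = of_real (K * H\<^sup>2) / S z" for z
  have sub: "ball 0 T0 \<subseteq> ball (0::complex) R" using T0 by auto
  show thesis
  proof (rule that[of T0 G g])
    show "T0 > 0" by (rule T0)
    show "G j holomorphic_on ball 0 T0" for j
      unfolding G_def using Sn by (intro holomorphic_on_divide holomorphic_on_subset[OF hY sub] holomorphic_on_subset[OF hS sub])
    show "g holomorphic_on ball 0 T0"
      unfolding g_def using Sn by (intro holomorphic_on_divide holomorphic_on_const holomorphic_on_subset[OF hS sub])
    show "G j 0 = of_real (norm (wt j) / wt_sum)" for j
      using KH by (simp add: G_def Y0 S0 K_def[symmetric] H_def[symmetric] power2_eq_square)
    show "g 0 = 1" using KH by (simp add: g_def S0)
    show "(g has_field_derivative of_real wt_mean) (at 0)"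
      unfolding g_def
      by (rule DERIV_cong[OF DERIV_divide[OF DERIV_const dS S0n]]) (use KH in \<open>simp add: S0 power2_eq_square\<close>)
    show "(G j has_field_derivative of_real (norm (wt j) / wt_sum * ((wt_mean - Re (lam j)) / 2))) (at 0)" for j
      unfolding G_def
    proof (rule DERIV_cong[OF DERIV_divide[OF dY dS S0n]])
      define s where "s = norm (wt j)"
      have "(- (K * s * H * (Re (lam j) + wt_mean) / 2) * (K * H\<^sup>2) - K * s * H * - (K * H\<^sup>2 * wt_mean)) / (K * H\<^sup>2 * (K * H\<^sup>2)) =
          s / H * ((wt_mean - Re (lam j)) / 2)"
        using KH by (simp add: power2_eq_square field_simps)
      from arg_cong[OF this, of complex_of_real]
      show "(of_real (- (kappa_inv ?n * norm (wt j) * wt_sum * (Re (lam j) + wt_mean) / 2)) * S 0 -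
           Y j 0 * of_real (- (K * H\<^sup>2 * wt_mean))) / (S 0 * S 0) = of_real (norm (wt j) / wt_sum * ((wt_mean - Re (lam j)) / 2))"
        unfolding S0 Y0 K_def[symmetric] H_def[symmetric] s_def of_real_divide of_real_diff of_real_mult[symmetric] .
    qed
  next
    fix T assume T: "0 < T" "T < T0"
    then have "T < R" using T0 by simp
    obtain y where y: "certifies T y" and yc: "\<And>j. Y j (of_real T) = of_real (y j)"
      using cert[OF T(1) \<open>T < R\<close>] by auto
    note g1 = gamma_1_from_certificate[OF T(1) y]
    have ST: "S (of_real T) = of_real (\<Sum>j\<in>UNIV. y j)" by (simp add: S_def yc)
    show "gamma_1_maximizers A T \<noteq> {}" by (rule g1(2))
    show "spectral_weights v b j = Re (G j (of_real T))" if "b \<in> gamma_1_maximizers A T" for b j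
      using g1(3)[OF that, of j] unfolding G_def ST yc of_real_divide[symmetric] by simp
    show "of_real (gamma_1 A T) = of_real (T ^ (2 * ?n - 1) / (kappa_inv ?n * wt_sum\<^sup>2)) * g (of_real T)"
      unfolding g1(1) g_def ST K_def[symmetric] H_def[symmetric] of_real_divide[symmetric] of_real_mult[symmetric]
      using KH by simp
  qed
qed

text \<open>\<open>F j\<close> extends \<open>rho T j / T\<close> to complex arguments. As
  \<open>sinhc\<close> is even, only the midpoint factor contributes to the derivative at 0.\<close>

lemma rho_holomorphic_expansion:
  obtains T1 F where "T1 > 0" "\<And>j. F j holomorphic_on ball 0 T1" "\<And>j z. z \<in> ball 0 T1 \<Longrightarrow> F j z \<noteq> 0"
    "\<And>j. F j 0 = 1" "\<And>j. (F j has_field_derivative of_real (Re (lam j))) (at 0)"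
    "\<And>T j. of_real (rho T j) = of_real T * F j (of_real T)"
proof -
  define l where "l j = lam j + cnj (lam j)" for j
  have l: "l j = of_real (2 * Re (lam j))" for j by (simp add: l_def complex_add_cnj)
  define F where "F j z = exp (l j * (z / 2)) * sinhc (z * l j)" for j z
  have sc: "(\<lambda>z. sinhc (z * c)) holomorphic_on S" for c S
  proof -
    have "(\<lambda>z. z * c) holomorphic_on S" by (intro holomorphic_intros)
    from holomorphic_on_compose_gen[OF this sinhc_holomorphic] show ?thesis by (simp add: o_def)
  qed
  have hF: "F j holomorphic_on S" for j S unfolding F_def by (intro holomorphic_intros sc) auto
  have F0: "F j 0 = 1" for j by (simp add: F_def sinhc_def)
  have ds: "((\<lambda>z. sinhc (z * c)) has_field_derivative 0) (at 0)" for c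
  proof -
    have 1: "((\<lambda>z. z * c) has_field_derivative c) (at 0)" by (auto intro!: derivative_eq_intros)
    have 2: "(sinhc has_field_derivative 0) (at (0 * c))" using DERIV_sinhc_0 by simp
    show ?thesis using DERIV_chain2[OF 2 1] by simp
  qed
  have dF: "(F j has_field_derivative of_real (Re (lam j))) (at 0)" for j
  proof -
    have "((\<lambda>z. exp (l j * (z / 2))) has_field_derivative l j / 2) (at 0)"
      by (auto intro!: derivative_eq_intros)
    from DERIV_cong[OF DERIV_mult[OF this ds], of "l j" "of_real (Re (lam j))"]
    show ?thesis unfolding F_def by (simp add: l sinhc_def)
  qed
  have "\<forall>\<^sub>F z in at 0. \<forall>j. dist (F j z) 1 < 1"
  proof (rule eventually_all_finite)
    fix j
    have "(F j \<longlongrightarrow> F j 0) (at 0)" using DERIV_isCont[OF dF] by (simp add: isCont_def)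
    then show "\<forall>\<^sub>F z in at 0. dist (F j z) 1 < 1" using tendstoD[of "F j" 1 "at 0" 1] by (simp add: F0)
  qed
  then obtain d where d: "d > 0" "\<And>z j. z \<noteq> 0 \<Longrightarrow> norm z < d \<Longrightarrow> dist (F j z) 1 < 1"
    by (auto simp: eventually_at)
  have nz: "F j z \<noteq> 0" if "z \<in> ball 0 d" for j z
    using d(2)[of z j] that F0[of j] by (cases "z = 0") auto
  have "of_real (rho T j) = of_real T * F j (of_real T)" for T j
  proof -
    have "expint T j j = of_real (rho T j)"
      using expint_hermitian[of T j j] by (simp add: rho_def complex_eq_iff)
    then show ?thesis by (simp add: expint_def expgram_def F_def l_def mult.assoc)
  qed
  with d(1) hF nz F0 dF show thesis by (rule that)
qed

lemma gamma_expansions: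
  fixes n :: nat
  defines "n \<equiv> CARD('n)"
  shows "\<exists>T0>0. \<exists>p :: real \<Rightarrow> 'n \<Rightarrow> real.
        (\<forall>T. 0 < T \<and> T < T0 \<longrightarrow>
           gamma_1_maximizers A T \<noteq> {} \<and>
           (\<forall>b\<in>gamma_1_maximizers A T. \<forall>j. spectral_weights v b j = p T j)) \<and>
        (\<forall>j. real_analytic_on (\<lambda>T. p T j) {0<..<T0}) \<and>
        (\<forall>j. (\<lambda>T. p T j - norm (wt j) / wt_sum * (1 + (wt_mean - Re (lam j)) / 2 * T))
               \<in> O[at_right 0](\<lambda>T. T\<^sup>2))" (is ?weights)
    and "\<exists>r \<in> O[at_right 0](\<lambda>T. T\<^sup>2). \<forall>\<^sub>F T in at_right 0.
        gamma_1 A T = kappa n * (1 / wt_sum)\<^sup>2 * T ^ (2 * n - 1) * (1 + wt_mean * T + r T)" (is ?gamma)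
    and "\<exists>r \<in> O[at_right 0](\<lambda>T. T\<^sup>2). \<forall>\<^sub>F T in at_right 0.
        gamma_1 A T / gamma_rel A T =
          real n * kappa n * (1 / wt_sum)\<^sup>2 * T ^ (2 * n - 2) * (1 + (wt_mean - trace A / real n) * T + r T)" (is ?ratio)
proof -
  obtain T0 G g where T0: "T0 > 0" and G: "\<And>j. G j holomorphic_on ball 0 T0" "\<And>j. G j 0 = of_real (norm (wt j) / wt_sum)"
    "\<And>j. (G j has_field_derivative of_real (norm (wt j) / wt_sum * ((wt_mean - Re (lam j)) / 2))) (at 0)"
    and g: "g holomorphic_on ball 0 T0" "g 0 = 1" "(g has_field_derivative of_real wt_mean) (at 0)"
    and gam: "\<And>T. 0 < T \<Longrightarrow> T < T0 \<Longrightarrow> of_real (gamma_1 A T) = of_real (T ^ (2 * n - 1) / (kappa_inv n * wt_sum\<^sup>2)) * g (of_real T)"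
    and max: "\<And>T. 0 < T \<Longrightarrow> T < T0 \<Longrightarrow> gamma_1_maximizers A T \<noteq> {}"
      "\<And>T b j. 0 < T \<Longrightarrow> T < T0 \<Longrightarrow> b \<in> gamma_1_maximizers A T \<Longrightarrow> spectral_weights v b j = Re (G j (of_real T))"
    using gamma_1_holomorphic_expansion unfolding n_def by blast
  obtain T1 F where T1: "T1 > 0" and F: "\<And>j. F j holomorphic_on ball 0 T1" "\<And>j z. z \<in> ball 0 T1 \<Longrightarrow> F j z \<noteq> 0"
    "\<And>j. F j 0 = 1" "\<And>j. (F j has_field_derivative of_real (Re (lam j))) (at 0)"
    and rF: "\<And>T j. of_real (rho T j) = of_real T * F j (of_real T)"
    using rho_holomorphic_expansion by blast
  have n0: "n > 0" by (simp add: n_def)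
  have rr: "Re (complex_of_real a * z) = a * Re z" for a z by simp
  have pw: "kappa n * (1 / wt_sum)\<^sup>2 * T ^ (2 * n - 1) = T ^ (2 * n - 1) / (kappa_inv n * wt_sum\<^sup>2)" for T
    by (simp add: kappa_kappa_inv power_divide)
  show ?weights
  proof (intro exI conjI allI impI ballI)
    show "T0 > 0" by (rule T0)
    show "gamma_1_maximizers A T \<noteq> {}" if "0 < T \<and> T < T0" for T using that max by blast
    show "spectral_weights v b j = Re (G j (of_real T))" if "0 < T \<and> T < T0" "b \<in> gamma_1_maximizers A T" for T b j
      using that max by blast
    show "real_analytic_on (\<lambda>T. Re (G j (of_real T))) {0<..<T0}" for j
      by (rule real_analytic_on_Re_holomorphic[OF G(1)])
    fix j
    have e: "Re (G j 0) + Re (of_real (norm (wt j) / wt_sum * ((wt_mean - Re (lam j)) / 2))) * T =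
        norm (wt j) / wt_sum * (1 + (wt_mean - Re (lam j)) / 2 * T)" for T
      unfolding G(2) Re_complex_of_real by (simp add: distrib_left)
    show "(\<lambda>T. Re (G j (of_real T)) - norm (wt j) / wt_sum * (1 + (wt_mean - Re (lam j)) / 2 * T)) \<in> O[at_right 0](\<lambda>T. T\<^sup>2)"
      using holomorphic_quadratic_remainder[OF G(1)[of j] T0 G(3)[of j]] unfolding e .
  qed
  show ?gamma
  proof (rule bexI)
    show "(\<lambda>T. Re (g (of_real T)) - (1 + wt_mean * T)) \<in> O[at_right 0](\<lambda>T. T\<^sup>2)"
      using holomorphic_quadratic_remainder[OF g(1) T0 g(3)] by (simp add: g(2))
    show "\<forall>\<^sub>F T in at_right 0. gamma_1 A T = kappa n * (1 / wt_sum)\<^sup>2 * T ^ (2 * n - 1) *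
        (1 + wt_mean * T + (Re (g (of_real T)) - (1 + wt_mean * T)))"
      unfolding eventually_at_right_field
    proof (intro exI conjI allI impI)
      fix T assume T: "0 < T" "T < T0"
      show "gamma_1 A T = kappa n * (1 / wt_sum)\<^sup>2 * T ^ (2 * n - 1) * (1 + wt_mean * T + (Re (g (of_real T)) - (1 + wt_mean * T)))"
        using arg_cong[OF gam[OF T], of Re] unfolding pw by (simp only: Re_complex_of_real rr) simp
    qed (rule T0)
  qed
  define T2 where "T2 = min T0 T1"
  have T2: "T2 > 0" "ball 0 T2 \<subseteq> ball (0::complex) T0" "ball 0 T2 \<subseteq> ball (0::complex) T1"
    using T0 T1 by (auto simp: T2_def)
  \<comment> \<open>\<open>gamma_rel A T\<close> is the reciprocal of the sum of
    \<open>1 / rho T j\<close>, each term being \<open>1 / T\<close> times \<open>1 / F j\<close>.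
    Dividing by \<open>n\<close> normalises \<open>q\<close> to 1 at 0; the derivatives of
    \<open>1 / F j\<close> average to \<open>- trace A / n\<close>.\<close>
  define q where "q z = g z * ((\<Sum>j\<in>UNIV. 1 / F j z) / of_nat n)" for z
  have hq: "q holomorphic_on ball 0 T2"
    unfolding q_def using F(2) T2 n0
    by (intro holomorphic_intros holomorphic_on_subset[OF F(1) T2(3)] holomorphic_on_subset[OF g(1) T2(2)]) auto
  have s0: "(\<Sum>j\<in>(UNIV::'n set). 1 / F j 0) / of_nat n = 1" using n0 by (simp add: F(3) n_def)
  have q0: "q 0 = 1" unfolding q_def s0 g(2) by simp
  have dq: "(q has_field_derivative of_real (wt_mean - trace A / real n)) (at 0)"
  proof -
    have "((\<lambda>z. 1 / F j z) has_field_derivative - of_real (Re (lam j))) (at 0)" for j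
      by (rule DERIV_cong[OF DERIV_divide[OF DERIV_const F(4)]]) (simp_all add: F(3))
    then have "((\<lambda>z. (\<Sum>j\<in>UNIV. 1 / F j z) / of_nat n) has_field_derivative (\<Sum>j\<in>UNIV. - of_real (Re (lam j))) / of_nat n) (at 0)"
      by (intro DERIV_cdivide DERIV_sum)
    from DERIV_mult[OF g(3) this]
    have "(q has_field_derivative of_real wt_mean * ((\<Sum>j\<in>UNIV. 1 / F j 0) / of_nat n) +
        (\<Sum>j\<in>UNIV. - of_real (Re (lam j))) / of_nat n * g 0) (at 0)" unfolding q_def .
    then show ?thesis unfolding s0 g(2) by (simp add: trace_eq sum_negf)
  qed
  show ?ratio
  proof (rule bexI)
    show "(\<lambda>T. Re (q (of_real T)) - (1 + (wt_mean - trace A / real n) * T)) \<in> O[at_right 0](\<lambda>T. T\<^sup>2)"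
      using holomorphic_quadratic_remainder[OF hq T2(1) dq] unfolding q0 Re_complex_of_real by simp
    show "\<forall>\<^sub>F T in at_right 0. gamma_1 A T / gamma_rel A T = real n * kappa n * (1 / wt_sum)\<^sup>2 * T ^ (2 * n - 2) *
        (1 + (wt_mean - trace A / real n) * T + (Re (q (of_real T)) - (1 + (wt_mean - trace A / real n) * T)))"
      unfolding eventually_at_right_field
    proof (intro exI conjI allI impI)
      fix T assume T: "0 < T" "T < T2"
      then have T': "T < T0" by (simp add: T2_def)
      define w where "w = T ^ (2 * n - 1) / (kappa_inv n * wt_sum\<^sup>2)"
      have "2 * n - 1 = Suc (2 * n - 2)" using n0 by arith
      then have w: "real n * kappa n * (1 / wt_sum)\<^sup>2 * T ^ (2 * n - 2) = w * real n / T"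
        using T by (simp add: w_def kappa_kappa_inv power_divide)
      have F1: "1 / complex_of_real (rho T j) = (1 / F j (of_real T)) / of_real T" for j by (simp add: rF)
      have "complex_of_real (gamma_1 A T / gamma_rel A T) = of_real (gamma_1 A T) * (\<Sum>j\<in>UNIV. 1 / of_real (rho T j))"
        by (simp add: gamma_rel_eq[OF T(1)])
      also have "\<dots> = (of_real w * g (of_real T)) * ((\<Sum>j\<in>UNIV. 1 / F j (of_real T)) / of_real T)"
        unfolding gam[OF T(1) T'] F1 w_def[symmetric] sum_divide_distrib by (rule refl)
      also have "\<dots> = of_real (w * real n / T) * q (of_real T)"
        using n0 by (simp add: q_def)
      finally have "gamma_1 A T / gamma_rel A T = w * real n / T * Re (q (of_real T))"
        by (metis Re_complex_of_real rr)
      then show "gamma_1 A T / gamma_rel A T = real n * kappa n * (1 / wt_sum)\<^sup>2 * T ^ (2 * n - 2) *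
        (1 + (wt_mean - trace A / real n) * T + (Re (q (of_real T)) - (1 + (wt_mean - trace A / real n) * T)))"
        unfolding w by simp
    qed (rule T2)
  qed
qed

end

theorem proposition2p6:
  fixes A :: "real^'n^'n"
    and v :: "'n \<Rightarrow> complex^'n"
    and lam :: "'n \<Rightarrow> complex"
    and h :: "'n \<Rightarrow> real"
    and H :: real
    and pistar :: "'n \<Rightarrow> real"
    and n :: nat
  defines "n \<equiv> CARD('n)"
  assumes "normal_matrix A"
    and "simple_spectrum (cmat A)"
    and "unitary_eigenbasis A v lam"
  defines "h \<equiv> \<lambda>k. norm (deriv (char_fun A) (lam k))"
    and "H \<equiv> (\<Sum>k\<in>UNIV. 1 / h k)"
    and "pistar \<equiv> \<lambda>j. 1 / (H * h j)"
  shows "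
    (d_n_maximizers A \<noteq> {} \<and>
      (\<forall>b. norm b = 1 \<longrightarrow>
         (b \<in> d_n_maximizers A \<longleftrightarrow> (\<forall>j. spectral_weights v b j = pistar j)))) \<and>
    (\<exists>T0>0. \<exists>p :: real \<Rightarrow> 'n \<Rightarrow> real.
        (\<forall>T. 0 < T \<and> T < T0 \<longrightarrow>
           gamma_1_maximizers A T \<noteq> {} \<and>
           (\<forall>b\<in>gamma_1_maximizers A T. \<forall>j. spectral_weights v b j = p T j)) \<and>
        (\<forall>j. real_analytic_on (\<lambda>T. p T j) {0<..<T0}) \<and>
        (\<forall>j. (\<lambda>T. p T j - pistar j * (1 + (alpha_n A - Re (lam j)) / 2 * T))
               \<in> O[at_right 0](\<lambda>T. T\<^sup>2))) \<and>
    (delta_n A = 1 / H) \<and>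
    (alpha_n A = 1 / H * (\<Sum>j\<in>UNIV. Re (lam j) / h j)) \<and>
    (\<exists>r \<in> O[at_right 0](\<lambda>T. T\<^sup>2). \<forall>\<^sub>F T in at_right 0.
        gamma_1 A T =
          kappa n * (delta_n A)\<^sup>2 * T ^ (2 * n - 1) * (1 + alpha_n A * T + r T)) \<and>
    (\<exists>r \<in> O[at_right 0](\<lambda>T. T\<^sup>2). \<forall>\<^sub>F T in at_right 0.
        gamma_1 A T / gamma_rel A T =
          real n * kappa n * (delta_n A)\<^sup>2 * T ^ (2 * n - 2) *
            (1 + (alpha_n A - trace A / real n) * T + r T))"
proof -
  interpret unitary_spectrum A v lam by unfold_locales fact+
  \<comment> \<open>This translates the quantities of the statement: \<open>H\<close> is
    \<open>wt_sum\<close>, and \<open>pistar\<close> is the normalised modulus of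
    \<open>wt\<close>.\<close>
  have h: "1 / h k = norm (wt k)" for k unfolding h_def norm_deriv_char_fun by simp
  have H: "H = wt_sum" unfolding H_def h wt_sum_def by (rule refl)
  have pistar: "pistar j = norm (wt j) / wt_sum" for j
    unfolding pistar_def H using h[of j] by (simp add: divide_inverse mult.commute)
  have alpha: "alpha_n A = wt_mean" by (rule alpha_n_eq)
  have "(\<Sum>j\<in>UNIV. Re (lam j) / h j) = (\<Sum>j\<in>UNIV. norm (wt j) * Re (lam j))"
    by (intro sum.cong refl) (simp add: h[symmetric])
  then have alpha': "alpha_n A = 1 / H * (\<Sum>j\<in>UNIV. Re (lam j) / h j)"
    unfolding alpha H wt_mean_def by simp
  have opt: "\<forall>b. norm b = 1 \<longrightarrow> (b \<in> d_n_maximizers A \<longleftrightarrow> (\<forall>j. spectral_weights v b j = pistar j))"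
    using d_n_maximizers_iff by (simp add: spectral_weights_coord pistar)
  have delta: "delta_n A = 1 / H" unfolding H by (rule delta_n_eq)
  show ?thesis
    by (intro conjI d_n_maximizers_nonempty opt delta alpha')
      (unfold pistar alpha delta_n_eq n_def, (rule gamma_expansions)+)
qed

end
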